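(* For each Q-datum $\mathcal{Q}$ for $\mathfrak{g}$, the homomorphism $\mathrm{wt}_{\mathcal{Q}}:\mathcal{M}\to\mathsf{Q}$ induces an isomorphism of abelian groups $\mathcal{M}/\mathcal{M}_A\simeq\mathsf{Q}$.
   Context: Basic notation. Let $\mathsf{g}$ be a finite-dimensional complex simple Lie algebra of type ADE with Dynkin diagram $\Delta$ (vertex set $\Delta_0$; $\imath\sim\jmath$ means adjacent). $\mathsf{P}=\bigoplus_{\imath\in\Delta_0}\mathbb{Z}\varpi_\imath$ is the weight lattice, $\alpha_\imath$ the simple roots, $\mathsf{Q}=\bigoplus_\imath\mathbb{Z}\alpha_\imath$ the root lattice of $\mathsf{g}$, $(\cdot,\cdot)$ the symmetric form with $(\varpi_\imath,\alpha_\jmath)=\delta_{\imath\jmath}$, $\mathsf{W}$ the Weyl group generated by $s_\imath(\lambda)=\lambda-(\lambda,\alpha_\imath)\alpha_\imath$, $\mathsf{R}=\mathsf{R}^+\sqcup\mathsf{R}^-$ the roots. Let $\sigma$ be an automorphism of $\Delta$ such that there is no $\imath$ with $\imath\sim\sigma(\imath)$, of order $r\in\{1,2,3\}$; $\sigma(\varpi_\imath)=\varpi_{\sigma(\imath)}$. Let $I$ be the set of $\sigma$-orbits, $\imath\mapsto\bar\imath$ the quotient map, $d_i=|i|\in\{1,r\}$. Write $i\sim j$ in $I$ if some representatives are adjacent; $c_{ii}=2$, $c_{ij}=-\lceil d_j/d_i\rceil$ if $i\sim j$, $c_{ij}=0$ otherwise. Then $(c_{ij})$ is the Cartan matrix of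 a complex simple Lie algebra $\mathfrak{g}$; every $\mathfrak{g}$ arises so: $\sigma=\mathrm{id}$, $\mathfrak{g}=\mathsf{g}$ if simply-laced, otherwise $(\mathsf{g},r,\mathfrak{g})=(A_{2n-1},2,B_n),(D_{n+1},2,C_n),(E_6,2,F_4),(D_4,3,G_2)$. $(\Delta,\sigma)$ is fixed. Q-data. A height function is $\xi:\Delta_0\to\mathbb{Z}$ such that (a) $|\xi_\imath-\xi_\jmath|=d_{\bar\imath}$ whenever $\imath\sim\jmath$ and $d_{\bar\imath}=d_{\bar\jmath}$; (b) for $i\sim j$ in $I$ with $d_i<d_j$ (so $d_i=1$, $d_j=r$, $i=\{\imath\}$), there is a unique $j^\circ\in j$ with $|\xi_\imath-\xi_{j^\circ}|=1$ and $\xi_{\sigma^l(j^\circ)}=\xi_{j^\circ}-2l$ for $0\le l<r$. A Q-datum for $\mathfrak{g}$ is $\mathcal{Q}=(\Delta,\sigma,\xi)$. Fix a $\sigma$-parity function: integers $\epsilon_\imath$, $0\le\epsilon_\imath<2d_{\bar\imath}$, with $\epsilon_{\imath}\equiv\epsilon_{\imath'}\pmod 2$ if $\bar\imath=\bar\imath'$; $\epsilon_{\sigma^l(\imath)}\equiv\epsilon_\imath-2l\pmod{2d_{\bar\imath}}$; $\epsilon_\imath\equiv\epsilon_\jmath+\min(d_{\bar\imath},d_{\bar\jmath})\pmod{2\min(d_{\bar\imath},d_{\bar\jmath})}$ if $\imath\sim\jmath$. All height functions are also required to satisfy (c) $\xi_\imath-\epsilon_\imath\in2d_{\bar\imath}\mathbb{Z}$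 (achievable by adding a constant). Repetition quiver. $\widehat\Delta^\sigma$ has vertex set $\widehat\Delta^\sigma_0=\{(\imath,p)\in\Delta_0\times\mathbb{Z}\mid p-\epsilon_\imath\in2d_{\bar\imath}\mathbb{Z}\}$ and arrows $(\imath,p)\to(\jmath,s)$ whenever $\imath\sim\jmath$, $s-p=\min(d_{\bar\imath},d_{\bar\jmath})$; $\pi(\imath,p)=\imath$. For finite $X\subset\widehat\Delta^\sigma_0$, order it as $(x_1,\dots,x_l)$ with $k<k'$ whenever there is an arrow $x_{k'}\to x_k$ and put $w[X]=s_{\pi(x_1)}\cdots s_{\pi(x_l)}$ (well defined). Generalized twisted Coxeter element and bijections. For $i\in I$ let $i^\circ\in i$ be the unique element maximizing $\xi$ on $i$. $X^\circ_{\mathcal{Q}}=\{(i^\circ,\xi_{i^\circ})\mid i\in I\}$, $\tau^\circ_{\mathcal{Q}}=w[X^\circ_{\mathcal{Q}}]\sigma$, $X'_{\mathcal{Q}}=\{(\sigma(i^\circ),p)\in\widehat\Delta^\sigma_0\mid i\in I,\ \xi_{\sigma(i^\circ)}<p\le\xi_{i^\circ}-2\}$, $\tau_{\mathcal{Q}}=w[X'_{\mathcal{Q}}]^{-1}\tau^\circ_{\mathcal{Q}}w[X'_{\mathcal{Q}}]$, $\gamma^{\mathcal{Q}}_\imath=(1-\tau_{\mathcal{Q}}^{d_{\bar\imath}})\varpi_\imath\in\mathsf{R}^+$. With $\widehat{\mathsf{R}}^+=\mathsf{R}^+\times\mathbb{Z}$, the bijection $\phi_{\mathcal{Q}}:\widehat\Delta^\sigma_0\to\widehat{\mathsf{R}}^+$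 is given by $\phi_{\mathcal{Q}}(\imath,\xi_\imath)=(\gamma^{\mathcal{Q}}_\imath,0)$ and, if $\phi_{\mathcal{Q}}(\imath,p)=(\beta,k)$, $\phi_{\mathcal{Q}}(\imath,p\pm2d_{\bar\imath})=(\tau_{\mathcal{Q}}^{\mp d_{\bar\imath}}\beta,k)$ if $\tau_{\mathcal{Q}}^{\mp d_{\bar\imath}}\beta\in\mathsf{R}^+$, $=(-\tau_{\mathcal{Q}}^{\mp d_{\bar\imath}}\beta,k\pm1)$ otherwise. Let $\epsilon_i\in\{0,1\}$, $\epsilon_i\equiv\epsilon_\imath\pmod2$ for $\imath\in i$, and $\widehat I=\{(i,p)\in I\times\mathbb{Z}\mid p-\epsilon_i\in2\mathbb{Z}\}$. The map $f:\widehat\Delta^\sigma_0\to\widehat I$, $(\imath,p)\mapsto(\bar\imath,p)$, is a bijection; $\bar\phi_{\mathcal{Q}}=\phi_{\mathcal{Q}}\circ f^{-1}:\widehat I\to\widehat{\mathsf{R}}^+$. $\mathcal{Q}$-weights. $\mathcal{M}$ is the (multiplicative) free abelian group on symbols $Y_{i,p}$, $(i,p)\in\widehat I$. $\mathrm{wt}_{\mathcal{Q}}:\mathcal{M}\to\mathsf{Q}$ is the group homomorphism with $\mathrm{wt}_{\mathcal{Q}}(Y_{i,p})=(-1)^k\alpha$ if $\bar\phi_{\mathcal{Q}}(i,p)=(\alpha,k)$. $\mathcal{M}_A\subset\mathcal{M}$ is the subgroup generated by the elements $$A_{i,p}=Y_{i,p-d_i}Y_{i,p+d_i}\Bigl(\prod_{j:c_{ji}=-1}Y_{j,p}^{-1}\Bigr)\Bigl(\prod_{j:c_{ji}=-2}Y_{j,p-1}^{-1}Y_{j,p+1}^{-1}\Bigr)\Bigl(\prod_{j:c_{ji}=-3}Y_{j,p-2}^{-1}Y_{j,p}^{-1}Y_{j,p+2}^{-1}\Bigr)$$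 for all $(i,p)\in I\times\mathbb{Z}$ with $(i,p-d_i)\in\widehat I$. *)

theory Defs
  imports
    Complex_Main
    "HOL-Algebra.Free_Abelian_Groups"
    "HOL-Combinatorics.Orbits"
    "HOL-Number_Theory.Cong"
begin

section \<open>Dynkin diagrams of type ADE and their automorphisms\<close>

text \<open>Diagrams are graphs on a finite type of vertices. The standard ones have vertices
  \<open>{1..n}\<close> with the Bourbaki labelling; each edge is listed once, smaller vertex first.\<close>

definition A_edge :: "nat \<Rightarrow> nat \<Rightarrow> nat \<Rightarrow> bool" where
  "A_edge n a b \<longleftrightarrow> b = a + 1"

definition D_edge :: "nat \<Rightarrow> nat \<Rightarrow> nat \<Rightarrow> bool" where
  "D_edge n a b \<longleftrightarrow> (b = a + 1 \<and> b < n) \<or> (a + 2 = n \<and> b = n)"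

definition E_edge :: "nat \<Rightarrow> nat \<Rightarrow> nat \<Rightarrow> bool" where
  "E_edge n a b \<longleftrightarrow> (a = 1 \<and> b = 3) \<or> (a = 2 \<and> b = 4) \<or> (3 \<le> a \<and> b = a + 1)"

definition diagram_iso :: "('v \<Rightarrow> 'v \<Rightarrow> bool) \<Rightarrow> nat \<Rightarrow> (nat \<Rightarrow> nat \<Rightarrow> nat \<Rightarrow> bool) \<Rightarrow> bool" where
  "diagram_iso adj n E \<longleftrightarrow>
     (\<exists>h. bij_betw h UNIV {1..n} \<and>
          (\<forall>x y. adj x y \<longleftrightarrow> E n (h x) (h y) \<or> E n (h y) (h x)))"

definition ADE_diagram :: "('v::finite \<Rightarrow> 'v \<Rightarrow> bool) \<Rightarrow> bool" where
  "ADE_diagram adj \<longleftrightarrow>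
     (\<exists>n\<ge>1. diagram_iso adj n A_edge) \<or>
     (\<exists>n\<ge>4. diagram_iso adj n D_edge) \<or>
     (\<exists>n\<in>{6,7,8}. diagram_iso adj n E_edge)"

definition aut_order :: "('v \<Rightarrow> 'v) \<Rightarrow> nat" where
  "aut_order \<sigma> = (LEAST n. 0 < n \<and> \<sigma> ^^ n = id)"

definition folding_aut :: "('v::finite \<Rightarrow> 'v \<Rightarrow> bool) \<Rightarrow> ('v \<Rightarrow> 'v) \<Rightarrow> bool" where
  "folding_aut adj \<sigma> \<longleftrightarrow>
     bij \<sigma> \<and> (\<forall>x y. adj (\<sigma> x) (\<sigma> y) \<longleftrightarrow> adj x y) \<and>
     (\<forall>x. \<not> adj x (\<sigma> x)) \<and> aut_order \<sigma> \<in> {1, 2, 3}"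


section \<open>The simply-laced root system\<close>

text \<open>The weight lattice is the free abelian group on the vertices, the basis element
  \<^term>\<open>frag_of x\<close> being the fundamental weight of \<^term>\<open>x\<close>.\<close>

type_synonym 'v weight = "'v \<Rightarrow>\<^sub>0 int"

context
  fixes adj :: "'v::finite \<Rightarrow> 'v \<Rightarrow> bool"
begin

definition simple_root :: "'v \<Rightarrow> 'v weight" where
  "simple_root x = frag_cmul 2 (frag_of x) - (\<Sum>y | adj x y. frag_of y)"

definition root_lattice :: "'v weight monoid" where
  "root_lattice = subgroup_generated (free_Abelian_group UNIV) (range simple_root)"

text \<open>As \<open>(\<varpi>\<^sub>y, \<alpha>\<^sub>x) = \<delta>\<^sub>y\<^sub>x\<close>, the number \<open>(v, \<alpha>\<^sub>x)\<close> is the \<open>x\<close>-coefficient of \<open>v\<close>.\<close>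

definition reflection :: "'v \<Rightarrow> 'v weight \<Rightarrow> 'v weight" where
  "reflection x v = v - frag_cmul (poly_mapping.lookup v x) (simple_root x)"

text \<open>The reflections are involutions, so no inverses are needed to generate the group.\<close>

inductive_set weyl_group :: "('v weight \<Rightarrow> 'v weight) set" where
  weyl_id: "id \<in> weyl_group"
| weyl_step: "w \<in> weyl_group \<Longrightarrow> reflection x \<circ> w \<in> weyl_group"

definition roots :: "'v weight set" where
  "roots = {w (simple_root x) | w x. w \<in> weyl_group}"

definition pos_roots :: "'v weight set" where
  "pos_roots = {\<beta> \<in> roots. \<exists>c :: 'v \<Rightarrow> nat. \<beta> = (\<Sum>x\<in>UNIV. frag_cmul (int (c x)) (simple_root x))}"

end

definition aut_weight :: "('v \<Rightarrow> 'v) \<Rightarrow> 'v weight \<Rightarrow> 'v weight" where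
  "aut_weight \<sigma> = frag_extend (\<lambda>x. frag_of (\<sigma> x))"


section \<open>Folding, parity functions and height functions\<close>

definition orbits :: "('v \<Rightarrow> 'v) \<Rightarrow> 'v set set" where
  "orbits \<sigma> = range (orbit \<sigma>)"

definition orbit_size :: "('v \<Rightarrow> 'v) \<Rightarrow> 'v \<Rightarrow> int" where
  "orbit_size \<sigma> x = int (card (orbit \<sigma> x))"

definition orbit_adj :: "('v \<Rightarrow> 'v \<Rightarrow> bool) \<Rightarrow> 'v set \<Rightarrow> 'v set \<Rightarrow> bool" where
  "orbit_adj adj i j \<longleftrightarrow> (\<exists>x\<in>i. \<exists>y\<in>j. adj x y)"

definition cartan :: "('v \<Rightarrow> 'v \<Rightarrow> bool) \<Rightarrow> 'v set \<Rightarrow> 'v set \<Rightarrow> int" where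
  "cartan adj i j =
     (if i = j then 2
      else if orbit_adj adj i j then - \<lceil>real (card j) / real (card i)\<rceil>
      else 0)"

definition parity_function :: "('v \<Rightarrow> 'v \<Rightarrow> bool) \<Rightarrow> ('v \<Rightarrow> 'v) \<Rightarrow> ('v \<Rightarrow> int) \<Rightarrow> bool" where
  "parity_function adj \<sigma> \<epsilon> \<longleftrightarrow>
     (\<forall>x. 0 \<le> \<epsilon> x \<and> \<epsilon> x < 2 * orbit_size \<sigma> x) \<and>
     (\<forall>x y. orbit \<sigma> x = orbit \<sigma> y \<longrightarrow> [\<epsilon> x = \<epsilon> y] (mod 2)) \<and>
     (\<forall>x l. [\<epsilon> ((\<sigma> ^^ l) x) = \<epsilon> x - 2 * int l] (mod 2 * orbit_size \<sigma> x)) \<and>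
     (\<forall>x y. adj x y \<longrightarrow>
        [\<epsilon> x = \<epsilon> y + min (orbit_size \<sigma> x) (orbit_size \<sigma> y)]
          (mod 2 * min (orbit_size \<sigma> x) (orbit_size \<sigma> y)))"

text \<open>In the second clause \<^term>\<open>i\<close> is a singleton.\<close>

definition height_function :: "('v \<Rightarrow> 'v \<Rightarrow> bool) \<Rightarrow> ('v \<Rightarrow> 'v) \<Rightarrow> ('v \<Rightarrow> int) \<Rightarrow> bool" where
  "height_function adj \<sigma> \<xi> \<longleftrightarrow>
     (\<forall>x y. adj x y \<and> orbit_size \<sigma> x = orbit_size \<sigma> y \<longrightarrow> \<bar>\<xi> x - \<xi> y\<bar> = orbit_size \<sigma> x) \<and>
     (\<forall>i\<in>orbits \<sigma>. \<forall>j\<in>orbits \<sigma>. orbit_adj adj i j \<and> card i < card j \<longrightarrow>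
        (\<forall>x\<in>i. \<exists>!y. y \<in> j \<and> \<bar>\<xi> x - \<xi> y\<bar> = 1 \<and>
                    (\<forall>l<aut_order \<sigma>. \<xi> ((\<sigma> ^^ l) y) = \<xi> y - 2 * int l)))"

definition Q_datum :: "('v::finite \<Rightarrow> 'v \<Rightarrow> bool) \<Rightarrow> ('v \<Rightarrow> 'v) \<Rightarrow> ('v \<Rightarrow> int) \<Rightarrow> bool" where
  "Q_datum adj \<sigma> \<xi> \<longleftrightarrow> ADE_diagram adj \<and> folding_aut adj \<sigma> \<and> height_function adj \<sigma> \<xi>"

definition height_compatible :: "('v \<Rightarrow> 'v) \<Rightarrow> ('v \<Rightarrow> int) \<Rightarrow> ('v \<Rightarrow> int) \<Rightarrow> bool" where
  "height_compatible \<sigma> \<epsilon> \<xi> \<longleftrightarrow> (\<forall>x. [\<xi> x = \<epsilon> x] (mod 2 * orbit_size \<sigma> x))"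


section \<open>The repetition quiver and the map \<open>\<phi>\<close>\<close>

context
  fixes adj :: "'v::finite \<Rightarrow> 'v \<Rightarrow> bool"
    and \<sigma> :: "'v \<Rightarrow> 'v"
    and \<epsilon> :: "'v \<Rightarrow> int"
    and \<xi> :: "'v \<Rightarrow> int"
begin

definition rep_vertices :: "('v \<times> int) set" where
  "rep_vertices = {(x, p). [p = \<epsilon> x] (mod 2 * orbit_size \<sigma> x)}"

definition rep_arrow :: "'v \<times> int \<Rightarrow> 'v \<times> int \<Rightarrow> bool" where
  "rep_arrow = (\<lambda>(x, p) (y, s). adj x y \<and> s - p = min (orbit_size \<sigma> x) (orbit_size \<sigma> y))"

definition compatible_reading :: "('v \<times> int) set \<Rightarrow> ('v \<times> int) list \<Rightarrow> bool" where
  "compatible_reading X xs \<longleftrightarrow> distinct xs \<and> set xs = X \<and>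
     (\<forall>k<length xs. \<forall>k'<length xs. rep_arrow (xs ! k') (xs ! k) \<longrightarrow> k < k')"

text \<open>The product does not depend on the chosen reading for the sets it is applied to below.\<close>

definition word_elt :: "('v \<times> int) set \<Rightarrow> 'v weight \<Rightarrow> 'v weight" where
  "word_elt X =
     foldr (\<lambda>x w. reflection adj (fst x) \<circ> w) (SOME xs. compatible_reading X xs) id"

definition top_elt :: "'v set \<Rightarrow> 'v" where
  "top_elt i = (ARG_MAX \<xi> x. x \<in> i)"

definition X_circ :: "('v \<times> int) set" where
  "X_circ = {(top_elt i, \<xi> (top_elt i)) | i. i \<in> orbits \<sigma>}"

definition X_prime :: "('v \<times> int) set" where
  "X_prime = {(\<sigma> (top_elt i), p) | i p. i \<in> orbits \<sigma> \<and> (\<sigma> (top_elt i), p) \<in> rep_vertices \<and>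
                \<xi> (\<sigma> (top_elt i)) < p \<and> p \<le> \<xi> (top_elt i) - 2}"

definition tau_circ :: "'v weight \<Rightarrow> 'v weight" where
  "tau_circ = word_elt X_circ \<circ> aut_weight \<sigma>"

definition tau :: "'v weight \<Rightarrow> 'v weight" where
  "tau = inv_into UNIV (word_elt X_prime) \<circ> tau_circ \<circ> word_elt X_prime"

definition gamma :: "'v \<Rightarrow> 'v weight" where
  "gamma x = frag_of x - (tau ^^ card (orbit \<sigma> x)) (frag_of x)"

definition phi_up :: "'v \<Rightarrow> 'v weight \<times> int \<Rightarrow> 'v weight \<times> int" where
  "phi_up x = (\<lambda>(\<beta>, k). let \<beta>' = (inv_into UNIV tau ^^ card (orbit \<sigma> x)) \<beta> in
     if \<beta>' \<in> pos_roots adj then (\<beta>', k) else (- \<beta>', k + 1))"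

definition phi_down :: "'v \<Rightarrow> 'v weight \<times> int \<Rightarrow> 'v weight \<times> int" where
  "phi_down x = (\<lambda>(\<beta>, k). let \<beta>' = (tau ^^ card (orbit \<sigma> x)) \<beta> in
     if \<beta>' \<in> pos_roots adj then (\<beta>', k) else (- \<beta>', k - 1))"

text \<open>The recursion is run from \<open>(x, \<xi> x)\<close> in steps of \<open>2 d\<close>, upwards or downwards. The two kinds
  of steps are mutually inverse on pairs of a positive root and an integer.\<close>

definition phi :: "'v \<times> int \<Rightarrow> 'v weight \<times> int" where
  "phi = (\<lambda>(x, p).
     if \<xi> x \<le> p
     then (phi_up x ^^ nat ((p - \<xi> x) div (2 * orbit_size \<sigma> x))) (gamma x, 0)
     else (phi_down x ^^ nat ((\<xi> x - p) div (2 * orbit_size \<sigma> x))) (gamma x, 0))"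

definition orbit_parity :: "'v set \<Rightarrow> int" where
  "orbit_parity i = (THE e. e \<in> {0, 1} \<and> (\<forall>x\<in>i. [e = \<epsilon> x] (mod 2)))"

definition I_hat :: "('v set \<times> int) set" where
  "I_hat = {(i, p). i \<in> orbits \<sigma> \<and> [p = orbit_parity i] (mod 2)}"

definition fold_map :: "'v \<times> int \<Rightarrow> 'v set \<times> int" where
  "fold_map = (\<lambda>(x, p). (orbit \<sigma> x, p))"

definition phi_bar :: "'v set \<times> int \<Rightarrow> 'v weight \<times> int" where
  "phi_bar = phi \<circ> inv_into rep_vertices fold_map"


section \<open>The groups \<open>\<M>\<close>, \<open>\<M>\<^sub>A\<close> and the weight homomorphism\<close>

text \<open>The free abelian group on the symbols \<open>Y\<^sub>i\<^sub>,\<^sub>p\<close> is written additively;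
  \<^term>\<open>frag_of (i, p)\<close> is \<open>Y\<^sub>i\<^sub>,\<^sub>p\<close>.\<close>

definition group_M :: "('v set \<times> int \<Rightarrow>\<^sub>0 int) monoid" where
  "group_M = free_Abelian_group I_hat"

definition A_elt :: "'v set \<Rightarrow> int \<Rightarrow> ('v set \<times> int \<Rightarrow>\<^sub>0 int)" where
  "A_elt i p =
     frag_of (i, p - int (card i)) + frag_of (i, p + int (card i))
     - (\<Sum>j | j \<in> orbits \<sigma> \<and> cartan adj j i = -1. frag_of (j, p))
     - (\<Sum>j | j \<in> orbits \<sigma> \<and> cartan adj j i = -2. frag_of (j, p - 1) + frag_of (j, p + 1))
     - (\<Sum>j | j \<in> orbits \<sigma> \<and> cartan adj j i = -3.
          frag_of (j, p - 2) + frag_of (j, p) + frag_of (j, p + 2))"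

definition subgroup_MA :: "('v set \<times> int \<Rightarrow>\<^sub>0 int) set" where
  "subgroup_MA = generate group_M {A_elt i p | i p. i \<in> orbits \<sigma> \<and> (i, p - int (card i)) \<in> I_hat}"

definition wt_Q :: "('v set \<times> int \<Rightarrow>\<^sub>0 int) \<Rightarrow> 'v weight" where
  "wt_Q = frag_extend (\<lambda>y. let (\<alpha>, k) = phi_bar y in if even k then \<alpha> else - \<alpha>)"

end

end

(* The sign (-1)^k in wt_Q absorbs the case distinction in phi, so that, for (x, p) in the
   repetition quiver, wt_Q (Y_{i,p}) = tau^((xi x - p)/2) gamma_x. Let w and u be the words of
   X_circ and X_prime and t = w sigma, so tau = u^-1 t u. Writing i_top for the vertex of highest
   xi in the orbit i, put Phi i p = t^((xi i_top - p)/2) (varpi at i_top). Pushing the fundamental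
   weights through the reflections of u one at a time gives u varpi_x = Phi i (xi x), hence
   u wt_Q (Y_{i,p}) = Phi i p - Phi i (p - 2 d_i). Pushing them through w gives the mesh relation
   Phi i p + Phi i (p - 2 d_i) = (contributions of the neighbouring orbits), and its difference at
   two heights says that wt_Q (A_{i,p}) = 0.

   The image is tau-stable and contains the simple roots at the i_top, so it is stable under w,
   hence under sigma, and contains all simple roots. Modulo the A_{i,p} every element is supported
   in a window of heights of length 2 d_i on each orbit i; the window has as many elements as there
   are vertices, which is the rank of the root lattice because the Cartan matrix is nonsingular.
   So the surjection from its span is injective, and the A_{i,p} generate the kernel. *)

theory Submission
  imports
    Defs
    "HOL-Combinatorics.Cycles"
    "HOL-Analysis.Cartesian_Space"
begin

section \<open>Diagrams of type ADE\<close>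

text \<open>The word \<open>u\<close> is there for orbits of size two on which \<open>\<xi>\<close>
  drops by more than 2. Powers of \<open>t\<close> run down an orbit from its top vertex in steps of
  2, so \<open>Phi\<close> puts a fundamental weight at the height of its vertex only while
  successive heights differ by 2. For a larger gap the reflections of \<open>X_prime\<close> lower
  the second vertex, 4 at a time, from \<open>\<xi> (top x) - 2\<close> to its actual height. Such
  an orbit and all its neighbours have size two, which keeps the mesh relations used there uniform.
  The foldings are never classified. Beyond symmetry and absence of loops, the diagram enters only
  through connectedness, nonsingularity of the Cartan matrix and the neighbours of a trivalent
  vertex; the last confines three-element orbits to a single fixed vertex surrounded by leaves.
  \<open>word_elt\<close> picks an arbitrary compatible reading, so arguments about words may use
  only the order that the arrows force.\<close>

lemma ADE_cases:
  assumes "ADE_diagram (adj :: 'v::finite \<Rightarrow> 'v \<Rightarrow> bool)"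
  obtains n E h where
    "bij_betw h UNIV {1..n}" "\<And>x y. adj x y \<longleftrightarrow> E n (h x) (h y) \<or> E n (h y) (h x)"
    "(E = A_edge \<and> n \<ge> 1) \<or> (E = D_edge \<and> n \<ge> 4) \<or> (E = E_edge \<and> n \<in> {6,7,8})"
  using assms unfolding ADE_diagram_def diagram_iso_def by blast

lemma ADE_sym:
  assumes "ADE_diagram adj" "adj x y"
  shows "adj y x"
  using assms by (elim ADE_cases) auto

lemma ADE_irrefl: "ADE_diagram adj \<Longrightarrow> \<not> adj x x"
  by (elim ADE_cases) (auto simp: A_edge_def D_edge_def E_edge_def)

text \<open>Types A and D contain a path starting at 1 (in D up to \<open>n - 1\<close>, with
  \<open>n\<close> attached to \<open>n - 2\<close>); type E is the path from 3 to \<open>n\<close>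
  with 1 and 2 attached to 3 and 4. For a predicate that is constant along edges each path is one
  induction.\<close>

lemma ADE_label_connected:
  assumes E: "(E = A_edge \<and> n \<ge> 1) \<or> (E = D_edge \<and> n \<ge> 4) \<or> (E = E_edge \<and> n \<in> {6,7,8::nat})"
    and P: "\<And>k l. k \<in> {1..n} \<Longrightarrow> l \<in> {1..n} \<Longrightarrow> E n k l \<Longrightarrow> P k \<longleftrightarrow> P l"
    and k: "k \<in> {1..n}"
  shows "P k \<longleftrightarrow> P 1"
  using E
proof (elim disjE conjE)
  assume A: "E = A_edge"
  have "k \<ge> 1" "k \<le> n" using k by auto
  then show ?thesis
  proof (induction k rule: dec_induct)
    case (step m)
    then show ?case using P[of m "Suc m"] by (auto simp: A A_edge_def)
  qed simp
next
  assume D: "E = D_edge" and n: "n \<ge> 4"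
  have *: "P k \<longleftrightarrow> P 1" if "k \<ge> 1" "k < n" for k
    using that
  proof (induction k rule: dec_induct)
    case (step m)
    then show ?case using P[of m "Suc m"] by (auto simp: D D_edge_def)
  qed simp
  have "P (n - 2) \<longleftrightarrow> P n"
    using P[of "n - 2" n] n by (auto simp: D D_edge_def)
  with * [of "n - 2"] * [of k] show ?thesis
    using k n by (cases "k = n") auto
next
  assume e: "E = E_edge" and n: "n \<in> {6,7,8}"
  have *: "P k \<longleftrightarrow> P 3" if "k \<ge> 3" "k \<le> n" for k
    using that
  proof (induction k rule: dec_induct)
    case (step m)
    then show ?case using P[of m "Suc m"] by (auto simp: e E_edge_def)
  qed simp
  have "P 1 \<longleftrightarrow> P 3" "P 2 \<longleftrightarrow> P 4"
    using P[of 1 3] P[of 2 4] n by (auto simp: e E_edge_def)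
  moreover have "k = 1 \<or> k = 2 \<or> k \<ge> 3" using k by auto
  ultimately show ?thesis
    using * [of k] * [of 4] k n by auto
qed

lemma ADE_connected:
  assumes ade: "ADE_diagram adj" and s: "s \<in> S"
    and closed: "\<And>x y. x \<in> S \<Longrightarrow> adj x y \<Longrightarrow> y \<in> S"
  shows "x \<in> S"
proof -
  obtain n E h where h: "bij_betw h UNIV {1..n}"
    and adj: "\<And>x y. adj x y \<longleftrightarrow> E n (h x) (h y) \<or> E n (h y) (h x)"
    and E: "(E = A_edge \<and> n \<ge> 1) \<or> (E = D_edge \<and> n \<ge> 4) \<or> (E = E_edge \<and> n \<in> {6,7,8})"
    by (rule ADE_cases[OF ade], rule that)
  have inj: "h x = h y \<longleftrightarrow> x = y" for x y
    using h by (auto simp: bij_betw_def inj_def)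
  have range: "\<exists>x. h x = k" if "k \<in> {1..n}" for k
  proof -
    have "k \<in> range h" using h that by (simp add: bij_betw_def)
    then show ?thesis by blast
  qed
  have mem: "h z \<in> h ` S \<longleftrightarrow> z \<in> S" for z
    using h by (intro inj_image_mem_iff) (simp add: bij_betw_def)
  have "h z \<in> h ` S \<longleftrightarrow> 1 \<in> h ` S" for z
  proof (rule ADE_label_connected[OF E])
    fix k l assume "k \<in> {1..n}" "l \<in> {1..n}" and kl: "E n k l"
    then obtain x y where "h x = k" "h y = l" using range by blast
    moreover from this kl have "x \<in> S \<longleftrightarrow> y \<in> S" using closed adj by blast
    ultimately show "k \<in> h ` S \<longleftrightarrow> l \<in> h ` S"
      using mem by blast
  qed (use h in \<open>auto simp: bij_betw_def\<close>)
  then show ?thesis using s mem by blast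
qed

section \<open>Nonsingularity of the Cartan matrices of types A, D and E\<close>

lemma path_neighbour_sum:
  fixes C :: "nat \<Rightarrow> real"
  assumes "C 0 = 0" "C (Suc n) = 0" "1 \<le> k" "k \<le> n"
  shows "(\<Sum>l | l \<in> {1..n} \<and> (A_edge n k l \<or> A_edge n l k). C l) = C (k - 1) + C (k + 1)"
proof -
  have "(\<Sum>l | l \<in> {1..n} \<and> (A_edge n k l \<or> A_edge n l k). C l) = (\<Sum>l \<in> {k - 1, k + 1}. C l)"
  proof (rule sum.mono_neutral_left)
    show "\<forall>l\<in>{k - 1, k + 1} - {l \<in> {1..n}. A_edge n k l \<or> A_edge n l k}. C l = 0"
      using assms by (cases "k = 1"; cases "k = n") (auto simp: A_edge_def)
  qed (use assms in \<open>auto simp: A_edge_def\<close>)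
  then show ?thesis using assms by simp
qed

text \<open>The equations say that the second differences of \<open>C\<close>, extended by 0 at both
  ends, vanish. So the extension is linear, and its value 0 at \<open>n + 1\<close> forces the slope
  \<open>D 1\<close> to be 0.\<close>

lemma A_kernel_trivial:
  fixes C :: "nat \<Rightarrow> real"
  assumes ker: "\<And>k. k \<in> {1..n} \<Longrightarrow>
    2 * C k = (\<Sum>l | l \<in> {1..n} \<and> (A_edge n k l \<or> A_edge n l k). C l)"
    and k: "k \<in> {1..n}"
  shows "C k = 0"
proof -
  define D where "D = (\<lambda>k. if k \<in> {1..n} then C k else 0)"
  have rec: "D (k + 1) = 2 * D k - D (k - 1)" if "1 \<le> k" "k \<le> n" for k
  proof -
    have "2 * D k = (\<Sum>l | l \<in> {1..n} \<and> (A_edge n k l \<or> A_edge n l k). D l)"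
      using ker[of k] that by (auto simp: D_def intro!: sum.cong)
    also have "\<dots> = D (k - 1) + D (k + 1)"
      by (rule path_neighbour_sum) (use that in \<open>auto simp: D_def\<close>)
    finally show ?thesis by simp
  qed
  have "D k = real k * D 1 \<and> D (Suc k) = real (Suc k) * D 1" if "k \<le> n" for k
    using that
  proof (induction k)
    case 0
    then show ?case by (simp add: D_def)
  next
    case (Suc k)
    then show ?case using rec[of "Suc k"] by (simp add: algebra_simps)
  qed
  from this[of n] this[of k] k have "D k = real k * D 1" "real (Suc n) * D 1 = 0"
    by (auto simp: D_def)
  then have "D k = 0" by auto
  then show ?thesis using k by (simp add: D_def)
qed

text \<open>\<open>C\<close> is linear with slope \<open>C 1\<close> up to \<open>n - 2\<close>.
  Both leaves \<open>n - 1\<close> and \<open>n\<close> carry half of \<open>C (n - 2)\<close>, so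
  the fork equation collapses to \<open>C (n - 2) = C (n - 3)\<close>, and the slope is 0.\<close>

lemma D_kernel_trivial:
  fixes C :: "nat \<Rightarrow> real"
  assumes n: "n \<ge> 4"
    and ker: "\<And>k. k \<in> {1..n} \<Longrightarrow>
    2 * C k = (\<Sum>l | l \<in> {1..n} \<and> (D_edge n k l \<or> D_edge n l k). C l)"
    and k: "k \<in> {1..n}"
  shows "C k = 0"
proof -
  have one: "2 * C 1 = C 2"
  proof -
    have "{l. l \<in> {1..n} \<and> (D_edge n 1 l \<or> D_edge n l 1)} = {2}"
      using n by (auto simp: D_edge_def)
    then show ?thesis using ker[of 1] n by simp
  qed
  have rec: "2 * C (Suc k) = C k + C (Suc (Suc k))" if "1 \<le> k" "k + 3 < n" for k
  proof -
    have "{l. l \<in> {1..n} \<and> (D_edge n (Suc k) l \<or> D_edge n l (Suc k))} = {k, Suc (Suc k)}"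
      using n that by (auto simp: D_edge_def)
    then show ?thesis using ker[of "Suc k"] that by simp
  qed
  have fork: "2 * C (n - 2) = C (n - 3) + C (n - 1) + C n"
  proof -
    have "{l. l \<in> {1..n} \<and> (D_edge n (n - 2) l \<or> D_edge n l (n - 2))} = {n - 3, n - 1, n}"
      using n by (auto simp: D_edge_def)
    moreover have "n - 2 \<in> {1..n}" "n - 3 \<noteq> n - 1" "n - 3 \<noteq> n" "n - 1 \<noteq> n" using n by auto
    ultimately show ?thesis using ker[of "n - 2"] by simp
  qed
  have ends: "2 * C (n - 1) = C (n - 2)" "2 * C n = C (n - 2)"
  proof -
    have "{l. l \<in> {1..n} \<and> (D_edge n (n - 1) l \<or> D_edge n l (n - 1))} = {n - 2}"
      "{l. l \<in> {1..n} \<and> (D_edge n n l \<or> D_edge n l n)} = {n - 2}"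
      using n by (auto simp: D_edge_def)
    moreover have "n - 1 \<in> {1..n}" "n \<in> {1..n}" using n by auto
    ultimately show "2 * C (n - 1) = C (n - 2)" "2 * C n = C (n - 2)"
      using ker[of "n - 1"] ker[of n] by simp_all
  qed
  have lin: "C k = real k * C 1 \<and> C (Suc k) = real (Suc k) * C 1" if "k \<ge> 1" "k + 2 < n" for k
    using that
  proof (induction k rule: dec_induct)
    case base
    then show ?case using one by (simp add: numeral_2_eq_2)
  next
    case (step k)
    then show ?case using rec[of k] by (simp add: algebra_simps)
  qed
  from lin[of "n - 3"] n have "C (n - 3) = real (n - 3) * C 1" "C (n - 2) = real (n - 2) * C 1"
    by (auto simp: Suc_diff_le[symmetric] eval_nat_numeral Suc_diff_Suc)
  with fork ends n have C1: "C 1 = 0"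
    by (auto simp: of_nat_diff algebra_simps)
  have "C k = 0" if "k \<ge> 1" "k + 2 \<le> n" for k
  proof (cases "k + 2 = n")
    case True
    then show ?thesis using \<open>C (n - 2) = _\<close> C1 by (metis diff_add_inverse2 mult_zero_right)
  qed (use lin[of k] that C1 in auto)
  then have "C (n - 2) = 0" "k \<le> n - 2 \<Longrightarrow> C k = 0"
    using n k by auto
  moreover have "k \<le> n - 2 \<or> k = n - 1 \<or> k = n" using k by auto
  ultimately show ?thesis using ends by auto
qed

text \<open>A linear system of determinant \<open>9 - n\<close>, solved directly in each of the
  three cases.\<close>

lemma E_kernel_trivial:
  fixes C :: "nat \<Rightarrow> real"
  assumes n: "n \<in> {6,7,8}"
    and ker: "\<And>k. k \<in> {1..n} \<Longrightarrow>
    2 * C k = (\<Sum>l | l \<in> {1..n} \<and> (E_edge n k l \<or> E_edge n l k). C l)"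
    and k: "k \<in> {1..n}"
  shows "C k = 0"
proof -
  have nb: "{l. l \<in> {1..n} \<and> (E_edge n 1 l \<or> E_edge n l 1)} = {3}"
    "{l. l \<in> {1..n} \<and> (E_edge n 2 l \<or> E_edge n l 2)} = {4}"
    "{l. l \<in> {1..n} \<and> (E_edge n 3 l \<or> E_edge n l 3)} = {1,4}"
    "{l. l \<in> {1..n} \<and> (E_edge n 4 l \<or> E_edge n l 4)} = {2,3,5}"
    "{l. l \<in> {1..n} \<and> (E_edge n 5 l \<or> E_edge n l 5)} = {4,6}"
    "{l. l \<in> {1..n} \<and> (E_edge n 6 l \<or> E_edge n l 6)} = (if n = 6 then {5} else {5,7})"
    "n \<ge> 7 \<Longrightarrow> {l. l \<in> {1..n} \<and> (E_edge n 7 l \<or> E_edge n l 7)} = (if n = 7 then {6} else {6,8})"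
    "n \<ge> 8 \<Longrightarrow> {l. l \<in> {1..n} \<and> (E_edge n 8 l \<or> E_edge n l 8)} = {7}"
    using n by (auto simp: E_edge_def)
  have e1: "2 * C 1 = C 3"
  proof -
    have "(1::nat) \<in> {1..n}" using n by auto
    from ker[OF this, unfolded nb(1)] show ?thesis by simp
  qed
  have e2: "2 * C 2 = C 4"
  proof -
    have "(2::nat) \<in> {1..n}" using n by auto
    from ker[OF this, unfolded nb(2)] show ?thesis by simp
  qed
  have e3: "2 * C 3 = C 1 + C 4"
  proof -
    have "(3::nat) \<in> {1..n}" using n by auto
    from ker[OF this, unfolded nb(3)] show ?thesis by simp
  qed
  have e4: "2 * C 4 = C 2 + C 3 + C 5"
  proof -
    have "(4::nat) \<in> {1..n}" using n by auto
    from ker[OF this, unfolded nb(4)] show ?thesis by simp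
  qed
  have e5: "2 * C 5 = C 4 + C 6"
  proof -
    have "(5::nat) \<in> {1..n}" using n by auto
    from ker[OF this, unfolded nb(5)] show ?thesis by simp
  qed
  have e6: "2 * C 6 = (if n = 6 then C 5 else C 5 + C 7)"
  proof -
    have "(6::nat) \<in> {1..n}" using n by auto
    from ker[OF this, unfolded nb(6)] show ?thesis by simp
  qed
  have e7: "2 * C 7 = (if n = 7 then C 6 else C 6 + C 8)" if "n \<ge> 7"
  proof -
    have "(7::nat) \<in> {1..n}" using n that by auto
    from ker[OF this, unfolded nb(7)[OF that]] show ?thesis by simp
  qed
  have e8: "2 * C 8 = C 7" if "n \<ge> 8"
  proof -
    have "(8::nat) \<in> {1..n}" using n that by auto
    from ker[OF this, unfolded nb(8)[OF that]] show ?thesis by simp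
  qed
  have "C 1 = 0 \<and> C 2 = 0 \<and> C 3 = 0 \<and> C 4 = 0 \<and> C 5 = 0 \<and> C 6 = 0 \<and>
    (n \<ge> 7 \<longrightarrow> C 7 = 0) \<and> (n \<ge> 8 \<longrightarrow> C 8 = 0)"
    using n
  proof (elim insertE emptyE)
    assume "n = 6" then show ?thesis using e1 e2 e3 e4 e5 e6 by simp
  next
    assume "n = 7" then show ?thesis using e1 e2 e3 e4 e5 e6 e7 by simp
  next
    assume "n = 8" then show ?thesis using e1 e2 e3 e4 e5 e6 e7 e8 by simp
  qed
  moreover have "k = 1 \<or> k = 2 \<or> k = 3 \<or> k = 4 \<or> k = 5 \<or> k = 6 \<or> (k = 7 \<and> n \<ge> 7) \<or> (k = 8 \<and> n \<ge> 8)"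
    using k n by auto
  ultimately show ?thesis by auto
qed

text \<open>Real rather than integer coefficients, because the rank argument for the root lattice
  takes place in \<open>real^'v\<close>.\<close>

lemma ADE_kernel_trivial:
  fixes c :: "'v::finite \<Rightarrow> real"
  assumes ade: "ADE_diagram adj" and ker: "\<And>x. 2 * c x = (\<Sum>y | adj x y. c y)"
  shows "c x = 0"
proof -
  obtain n E h where h: "bij_betw h UNIV {1..n}"
    and adj: "\<And>x y. adj x y \<longleftrightarrow> E n (h x) (h y) \<or> E n (h y) (h x)"
    and E: "(E = A_edge \<and> n \<ge> 1) \<or> (E = D_edge \<and> n \<ge> 4) \<or> (E = E_edge \<and> n \<in> {6,7,8})"
    by (rule ADE_cases[OF ade], rule that)
  have inv: "inv_into UNIV h (h y) = y" for y
    using h by (simp add: bij_betw_def)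
  define C where "C = (\<lambda>k. c (inv_into UNIV h k))"
  have "2 * C k = (\<Sum>l | l \<in> {1..n} \<and> (E n k l \<or> E n l k). C l)" if "k \<in> {1..n}" for k
  proof -
    have "k \<in> range h" using h that by (simp add: bij_betw_def)
    then obtain x where k: "k = h x" by (rule imageE)
    have "h ` {y. adj x y} = {l. l \<in> {1..n} \<and> (E n k l \<or> E n l k)}"
    proof (intro equalityI subsetI)
      fix l assume "l \<in> h ` {y. adj x y}"
      then obtain y where "l = h y" "E n (h x) (h y) \<or> E n (h y) (h x)" unfolding adj by blast
      moreover have "h y \<in> {1..n}" using h by (auto simp: bij_betw_def)
      ultimately show "l \<in> {l. l \<in> {1..n} \<and> (E n k l \<or> E n l k)}" unfolding k by simp
    next
      fix l assume "l \<in> {l. l \<in> {1..n} \<and> (E n k l \<or> E n l k)}"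
      then have l: "l \<in> {1..n}" "E n k l \<or> E n l k" by auto
      then have "l \<in> range h" using h by (simp add: bij_betw_def)
      then obtain y where "l = h y" by (rule imageE)
      with l(2) show "l \<in> h ` {y. adj x y}" unfolding adj k by blast
    qed
    moreover have "inj_on h {y. adj x y}"
      using h by (metis bij_betw_def inj_on_subset subset_UNIV)
    ultimately have "(\<Sum>y | adj x y. C (h y)) = (\<Sum>l | l \<in> {1..n} \<and> (E n k l \<or> E n l k). C l)"
      by (metis (no_types, lifting) comp_apply sum.cong sum.reindex)
    then show ?thesis using ker[of x] by (simp add: C_def inv k)
  qed
  moreover have "h x \<in> {1..n}" using h by (auto simp: bij_betw_def)
  ultimately have "C (h x) = 0"
    using E A_kernel_trivial[of n C "h x"] D_kernel_trivial[of n C "h x"]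
      E_kernel_trivial[of n C "h x"] by (elim disjE conjE) blast+
  then show ?thesis by (simp add: C_def inv)
qed

text \<open>The branch vertex is \<open>n - 2\<close> in type D, with leaf \<open>n\<close>, and 4
  in type E, with leaf 2; type A has none. If the three neighbours form one orbit,
  \<open>\<sigma>\<close> turns all of them into leaves.\<close>

lemma ADE_trivalent:
  assumes ade: "ADE_diagram adj" and nb: "adj z a" "adj z b" "adj z c"
    and dist: "a \<noteq> b" "a \<noteq> c" "b \<noteq> c"
  obtains l where "l \<in> {a, b, c}" "\<And>y. adj l y \<Longrightarrow> y = z"
    "\<And>y. adj z y \<Longrightarrow> y \<in> {a, b, c}"
proof -
  obtain n E h where h: "bij_betw h UNIV {1..n}"
    and adj: "\<And>x y. adj x y \<longleftrightarrow> E n (h x) (h y) \<or> E n (h y) (h x)"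
    and E: "(E = A_edge \<and> n \<ge> 1) \<or> (E = D_edge \<and> n \<ge> 4) \<or> (E = E_edge \<and> n \<in> {6,7,8})"
    by (rule ADE_cases[OF ade], rule that)
  have inj: "h x = h y \<longleftrightarrow> x = y" for x y
    using h by (auto simp: bij_betw_def inj_def)
  have bounds: "h y \<ge> 1 \<and> h y \<le> n" for y
    using h by (auto simp: bij_betw_def)
  have dist': "h a \<noteq> h b" "h a \<noteq> h c" "h b \<noteq> h c" using dist inj by auto
  have "(\<exists>l\<in>{a, b, c}. \<forall>y. adj l y \<longrightarrow> h y = h z) \<and>
      (\<forall>y. adj z y \<longrightarrow> h y = h a \<or> h y = h b \<or> h y = h c)"
    using E
  proof (elim disjE conjE)
    assume "E = A_edge"
    then have "h y = h z + 1 \<or> h y = h z - 1" if "adj z y" for y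
      using that unfolding adj A_edge_def by auto
    then show ?thesis using nb dist' by metis
  next
    assume D: "E = D_edge" and n: "n \<ge> 4"
    have hy: "h y = h z + 1 \<or> h y = h z - 1" if "adj z y" "h z < n - 2" for y
      using that unfolding adj D D_edge_def by auto
    have hy2: "h y = n - 3 \<or> h y = n - 1 \<or> h y = n" if "adj z y" "h z = n - 2" for y
      using that n unfolding adj D D_edge_def by auto
    have hy3: "h y = n - 2" if "adj z y" "h z > n - 2" for y
      using that bounds[of z] bounds[of y] unfolding adj D D_edge_def by auto
    have hz: "h z = n - 2"
    proof (rule linorder_cases[of "h z" "n - 2"])
      assume "h z < n - 2"
      then show ?thesis using hy nb dist' by metis
    next
      assume "h z > n - 2"
      then show ?thesis using hy3 nb dist' by metis
    qed
    then have "h a = n \<or> h b = n \<or> h c = n"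
      using hy2 nb dist' by metis
    moreover have "h y = h z" if "h l = n" "adj l y" for l y
      using that n hz bounds[of y] unfolding adj D D_edge_def by auto
    moreover have "h y = h a \<or> h y = h b \<or> h y = h c" if "adj z y" for y
      using hy2[OF that hz] hy2[OF nb(1) hz] hy2[OF nb(2) hz] hy2[OF nb(3) hz] dist' by metis
    ultimately show ?thesis by blast
  next
    assume e: "E = E_edge" and n: "n \<in> {6,7,8}"
    have hy1: "h y = 3" if "adj z y" "h z = 1" for y
      using that unfolding adj e E_edge_def by auto
    have hy2: "h y = 4" if "adj z y" "h z = 2" for y
      using that unfolding adj e E_edge_def by auto
    have hy3: "h y = 1 \<or> h y = 4" if "adj z y" "h z = 3" for y
      using that unfolding adj e E_edge_def by auto
    have hy4: "h y = 2 \<or> h y = 3 \<or> h y = 5" if "adj z y" "h z = 4" for y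
      using that unfolding adj e E_edge_def by auto
    have hy5: "h y = h z + 1 \<or> h y = h z - 1" if "adj z y" "h z \<ge> 5" for y
      using that unfolding adj e E_edge_def by auto
    have "h z = 1 \<or> h z = 2 \<or> h z = 3 \<or> h z = 4 \<or> h z \<ge> 5" using bounds[of z] by linarith
    then have hz: "h z = 4"
    proof (elim disjE)
      assume "h z = 1" then show ?thesis using hy1 nb dist' by metis
    next
      assume "h z = 2" then show ?thesis using hy2 nb dist' by metis
    next
      assume "h z = 3" then show ?thesis using hy3 nb dist' by metis
    next
      assume "h z \<ge> 5" then show ?thesis using hy5 nb dist' by metis
    qed
    then have "h a = 2 \<or> h b = 2 \<or> h c = 2"
      using hy4 nb dist' by metis
    moreover have "h y = h z" if "h l = 2" "adj l y" for l y
      using that hz unfolding adj e E_edge_def by auto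
    moreover have "h y = h a \<or> h y = h b \<or> h y = h c" if "adj z y" for y
      using hy4[OF that hz] hy4[OF nb(1) hz] hy4[OF nb(2) hz] hy4[OF nb(3) hz] dist' by metis
    ultimately show ?thesis by blast
  qed
  then obtain l where "l \<in> {a, b, c}" "\<And>y. adj l y \<Longrightarrow> y = z"
      "\<And>y. adj z y \<Longrightarrow> y \<in> {a, b, c}"
    unfolding inj by blast
  then show ?thesis by (rule that)
qed

section \<open>Integer powers of additive bijections\<close>

text \<open>Heights lie on both sides of the one at which the recursion starts, so negative powers
  occur as well. Meaningful for bijections only.\<close>

definition int_power :: "('a \<Rightarrow> 'a) \<Rightarrow> int \<Rightarrow> 'a \<Rightarrow> 'a" where
  "int_power f k = (if 0 \<le> k then f ^^ nat k else inv_into UNIV f ^^ nat (- k))"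

lemma int_power_0 [simp]: "int_power f 0 x = x"
  by (simp add: int_power_def)

lemma int_power_of_nat: "int_power f (int n) = f ^^ n"
  by (simp add: int_power_def)

lemma int_power_minus_of_nat: "int_power f (- int n) = inv_into UNIV f ^^ n"
  by (simp add: int_power_def)

lemma int_power_succ:
  assumes "bij f"
  shows "int_power f (k + 1) x = f (int_power f k x)"
proof (cases "0 \<le> k")
  case True
  then show ?thesis by (simp add: int_power_def nat_add_distrib)
next
  case False
  define m where "m = nat (- k - 1)"
  have k: "k = - int (Suc m)" "k + 1 = - int m" using False by (auto simp: m_def)
  show ?thesis
    using assms unfolding k(2) int_power_minus_of_nat unfolding k(1) int_power_minus_of_nat
    by (simp add: surj_f_inv_f bij_is_surj)
qed

lemma int_power_pred:
  assumes "bij f"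
  shows "int_power f (k - 1) x = inv_into UNIV f (int_power f k x)"
  using int_power_succ[OF assms, of "k - 1" x] assms
  by (metis bij_is_inj diff_add_cancel inv_f_f)

lemma int_power_add:
  assumes "bij f"
  shows "int_power f (a + b) x = int_power f a (int_power f b x)"
proof (induction a rule: int_induct[of _ 0])
  case (step1 a)
  then show ?case
    using int_power_succ[OF assms] by (metis add.assoc add.commute)
next
  case (step2 a)
  have "a - 1 + b = a + b - 1" by simp
  then show ?case
    using step2 int_power_pred[OF assms] by metis
qed simp

lemma bij_inv: "bij f \<Longrightarrow> bij (inv_into UNIV f)"
  by (rule bij_imp_bij_inv)

text \<open>Transfers powers of \<open>tau\<close> to powers of \<open>t\<close>, for which
  \<open>Phi\<close> is defined.\<close>

lemma int_power_conjugate: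
  fixes u f :: "'a \<Rightarrow> 'a"
  assumes u: "bij u" and f: "bij f"
  shows "int_power (inv_into UNIV u \<circ> f \<circ> u) k x = inv_into UNIV u (int_power f k (u x))"
proof -
  let ?g = "inv_into UNIV u \<circ> f \<circ> u"
  have g: "bij ?g" using u f by (intro bij_comp bij_inv)
  have uu: "u (inv_into UNIV u y) = y" "inv_into UNIV u (u y) = y" for y
    using u by (simp_all add: bij_is_inj bij_is_surj surj_f_inv_f)
  show ?thesis
  proof (induction k rule: int_induct[of _ 0])
    case (step1 k)
    have "int_power ?g (k + 1) x = ?g (int_power ?g k x)" by (rule int_power_succ[OF g])
    also have "\<dots> = inv_into UNIV u (int_power f (k + 1) (u x))"
      unfolding step1(2) int_power_succ[OF f] by (simp add: uu)
    finally show ?case .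
  next
    case (step2 k)
    have "?g (inv_into UNIV u (int_power f (k - 1) (u x))) = inv_into UNIV u (int_power f k (u x))"
      using int_power_succ[OF f, of "k - 1" "u x"] by (simp add: uu)
    then show ?case
      using step2 int_power_pred[OF g, of k x] g by (metis bij_is_inj inv_f_f)
  qed (simp add: uu)
qed

section \<open>Additive maps and subgroups\<close>

lemma additive_comp: "additive f \<Longrightarrow> additive g \<Longrightarrow> additive (f \<circ> g)"
  by (simp add: additive_def)

lemma additive_id: "additive id"
  by (simp add: additive_def)

lemma additive_funpow:
  fixes f :: "'a::ab_group_add \<Rightarrow> 'a"
  shows "additive f \<Longrightarrow> additive (f ^^ n)"
  by (induction n) (simp_all add: additive_def)

lemma additive_inv:
  assumes "additive f" "bij f"
  shows "additive (inv_into UNIV f)"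
proof
  fix x y
  have "f (inv_into UNIV f x + inv_into UNIV f y) = x + y"
    using assms by (simp add: additive.add surj_f_inv_f bij_is_surj)
  then show "inv_into UNIV f (x + y) = inv_into UNIV f x + inv_into UNIV f y"
    using assms(2) by (metis bij_is_inj inv_f_f)
qed

lemma additive_int_power: "additive f \<Longrightarrow> bij f \<Longrightarrow> additive (int_power f k)"
  by (simp add: int_power_def additive_funpow additive_inv)

lemma additive_frag_extend: "additive (frag_extend f)"
  by (simp add: additive_def frag_extend_add)

lemma additive_frag_cmul:
  assumes "additive f"
  shows "f (frag_cmul c x) = frag_cmul c (f x)"
proof (induction c rule: int_induct[of _ 0])
  case (step1 c)
  then show ?case using assms by (simp add: frag_cmul_distrib additive.add)
next
  case (step2 c)
  then show ?case using assms by (simp add: frag_cmul_diff_distrib additive.diff)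
qed (use assms in \<open>simp add: additive.zero\<close>)

lemma additive_frag_eqI:
  assumes "additive f" "additive g" "\<And>x. f (frag_of x) = g (frag_of x)"
  shows "f v = g v"
proof -
  have "Poly_Mapping.keys v \<subseteq> UNIV" by simp
  then show ?thesis
    by (induction v rule: frag_induction) (use assms in \<open>simp_all add: additive.zero additive.diff\<close>)
qed

text \<open>Subgroups of an additive type without the \<open>monoid\<close> records. Containments
  below are proved by taking for \<open>N\<close> a preimage or a set of good elements and checking
  generators.\<close>

definition add_closed :: "'a::ab_group_add set \<Rightarrow> bool" where
  "add_closed N \<longleftrightarrow> 0 \<in> N \<and> (\<forall>a\<in>N. \<forall>b\<in>N. a - b \<in> N)"

lemma add_closed_zero: "add_closed N \<Longrightarrow> 0 \<in> N"
  and add_closed_diff: "add_closed N \<Longrightarrow> a \<in> N \<Longrightarrow> b \<in> N \<Longrightarrow> a - b \<in> N"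
  by (auto simp: add_closed_def)

lemma add_closed_minus: "add_closed N \<Longrightarrow> a \<in> N \<Longrightarrow> - a \<in> N"
  by (metis add_closed_diff add_closed_zero diff_0)

lemma add_closed_add: "add_closed N \<Longrightarrow> a \<in> N \<Longrightarrow> b \<in> N \<Longrightarrow> a + b \<in> N"
  by (metis add_closed_diff add_closed_minus diff_minus_eq_add)

lemma add_closed_sum:
  assumes "add_closed N" "\<And>x. x \<in> A \<Longrightarrow> f x \<in> N"
  shows "sum f A \<in> N"
  using assms(2)
  by (induction A rule: infinite_finite_induct)
    (auto simp: add_closed_zero add_closed_add assms(1))

lemma add_closed_frag_cmul: "add_closed N \<Longrightarrow> a \<in> N \<Longrightarrow> frag_cmul c a \<in> N"
  by (rule frag_closure_minus_cmul[where P = "\<lambda>x. x \<in> N"]) (auto simp: add_closed_diff add_closed_zero)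

lemma add_closed_vimage: "additive f \<Longrightarrow> add_closed N \<Longrightarrow> add_closed (f -` N)"
  by (simp add: add_closed_def additive.zero additive.diff)

lemma add_closed_frag_extend:
  assumes "add_closed N" "\<And>x. x \<in> Poly_Mapping.keys m \<Longrightarrow> f x \<in> N"
  shows "frag_extend f m \<in> N"
  unfolding frag_extend_def
  using assms by (intro add_closed_sum add_closed_frag_cmul)

section \<open>Words in simple reflections\<close>

lemma additive_reflection: "additive (reflection adj x)"
  by (simp add: additive_def reflection_def lookup_add frag_cmul_distrib)

lemma additive_aut_weight: "additive (aut_weight \<sigma>)"
  unfolding aut_weight_def by (rule additive_frag_extend)

lemma aut_weight_frag_of [simp]: "aut_weight \<sigma> (frag_of x) = frag_of (\<sigma> x)"
  by (simp add: aut_weight_def)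

lemma bij_aut_weight:
  assumes "bij \<sigma>"
  shows "bij (aut_weight \<sigma>)"
proof -
  have comp: "aut_weight f \<circ> aut_weight g = id" if "\<And>x. f (g x) = x" for f g :: "'a \<Rightarrow> 'a"
  proof
    fix v
    show "(aut_weight f \<circ> aut_weight g) v = id v"
      by (rule additive_frag_eqI[OF additive_comp[OF additive_aut_weight additive_aut_weight] additive_id])
        (simp add: that)
  qed
  show ?thesis
    by (rule o_bij[OF comp comp[of \<sigma> "inv_into UNIV \<sigma>"]])
      (use assms in \<open>simp_all add: bij_is_inj bij_is_surj surj_f_inv_f\<close>)
qed

lemma reflection_frag_of:
  "reflection adj x (frag_of y) = (if y = x then frag_of x - simple_root adj x else frag_of y)"
  by (auto simp: reflection_def)

lemma lookup_simple_root:
  fixes adj :: "'v::finite \<Rightarrow> 'v \<Rightarrow> bool"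
  shows "poly_mapping.lookup (simple_root adj x) y =
    (if y = x then 2 else 0) - (if adj x y then 1 else 0)"
proof -
  have "poly_mapping.lookup (\<Sum>z | adj x z. frag_of z) y = (\<Sum>z | adj x z. if z = y then 1 else 0)"
    unfolding lookup_sum by (intro sum.cong) auto
  also have "\<dots> = (if adj x y then 1 else 0)"
    by (subst sum.delta) auto
  finally show ?thesis by (simp add: simple_root_def lookup_minus)
qed

lemma reflection_involutive:
  fixes adj :: "'v::finite \<Rightarrow> 'v \<Rightarrow> bool"
  assumes "\<not> adj x x"
  shows "reflection adj x (reflection adj x v) = v"
proof -
  define c where "c = poly_mapping.lookup v x"
  \<comment> \<open>Without a loop at \<open>x\<close> the diagonal coefficient of the simple root
    is 2, so the reflection negates this coordinate.\<close>
  have "poly_mapping.lookup (reflection adj x v) x = - c"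
    using assms by (simp add: reflection_def lookup_minus lookup_simple_root c_def)
  then have "reflection adj x (reflection adj x v) = v - frag_cmul c (simple_root adj x) - frag_cmul (- c) (simple_root adj x)"
    by (simp add: reflection_def c_def)
  also have "\<dots> = v" by (simp flip: minus_frag_cmul)
  finally show ?thesis .
qed

definition refl_word :: "('v::finite \<Rightarrow> 'v \<Rightarrow> bool) \<Rightarrow> 'v list \<Rightarrow> 'v weight \<Rightarrow> 'v weight" where
  "refl_word adj vs = foldr (\<lambda>x w. reflection adj x \<circ> w) vs id"

lemma refl_word_Nil [simp]: "refl_word adj [] v = v"
  and refl_word_Cons: "refl_word adj (x # vs) v = reflection adj x (refl_word adj vs v)"
  by (simp_all add: refl_word_def)

lemma refl_word_append: "refl_word adj (vs @ us) v = refl_word adj vs (refl_word adj us v)"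
  by (induction vs) (simp_all add: refl_word_Cons)

lemma additive_refl_word: "additive (refl_word adj vs)"
  by (induction vs) (simp_all add: additive_def refl_word_Cons additive.add[OF additive_reflection])

lemma bij_refl_word:
  assumes "\<And>x. \<not> adj x x"
  shows "bij (refl_word adj vs)"
proof (induction vs)
  case Nil
  have "refl_word adj [] = id" by auto
  then show ?case by (simp only: bij_id)
next
  case (Cons x vs)
  have "refl_word adj (x # vs) = reflection adj x \<circ> refl_word adj vs"
    by (auto simp: refl_word_Cons)
  moreover have "bij (reflection adj x)"
    by (rule involuntory_imp_bij) (simp add: reflection_involutive assms)
  ultimately show ?case using Cons by (simp only: bij_comp)
qed

lemma refl_word_frag_of_notin: "y \<notin> set vs \<Longrightarrow> refl_word adj vs (frag_of y) = frag_of y"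
  by (induction vs) (auto simp: refl_word_Cons reflection_frag_of)

text \<open>Each reflection changes a vector by a multiple of its simple root. Only the simple roots
  at letters of the word have to lie in \<open>N\<close>, which permits inductions over prefixes of
  a word.\<close>

lemma refl_word_displacement:
  assumes "add_closed N" "\<And>x. x \<in> set vs \<Longrightarrow> simple_root adj x \<in> N"
  shows "refl_word adj vs v - v \<in> N"
  using assms(2)
proof (induction vs)
  case (Cons x vs)
  have eq: "refl_word adj (x # vs) v - v =
      (refl_word adj vs v - v) -
      frag_cmul (poly_mapping.lookup (refl_word adj vs v) x) (simple_root adj x)"
    by (simp add: refl_word_Cons reflection_def)
  have "refl_word adj vs v - v \<in> N" using Cons by simp
  moreover have "frag_cmul (poly_mapping.lookup (refl_word adj vs v) x) (simple_root adj x) \<in> N"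
    using Cons.prems by (intro add_closed_frag_cmul assms(1)) simp
  ultimately show ?case unfolding eq by (rule add_closed_diff[OF assms(1)])
qed (use assms in \<open>simp add: add_closed_zero\<close>)

lemma refl_word_mem_iff:
  assumes "add_closed N" "\<And>x. x \<in> set vs \<Longrightarrow> simple_root adj x \<in> N"
  shows "refl_word adj vs v \<in> N \<longleftrightarrow> v \<in> N"
  using refl_word_displacement[OF assms(1), of vs adj v, OF assms(2)] assms(1)
    add_closed_add[of N "refl_word adj vs v - v" v] add_closed_diff[of N "refl_word adj vs v" "refl_word adj vs v - v"]
  by auto

lemma additive_simple_root:
  assumes "additive f"
  shows "f (simple_root adj x) = f (frag_of x) + f (frag_of x) - (\<Sum>y | adj x y. f (frag_of y))"
proof -
  have "frag_cmul 2 v = v + v" for v :: "'a \<Rightarrow>\<^sub>0 int"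
    using frag_cmul_distrib[of 1 1 v] by simp
  then show ?thesis
    using assms by (simp add: simple_root_def additive.diff additive.add additive.sum)
qed

text \<open>Image under the word \<open>vs\<close> of the identity that \<open>\<varpi>_x\<close>
  plus its reflection at \<open>x\<close> is the sum of the fundamental weights at the neighbours of
  \<open>x\<close>. All mesh relations come from this.\<close>

lemma refl_word_snoc_frag_of:
  "refl_word adj (vs @ [x]) (frag_of x) + refl_word adj vs (frag_of x) =
    (\<Sum>y | adj x y. refl_word adj vs (frag_of y))"
proof -
  have "refl_word adj vs (simple_root adj x) = refl_word adj vs (frag_of x) +
      refl_word adj vs (frag_of x) - (\<Sum>y | adj x y. refl_word adj vs (frag_of y))"
    by (rule additive_simple_root[OF additive_refl_word])
  then show ?thesis
    by (simp add: refl_word_append refl_word_Cons reflection_frag_of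
        additive.diff[OF additive_refl_word])
qed

lemma refl_word_snoc_frag_of_other:
  "y \<noteq> x \<Longrightarrow> refl_word adj (vs @ [x]) (frag_of y) = refl_word adj vs (frag_of y)"
  by (simp add: refl_word_append refl_word_Cons reflection_frag_of)

lemma aut_weight_simple_root:
  fixes adj :: "'v::finite \<Rightarrow> 'v \<Rightarrow> bool"
  assumes "bij \<sigma>" "\<And>x y. adj (\<sigma> x) (\<sigma> y) \<longleftrightarrow> adj x y"
  shows "aut_weight \<sigma> (simple_root adj x) = simple_root adj (\<sigma> x)"
proof -
  have "{y. adj (\<sigma> x) y} = \<sigma> ` {y. adj x y}"
  proof (intro equalityI subsetI)
    fix y assume "y \<in> {y. adj (\<sigma> x) y}"
    moreover obtain z where "y = \<sigma> z" using assms(1) by (meson bij_pointE)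
    ultimately show "y \<in> \<sigma> ` {y. adj x y}" using assms(2) by auto
  qed (use assms(2) in auto)
  moreover have "inj_on \<sigma> A" for A using assms(1) by (meson bij_is_inj inj_on_subset subset_UNIV)
  ultimately have "(\<Sum>y | adj (\<sigma> x) y. frag_of y) = (\<Sum>y | adj x y. frag_of (\<sigma> y))"
    by (simp add: sum.reindex)
  then show ?thesis
    by (simp add: simple_root_def additive.diff[OF additive_aut_weight]
        additive.sum[OF additive_aut_weight] additive_frag_cmul[OF additive_aut_weight])
qed

lemma word_elt_eq_refl_word:
  assumes "\<exists>xs. compatible_reading adj \<sigma> X xs"
  obtains xs where "compatible_reading adj \<sigma> X xs" "word_elt adj \<sigma> X = refl_word adj (map fst xs)"
proof
  show "compatible_reading adj \<sigma> X (SOME xs. compatible_reading adj \<sigma> X xs)"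
    using assms by (rule someI_ex)
qed (simp add: word_elt_def refl_word_def foldr_map comp_def)

text \<open>Heights increase along arrows, so listing \<open>X\<close> by decreasing height is
  compatible. Hence the \<open>SOME\<close> in \<open>word_elt\<close> yields a genuine
  reading.\<close>

lemma compatible_reading_exists:
  fixes X :: "('v::finite \<times> int) set"
  assumes fin: "finite X"
  shows "\<exists>xs. compatible_reading adj \<sigma> X xs"
proof -
  obtain ys where ys: "set ys = X" "distinct ys" using finite_distinct_list[OF fin] by blast
  define xs where "xs = sort_key (\<lambda>x. - snd x) ys"
  have xs: "set xs = X" "distinct xs" "sorted (map (\<lambda>x. - snd x) xs)"
    using ys by (simp_all add: xs_def)
  have "k < k'" if "k < length xs" "k' < length xs" "rep_arrow adj \<sigma> (xs ! k') (xs ! k)" for k k'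
  proof (rule ccontr)
    assume "\<not> k < k'"
    then have "- snd (xs ! k') \<le> - snd (xs ! k)"
      using xs(3) that by (auto simp: sorted_iff_nth_mono)
    moreover have "orbit_size \<sigma> x > 0" for x
      by (simp add: orbit_size_def card_gt_0_iff orbit_nonempty)
    then have "min (orbit_size \<sigma> x) (orbit_size \<sigma> y) > 0" for x y by simp
    ultimately show False
      using that(3) by (auto simp: rep_arrow_def case_prod_unfold) (smt (verit))
  qed
  then show ?thesis using xs by (auto simp: compatible_reading_def)
qed

section \<open>The root lattice\<close>

lemma carrier_root_lattice:
  "carrier (root_lattice adj) = generate (free_Abelian_group UNIV) (range (simple_root adj))"
proof -
  have "carrier (free_Abelian_group UNIV) \<inter> range (simple_root adj) = range (simple_root adj)"
    by (auto simp: carrier_free_Abelian_group_iff)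
  then show ?thesis by (simp add: root_lattice_def carrier_subgroup_generated)
qed

lemma mult_root_lattice [simp]: "x \<otimes>\<^bsub>root_lattice adj\<^esub> y = x + y"
  by (simp add: root_lattice_def)

lemma one_root_lattice [simp]: "\<one>\<^bsub>root_lattice adj\<^esub> = 0"
  by (simp add: root_lattice_def)

lemma group_root_lattice: "group (root_lattice adj)"
  by (simp add: root_lattice_def group.group_subgroup_generated)

lemma add_closed_generate:
  assumes "B \<subseteq> carrier (free_Abelian_group S)"
  shows "add_closed (generate (free_Abelian_group S) B)"
proof -
  interpret group "free_Abelian_group S" by simp
  have sub: "subgroup (generate (free_Abelian_group S) B) (free_Abelian_group S)"
    using assms by (rule generate_is_subgroup)
  show ?thesis
    unfolding add_closed_def
  proof (intro conjI ballI)
    show "0 \<in> generate (free_Abelian_group S) B"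
      using subgroup.one_closed[OF sub] by simp
    fix a b assume ab: "a \<in> generate (free_Abelian_group S) B" "b \<in> generate (free_Abelian_group S) B"
    then have "Poly_Mapping.keys b \<subseteq> S" using subgroup.subset[OF sub] by (metis carrier_free_Abelian_group_iff subsetD)
    then show "a - b \<in> generate (free_Abelian_group S) B"
      using subgroup.m_closed[OF sub ab(1) subgroup.m_inv_closed[OF sub ab(2)]] by simp
  qed
qed

lemma generate_subset_add_closed:
  assumes "add_closed N" "B \<subseteq> N" "B \<subseteq> carrier (free_Abelian_group S)"
  shows "generate (free_Abelian_group S) B \<subseteq> N"
proof
  fix x assume "x \<in> generate (free_Abelian_group S) B"
  then show "x \<in> N"
  proof (induction rule: generate.induct)
    case (inv h)
    then have "Poly_Mapping.keys h \<subseteq> S" using assms(3) by (metis carrier_free_Abelian_group_iff subsetD)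
    with inv show ?case using assms by (auto simp: add_closed_minus)
  qed (use assms in \<open>auto simp: add_closed_zero add_closed_add\<close>)
qed

lemma add_closed_root_lattice: "add_closed (carrier (root_lattice adj))"
  unfolding carrier_root_lattice by (rule add_closed_generate) (auto simp: carrier_free_Abelian_group_iff)

lemma simple_root_in_root_lattice: "simple_root adj x \<in> carrier (root_lattice adj)"
  unfolding carrier_root_lattice by (rule generate.incl) simp

lemma root_lattice_subset:
  assumes "add_closed N" "\<And>x. simple_root adj x \<in> N"
  shows "carrier (root_lattice adj) \<subseteq> N"
  unfolding carrier_root_lattice by (rule generate_subset_add_closed[OF assms(1)])
    (use assms in \<open>auto simp: carrier_free_Abelian_group_iff\<close>)

text \<open>The coefficients form the Cartan matrix, which has trivial kernel; a left inverse of a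
  square matrix is a right inverse, so the columns span.\<close>

lemma real_span_simple_roots:
  fixes adj :: "'v::finite \<Rightarrow> 'v \<Rightarrow> bool"
  assumes ade: "ADE_diagram adj"
  shows "span (range (\<lambda>x. (\<chi> y. real_of_int (poly_mapping.lookup (simple_root adj x) y)) :: real^'v)) = UNIV"
proof -
  let ?A = "(\<chi> y x. real_of_int (poly_mapping.lookup (simple_root adj x) y)) :: real^'v^'v"
  have "c = 0" if "?A *v c = 0" for c
  proof -
    have "2 * c $ y = (\<Sum>x | adj y x. c $ x)" for y
    proof -
      have "0 = (?A *v c) $ y" using that by simp
      also have "\<dots> = (\<Sum>x\<in>UNIV. (if y = x then 2 * c $ x else 0) - (if adj y x then c $ x else 0))"
        unfolding matrix_vector_mult_def
        by (auto simp: lookup_simple_root ADE_sym[OF ade] intro!: sum.cong)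
      also have "\<dots> = 2 * c $ y - (\<Sum>x | adj y x. c $ x)"
        by (simp add: sum_subtractf sum.delta' sum.If_cases)
      finally show ?thesis by simp
    qed
    then have "c $ y = 0" for y by (rule ADE_kernel_trivial[OF ade])
    then show ?thesis by (simp add: vec_eq_iff)
  qed
  then have "\<exists>B. ?A ** B = mat 1"
    using matrix_left_invertible_ker[of ?A] matrix_left_right_inverse[of _ ?A] by blast
  then have "span (columns ?A) = UNIV"
    using matrix_right_invertible_span_columns[of ?A] by (simp add: span_vec_eq)
  moreover have "columns ?A = range (\<lambda>x. (\<chi> y. real_of_int (poly_mapping.lookup (simple_root adj x) y)))"
    by (auto simp: columns_def column_def)
  ultimately show ?thesis by simp
qed

section \<open>Orbits and height functions\<close>

lemma permutation_of_bij_finite: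
  fixes f :: "'v::finite \<Rightarrow> 'v"
  shows "bij f \<Longrightarrow> permutation f"
  by (simp add: permutation)

locale q_data =
  fixes adj :: "'v::finite \<Rightarrow> 'v \<Rightarrow> bool"
    and \<sigma> :: "'v \<Rightarrow> 'v"
    and \<epsilon> \<xi> :: "'v \<Rightarrow> int"
  assumes datum: "Q_datum adj \<sigma> \<xi>"
    and parity: "parity_function adj \<sigma> \<epsilon>"
    and compat: "height_compatible \<sigma> \<epsilon> \<xi>"
begin

abbreviation r :: nat where "r \<equiv> aut_order \<sigma>"
abbreviation orb :: "'v \<Rightarrow> 'v set" where "orb x \<equiv> orbit \<sigma> x"
abbreviation dd :: "'v \<Rightarrow> nat" where "dd x \<equiv> card (orb x)"

lemma ade: "ADE_diagram adj"
  using datum by (simp add: Q_datum_def)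

lemma folding: "bij \<sigma>" "adj (\<sigma> x) (\<sigma> y) \<longleftrightarrow> adj x y" "\<not> adj x (\<sigma> x)" "r \<in> {1, 2, 3}"
  using datum by (auto simp: Q_datum_def folding_aut_def)

lemma adj_sym: "adj x y \<longleftrightarrow> adj y x"
  using ADE_sym[OF ade] by blast

lemma irrefl: "\<not> adj x x"
  by (rule ADE_irrefl[OF ade])

lemma sigma_inj: "\<sigma> x = \<sigma> y \<longleftrightarrow> x = y"
  using folding(1) by (auto simp: bij_def inj_def)

lemma funpow_order: "(\<sigma> ^^ r) x = x"
proof -
  obtain n where "\<sigma> ^^ n = id" "n > 0"
    using permutation_is_nilpotent[OF permutation_of_bij_finite[OF folding(1)]] by blast
  then have "0 < r \<and> \<sigma> ^^ r = id"
    unfolding aut_order_def by (intro LeastI[of "\<lambda>n. 0 < n \<and> \<sigma> ^^ n = id" n]) simp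
  then show ?thesis by simp
qed

lemma orb_eq_image: "orb x = (\<lambda>l. (\<sigma> ^^ l) x) ` {..<r}"
proof (intro equalityI subsetI)
  fix y assume "y \<in> orb x"
  then obtain n where "y = (\<sigma> ^^ n) x" unfolding orbit_altdef by blast
  then have "y = (\<sigma> ^^ (n mod r)) x"
    using funpow_mod_eq[OF funpow_order] by simp
  moreover have "n mod r < r" using folding(4) by auto
  ultimately show "y \<in> (\<lambda>l. (\<sigma> ^^ l) x) ` {..<r}" by blast
next
  fix y assume "y \<in> (\<lambda>l. (\<sigma> ^^ l) x) ` {..<r}"
  then obtain l where l: "l < r" "y = (\<sigma> ^^ l) x" by blast
  then have "y = (\<sigma> ^^ (l + r)) x" "0 < l + r" by (simp_all add: funpow_add funpow_order)
  then show "y \<in> orb x" unfolding orbit_altdef by blast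
qed

lemma self_in_orb: "x \<in> orb x"
  using folding(4) by (auto simp: orb_eq_image intro!: image_eqI[of _ _ 0])

lemma orb_eqI:
  assumes "y \<in> orb x"
  shows "orb y = orb x"
proof
  show "orb y \<subseteq> orb x" using assms by (auto intro: orbit_trans)
  show "orb x \<subseteq> orb y" using orbit_swap[OF self_in_orb assms] by (auto intro: orbit_trans)
qed

lemma orb_eq_iff: "orb y = orb x \<longleftrightarrow> y \<in> orb x"
  using orb_eqI self_in_orb by metis

lemma orb_funpow [simp]: "orb ((\<sigma> ^^ l) x) = orb x"
  by (rule orb_eqI, rule funpow_in_orbit, rule self_in_orb)

lemma orb_sigma [simp]: "orb (\<sigma> x) = orb x"
  using orb_funpow[of 1 x] by simp

text \<open>As \<open>r\<close> is 1 or a prime, an orbit is a point or has exactly \<open>r\<close>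
  elements. For \<open>r = 3\<close>, returning to \<open>x\<close> after two steps as well as after
  three would make \<open>x\<close> fixed.\<close>

lemma dd_cases:
  obtains (fixed) "\<sigma> x = x" "orb x = {x}" "dd x = 1"
  | (moved) "\<sigma> x \<noteq> x" "dd x = r" "r = 2 \<or> r = 3" "inj_on (\<lambda>l. (\<sigma> ^^ l) x) {..<r}"
proof (cases "\<sigma> x = x")
  case True
  then show ?thesis using fixed orbit_eq_singleton_iff[of \<sigma> x] by simp
next
  case False
  have "r \<noteq> 1" using False funpow_order[of x] by auto
  then have r: "r = 2 \<or> r = 3" using folding(4) by auto
  have "inj_on (\<lambda>l. (\<sigma> ^^ l) x) {..<r}"
    using r
  proof
    assume "r = 2"
    moreover have "{..<2} = {0, 1::nat}" by auto
    ultimately show ?thesis using False by (simp add: inj_on_def)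
  next
    assume r3: "r = 3"
    have "\<sigma> (\<sigma> (\<sigma> x)) = x" using funpow_order[of x] r3 by (simp add: eval_nat_numeral)
    then have "\<sigma> (\<sigma> x) \<noteq> x" using False by metis
    moreover have "{..<3} = {0, 1, 2::nat}" by auto
    moreover have "\<sigma> (\<sigma> x) \<noteq> \<sigma> x" using False sigma_inj by blast
    ultimately show ?thesis using False r3 by (simp add: inj_on_def eval_nat_numeral)
  qed
  moreover from this have "dd x = r" by (simp add: orb_eq_image card_image)
  ultimately show ?thesis using moved False r by blast
qed

lemma dd_pos: "dd x > 0"
  by (cases x rule: dd_cases) auto

lemma dd_le: "dd x \<le> 3"
  by (cases x rule: dd_cases) auto

lemma dd_eq_cases: "dd x = 1 \<or> dd x = r"
  by (cases x rule: dd_cases) auto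

lemma fixed_iff: "\<sigma> x = x \<longleftrightarrow> dd x = 1"
  by (cases x rule: dd_cases) auto

lemma funpow_dd: "(\<sigma> ^^ dd x) x = x"
  by (cases x rule: dd_cases) (auto simp: funpow_order)

lemma orb_eq: "orb x = (\<lambda>l. (\<sigma> ^^ l) x) ` {..<dd x}"
  by (cases x rule: dd_cases) (auto simp: orb_eq_image)

lemma orb_memD: "y \<in> orb x \<Longrightarrow> \<exists>l<dd x. y = (\<sigma> ^^ l) x"
  using equalityD1[OF orb_eq[of x]] by blast

lemma inj_on_orb: "inj_on (\<lambda>l. (\<sigma> ^^ l) x) {..<dd x}"
proof (cases x rule: dd_cases)
  case fixed
  then have "{..<dd x} = {0}" by auto
  then show ?thesis by simp
qed simp

lemma funpow_eq_iff: "l < dd x \<Longrightarrow> (\<sigma> ^^ l) x = x \<longleftrightarrow> l = 0"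
  using inj_onD[OF inj_on_orb[of x], of l 0] dd_pos[of x] by auto

lemma adj_funpow: "adj ((\<sigma> ^^ l) x) ((\<sigma> ^^ l) y) \<longleftrightarrow> adj x y"
  by (induction l) (simp_all add: folding(2))

text \<open>In an orbit of at most three elements, two distinct elements are related by one
  application of \<open>\<sigma>\<close> in one of the two directions, and no vertex is adjacent to
  its image.\<close>

lemma adj_imp_orb_neq:
  assumes "adj x y"
  shows "orb x \<noteq> orb y"
proof
  assume "orb x = orb y"
  then have "y \<in> orb x" using self_in_orb by blast
  then obtain l where l: "l < dd x" "y = (\<sigma> ^^ l) x" using orb_memD by blast
  then have "l = 0 \<or> l = 1 \<or> l = 2 \<and> dd x = 3" using dd_le[of x] by linarith
  then show False
  proof (elim disjE conjE)
    assume "l = 2" "dd x = 3"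
    then have "\<sigma> y = x" using l funpow_dd[of x] by (simp add: eval_nat_numeral)
    then show False using assms folding(3) adj_sym by metis
  qed (use assms l irrefl folding(3) in auto)
qed

text \<open>Compatibility carries the congruences of \<open>\<epsilon>\<close> over to
  \<open>\<xi>\<close>; \<open>height_adj\<close> does the same along edges.\<close>

lemma height_funpow: "2 * int (dd x) dvd \<xi> ((\<sigma> ^^ l) x) - \<xi> x + 2 * int l"
proof -
  have 1: "[\<xi> ((\<sigma> ^^ l) x) = \<epsilon> ((\<sigma> ^^ l) x)] (mod 2 * int (dd x))"
    using compat unfolding height_compatible_def orbit_size_def by (metis orb_funpow)
  have 2: "[\<xi> x = \<epsilon> x] (mod 2 * int (dd x))"
    using compat unfolding height_compatible_def orbit_size_def by blast
  have 3: "[\<epsilon> ((\<sigma> ^^ l) x) = \<epsilon> x - 2 * int l] (mod 2 * int (dd x))"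
    using parity unfolding parity_function_def orbit_size_def by blast
  have "[\<epsilon> x - 2 * int l = \<xi> x - 2 * int l] (mod 2 * int (dd x))"
    using cong_diff[OF cong_sym[OF 2] cong_refl] .
  then have "[\<xi> ((\<sigma> ^^ l) x) = \<xi> x - 2 * int l] (mod 2 * int (dd x))"
    using 1 3 cong_trans by blast
  then show ?thesis by (simp add: cong_iff_dvd_diff algebra_simps)
qed

lemma height_adj:
  assumes "adj x y"
  shows "2 * int (min (dd x) (dd y)) dvd \<xi> x - \<xi> y - int (min (dd x) (dd y))"
proof -
  let ?m = "int (min (dd x) (dd y))"
  have m: "min (dd x) (dd y) dvd dd x" "min (dd x) (dd y) dvd dd y"
    using dd_eq_cases[of x] dd_eq_cases[of y] dd_pos[of x] dd_pos[of y]
    by (auto simp: min_def not_le less_Suc_eq_le le_Suc_eq)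
  have "2 * ?m dvd 2 * int (dd x)" "2 * ?m dvd 2 * int (dd y)"
    using m by (auto intro!: mult_dvd_mono simp only: int_dvd_int_iff dvd_refl)
  moreover have "[\<xi> x = \<epsilon> x] (mod 2 * int (dd x))" "[\<xi> y = \<epsilon> y] (mod 2 * int (dd y))"
    using compat unfolding height_compatible_def orbit_size_def by blast+
  ultimately have 1: "[\<xi> x = \<epsilon> x] (mod 2 * ?m)" "[\<xi> y = \<epsilon> y] (mod 2 * ?m)"
    using cong_dvd_modulus by blast+
  have 2: "[\<epsilon> x = \<epsilon> y + ?m] (mod 2 * ?m)"
    using parity assms unfolding parity_function_def orbit_size_def of_nat_min by blast
  have "[\<epsilon> y + ?m = \<xi> y + ?m] (mod 2 * ?m)"
    using cong_add[OF cong_sym[OF 1(2)] cong_refl] .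
  then have "[\<xi> x = \<xi> y + ?m] (mod 2 * ?m)"
    using 1 2 cong_trans by blast
  then show ?thesis by (simp add: cong_iff_dvd_diff algebra_simps)
qed

text \<open>\<open>l\<close> steps along the orbit change \<open>\<xi>\<close> by
  \<open>- 2 l\<close> modulo twice the orbit size, so the elements of an orbit have distinct
  residues.\<close>

lemma height_inj:
  assumes "y \<in> orb x" "2 * int (dd x) dvd \<xi> y - \<xi> x"
  shows "y = x"
proof -
  obtain l where l: "l < dd x" "y = (\<sigma> ^^ l) x" using orb_memD assms(1) by blast
  then have "2 * int (dd x) dvd (\<xi> y - \<xi> x + 2 * int l) - (\<xi> y - \<xi> x)"
    using height_funpow[of x l] assms(2) by (metis dvd_diff)
  then have "int (dd x) dvd int l" by simp
  then have "l = 0" using l(1) by (simp only: int_dvd_int_iff) (auto dest: dvd_imp_le)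
  then show ?thesis using l by simp
qed

lemma height_parity: "y \<in> orb x \<Longrightarrow> even (\<xi> y - \<xi> x)"
proof -
  assume "y \<in> orb x"
  then obtain l where "y = (\<sigma> ^^ l) x" using orb_memD by blast
  then have "2 dvd \<xi> y - \<xi> x + 2 * int l" using height_funpow[of x l] by (meson dvd_mult_left)
  then show ?thesis by simp
qed

lemma height_same_size: "adj x y \<Longrightarrow> dd x = dd y \<Longrightarrow> \<bar>\<xi> x - \<xi> y\<bar> = int (dd x)"
  using datum unfolding Q_datum_def height_function_def orbit_size_def by auto

section \<open>The vertex of greatest height in an orbit\<close>

definition top :: "'v \<Rightarrow> 'v" where "top x = top_elt \<xi> (orb x)"

lemma top_in_orb: "top x \<in> orb x" and height_le_top: "y \<in> orb x \<Longrightarrow> \<xi> y \<le> \<xi> (top x)"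
proof -
  have ne: "\<xi> ` orb x \<noteq> {}" "finite (\<xi> ` orb x)" using self_in_orb by auto
  then obtain t where t: "t \<in> orb x" "\<xi> t = Max (\<xi> ` orb x)" using Max_in[OF ne(2,1)] by (metis imageE)
  then have "is_arg_max \<xi> (\<lambda>y. y \<in> orb x) t"
    using ne by (auto simp: is_arg_max_linorder)
  then have "is_arg_max \<xi> (\<lambda>y. y \<in> orb x) (top x)"
    unfolding top_def top_elt_def arg_max_def by (rule someI)
  then show "top x \<in> orb x" "y \<in> orb x \<Longrightarrow> \<xi> y \<le> \<xi> (top x)"
    by (auto simp: is_arg_max_linorder)
qed

lemma orb_top [simp]: "orb (top x) = orb x"
  by (rule orb_eqI) (rule top_in_orb)

lemma top_cong: "orb x = orb y \<Longrightarrow> top x = top y"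
  by (simp add: top_def)

lemma top_top [simp]: "top (top x) = top x"
  by (rule top_cong) simp

lemma top_sigma [simp]: "top (\<sigma> x) = top x"
  by (rule top_cong) simp

lemma top_funpow [simp]: "top ((\<sigma> ^^ l) x) = top x"
  by (rule top_cong) simp

lemma top_fixed: "dd x = 1 \<Longrightarrow> top x = x"
  using top_in_orb[of x] by (cases x rule: dd_cases) auto

lemma height_lt_top:
  assumes "x \<noteq> top x"
  shows "\<xi> x \<le> \<xi> (top x) - 2"
proof -
  have "x \<in> orb (top x)" using self_in_orb by simp
  then have "\<xi> x \<le> \<xi> (top x)" "even (\<xi> x - \<xi> (top x))" "\<xi> x \<noteq> \<xi> (top x)"
    using height_le_top[of x "top x"] height_parity[of x "top x"] height_inj[of x "top x"] assms by auto
  then show ?thesis by presburger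
qed

lemma top_if_max:
  assumes "\<And>l. l < dd x \<Longrightarrow> \<xi> ((\<sigma> ^^ l) x) \<le> \<xi> x"
  shows "top x = x"
proof (rule ccontr)
  assume "top x \<noteq> x"
  moreover obtain l where "l < dd x" "top x = (\<sigma> ^^ l) x"
    using orb_memD[OF top_in_orb] by blast
  ultimately show False using assms[of l] height_lt_top[of x] by auto
qed

text \<open>The distinguished vertex that a height function provides on the larger orbit is its top
  vertex, because heights fall by 2 at each step from it.\<close>

lemma height_mixed:
  assumes "adj x y" "dd x < dd y"
  shows "dd x = 1" "dd y = r" "\<bar>\<xi> x - \<xi> (top y)\<bar> = 1"
    "l < r \<Longrightarrow> \<xi> ((\<sigma> ^^ l) (top y)) = \<xi> (top y) - 2 * int l"
proof -
  show "dd x = 1" "dd y = r" using assms(2) dd_eq_cases[of x] dd_eq_cases[of y] dd_pos[of x] by auto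
  have "orb x \<in> orbits \<sigma>" "orb y \<in> orbits \<sigma>" by (auto simp: orbits_def)
  moreover have "orbit_adj adj (orb x) (orb y)"
    using assms(1) self_in_orb by (auto simp: orbit_adj_def)
  moreover have "x \<in> orb x" by (rule self_in_orb)
  ultimately obtain t where t: "t \<in> orb y" "\<bar>\<xi> x - \<xi> t\<bar> = 1"
    and tl: "\<And>l. l < r \<Longrightarrow> \<xi> ((\<sigma> ^^ l) t) = \<xi> t - 2 * int l"
    using datum assms(2) unfolding Q_datum_def height_function_def by metis
  have "orb t = orb y" using t(1) by (rule orb_eqI)
  then have "top t = t" "top y = top t"
    using tl \<open>dd y = r\<close> by (auto intro!: top_if_max top_cong)
  then have "t = top y" by simp
  then show "\<bar>\<xi> x - \<xi> (top y)\<bar> = 1"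
    "l < r \<Longrightarrow> \<xi> ((\<sigma> ^^ l) (top y)) = \<xi> (top y) - 2 * int l"
    using t tl by auto
qed

lemma fixed_adj_orb: "dd x = 1 \<Longrightarrow> adj x y \<Longrightarrow> z \<in> orb y \<Longrightarrow> adj x z"
proof -
  assume x: "dd x = 1" and xy: "adj x y" and "z \<in> orb y"
  then obtain l where z: "z = (\<sigma> ^^ l) y" using orb_memD by blast
  have "(\<sigma> ^^ l) x = x" using x by (induction l) (simp_all add: fixed_iff)
  then show ?thesis using xy adj_funpow[of l x y] z by simp
qed

text \<open>If the orbits of \<open>x\<close> and \<open>y\<close> have equal size,
  \<open>height_adj\<close> makes the heights of \<open>y\<close> and \<open>z\<close> congruent
  modulo twice that size, and \<open>height_inj\<close> identifies them.\<close>

lemma neighbour_unique: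
  assumes "adj x y" "adj x z" "z \<in> orb y" "dd y \<le> dd x"
  shows "z = y"
proof (cases "dd y = 1")
  case True
  then show ?thesis using assms(3) by (cases y rule: dd_cases) auto
next
  case False
  then have dd: "dd x = dd y" "dd z = dd y"
    using dd_eq_cases[of x] dd_eq_cases[of y] assms dd_pos[of y] orb_eqI[of z y] by auto
  have "2 * int (dd y) dvd (\<xi> x - \<xi> y - int (dd y)) - (\<xi> x - \<xi> z - int (dd y))"
    by (rule dvd_diff) (use height_adj[OF assms(1)] height_adj[OF assms(2)] dd in simp_all)
  then have "2 * int (dd y) dvd \<xi> z - \<xi> y" by simp
  then show ?thesis using height_inj assms(3) by blast
qed

section \<open>Connectedness and three-element orbits\<close>

lemma connected: "s \<in> S \<Longrightarrow> (\<And>x y. x \<in> S \<Longrightarrow> adj x y \<Longrightarrow> y \<in> S) \<Longrightarrow> x \<in> S"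
  using ADE_connected[OF ade] by blast

lemma moved_has_neighbour:
  assumes "dd x \<noteq> 1"
  obtains y where "adj x y"
proof (rule ccontr)
  assume "\<not> thesis"
  then have "\<not> adj x y" for y using that by blast
  then have "\<sigma> x \<in> {x}" using connected[of x "{x}" "\<sigma> x"] by blast
  then show False using assms fixed_iff by auto
qed

text \<open>If every orbit had three elements, the parity function would take only two values modulo 6
  on a connected diagram, whereas it takes three on each orbit.\<close>

lemma order_three_fixed_vertex:
  assumes "r = 3"
  obtains z where "dd z = 1"
proof (rule ccontr)
  assume "\<not> thesis"
  then have dd: "dd x = 3" for x using that dd_eq_cases[of x] assms by auto
  fix s :: 'v
  let ?S = "{x. 3 dvd \<xi> x - \<xi> s}"
  have "\<sigma> s \<in> ?S"
  proof (rule connected)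
    show "s \<in> ?S" by simp
    fix x y assume "x \<in> ?S" "adj x y"
    have "2 * 3 dvd \<xi> x - \<xi> y - 3"
      using height_adj[OF \<open>adj x y\<close>] unfolding dd by simp
    then have "3 dvd \<xi> x - \<xi> y - 3" by (rule dvd_mult_right)
    with \<open>x \<in> ?S\<close> show "y \<in> ?S" unfolding mem_Collect_eq by presburger
  qed
  have "2 * 3 dvd \<xi> (\<sigma> s) - \<xi> s + 2"
    using height_funpow[of s 1] unfolding dd by simp
  then have "3 dvd \<xi> (\<sigma> s) - \<xi> s + 2" by (rule dvd_mult_right)
  with \<open>\<sigma> s \<in> ?S\<close> show False unfolding mem_Collect_eq by presburger
qed

text \<open>The diagram must be a fixed vertex \<open>z\<close> with an orbit of three leaves around
  it: by connectedness some fixed \<open>z\<close> has a moved neighbour \<open>y\<close>, the orbit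
  of \<open>y\<close> makes \<open>z\<close> trivalent, one of the three is a leaf, and
  \<open>\<sigma>\<close> spreads this to all of them.\<close>

lemma orbit_three:
  assumes "dd x = 3"
  shows "\<exists>z. dd z = 1 \<and> adj x z" "adj x y \<Longrightarrow> dd y = 1"
proof -
  have r: "r = 3" using assms dd_eq_cases[of x] by simp
  obtain s where s: "dd s = 1" using order_three_fixed_vertex[OF r] .
  have "\<exists>z y. dd z = 1 \<and> adj z y \<and> dd y \<noteq> 1"
  proof (rule ccontr)
    assume "\<not> ?thesis"
    then have "w \<in> {z. dd z = 1}" if "v \<in> {z. dd z = 1}" "adj v w" for v w
      using that by blast
    with s have "x \<in> {z. dd z = 1}" using connected[of s "{z. dd z = 1}" x] by blast
    then show False using assms by simp
  qed
  then obtain z y where z: "dd z = 1" "adj z y" "dd y \<noteq> 1" by blast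
  then have y: "dd y = 3" using dd_eq_cases[of y] r by simp
  have nb: "adj z ((\<sigma> ^^ l) y)" for l
    by (rule fixed_adj_orb[OF z(1,2)]) (rule funpow_in_orbit, rule self_in_orb)
  have dist: "(\<sigma> ^^ 0) y \<noteq> (\<sigma> ^^ 1) y" "(\<sigma> ^^ 0) y \<noteq> (\<sigma> ^^ 2) y" "(\<sigma> ^^ 1) y \<noteq> (\<sigma> ^^ 2) y"
    using inj_onD[OF inj_on_orb[of y], of 0 1] inj_onD[OF inj_on_orb[of y], of 0 2]
      inj_onD[OF inj_on_orb[of y], of 1 2] y by auto
  obtain l where l: "l \<in> {(\<sigma> ^^ 0) y, (\<sigma> ^^ 1) y, (\<sigma> ^^ 2) y}" "\<And>u. adj l u \<Longrightarrow> u = z"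
    and znb: "\<And>u. adj z u \<Longrightarrow> u \<in> {(\<sigma> ^^ 0) y, (\<sigma> ^^ 1) y, (\<sigma> ^^ 2) y}"
    using ADE_trivalent[OF ade nb nb nb dist] by blast
  \<comment> \<open>A power of \<open>\<sigma>\<close> carries \<open>w\<close> to the leaf
    \<open>l\<close> and fixes \<open>z\<close>, so \<open>z\<close> is also the only neighbour of
    \<open>w\<close>.\<close>
  have leaf: "u = z" if "adj w u" "w \<in> orb y" for w u
  proof -
    have "orb l = orb y" using l(1) by auto
    then have "w \<in> orb l" using that by simp
    then obtain k where k: "k < dd l" "w = (\<sigma> ^^ k) l" using orb_memD by blast
    define u' where "u' = (\<sigma> ^^ (dd l - k)) u"
    have "(\<sigma> ^^ (dd l - k)) w = l"
      using k funpow_dd[of l] by (simp flip: funpow_add[THEN fun_cong, simplified comp_apply])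
    then have "adj l u'" using that(1) adj_funpow unfolding u'_def by metis
    then have "u' = z" by (rule l(2))
    moreover have "(\<sigma> ^^ n) z = z" for n
      using z(1) by (induction n) (simp_all add: fixed_iff)
    ultimately have "(\<sigma> ^^ (dd l - k)) u = (\<sigma> ^^ (dd l - k)) z"
      unfolding u'_def by simp
    then show "u = z"
      using bij_fn[OF folding(1)] by (metis bij_is_inj injD)
  qed
  have all: "v \<in> insert z (orb y)" for v
  proof (rule connected)
    show "z \<in> insert z (orb y)" by simp
    fix v w assume "v \<in> insert z (orb y)" "adj v w"
    then show "w \<in> insert z (orb y)"
      using leaf znb[of w] by (auto simp flip: orb_eq_iff)
  qed
  have "x \<in> orb y" using all[of x] assms z(1) by auto
  then show "adj x y \<Longrightarrow> dd y = 1" "\<exists>z. dd z = 1 \<and> adj x z" for y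
    using leaf[of x] z(1) fixed_adj_orb[OF z(1,2)] adj_sym by blast+
qed

section \<open>The mesh relations\<close>

abbreviation w :: "'v weight \<Rightarrow> 'v weight" where "w \<equiv> word_elt adj \<sigma> (X_circ \<sigma> \<xi>)"
abbreviation t :: "'v weight \<Rightarrow> 'v weight" where "t \<equiv> tau_circ adj \<sigma> \<xi>"

lemma top_adj_height:
  assumes "adj x y" "top x = x" "top y = y"
  shows "\<bar>\<xi> x - \<xi> y\<bar> = int (min (dd x) (dd y))"
proof (cases "dd x" "dd y" rule: linorder_cases)
  case less
  then show ?thesis using height_mixed[OF assms(1) less] assms(3) by simp
next
  case equal
  then show ?thesis using height_same_size[OF assms(1)] by simp
next
  case greater
  then show ?thesis
    using height_mixed[OF assms(1)[unfolded adj_sym[of x y]] greater] assms(2) by simp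
qed

lemma X_circ_eq: "X_circ \<sigma> \<xi> = (\<lambda>x. (x, \<xi> x)) ` {x. top x = x}"
proof (intro equalityI subsetI)
  fix z assume "z \<in> X_circ \<sigma> \<xi>"
  then obtain x where "z = (top x, \<xi> (top x))"
    unfolding X_circ_def orbits_def top_def by blast
  then show "z \<in> (\<lambda>x. (x, \<xi> x)) ` {x. top x = x}" by auto
next
  fix z assume "z \<in> (\<lambda>x. (x, \<xi> x)) ` {x. top x = x}"
  then obtain x where "top x = x" "z = (x, \<xi> x)" by blast
  then have "z = (top_elt \<xi> (orb x), \<xi> (top_elt \<xi> (orb x)))" by (simp add: top_def)
  then show "z \<in> X_circ \<sigma> \<xi>" unfolding X_circ_def orbits_def by blast
qed

text \<open>Adjacent top vertices differ in height by the smaller of their orbit sizes, so an arrow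
  leads from the lower to the higher, and targets are read first. This settles, for every reading,
  which neighbours precede a letter.\<close>

lemma circ_reading:
  obtains vs where "w = refl_word adj vs" "distinct vs" "set vs = {x. top x = x}"
    "\<And>a x b y. vs = a @ x # b \<Longrightarrow> adj x y \<Longrightarrow> y \<in> set a \<longleftrightarrow> top y = y \<and> \<xi> x < \<xi> y"
proof -
  have "finite (X_circ \<sigma> \<xi>)" unfolding X_circ_eq by simp
  then obtain xs where xs: "compatible_reading adj \<sigma> (X_circ \<sigma> \<xi>) xs"
    and w: "w = refl_word adj (map fst xs)"
    using word_elt_eq_refl_word[OF compatible_reading_exists] by metis
  define vs where "vs = map fst xs"
  have set_xs: "set xs = (\<lambda>x. (x, \<xi> x)) ` {x. top x = x}" and dist_xs: "distinct xs"
    using xs by (simp_all add: compatible_reading_def X_circ_eq)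
  have xs_nth: "xs ! k = (vs ! k, \<xi> (vs ! k))" if "k < length vs" for k
    using nth_mem[of k xs] that unfolding set_xs vs_def by auto
  have set_vs: "set vs = {x. top x = x}" unfolding vs_def set_map set_xs by force
  have dist_vs: "distinct vs"
    unfolding vs_def distinct_map using dist_xs set_xs by (auto simp: inj_on_def)
  have "y \<in> set a \<longleftrightarrow> top y = y \<and> \<xi> x < \<xi> y" if vs: "vs = a @ x # b" and xy: "adj x y" for a x b y
  proof -
    define k where "k = length a"
    have k: "k < length vs" "vs ! k = x" by (simp_all add: vs k_def)
    have "x \<in> set vs" using vs by simp
    then have tx: "top x = x" unfolding set_vs by simp
    have order: "m < m'" if "m < length vs" "m' < length vs" "adj (vs ! m') (vs ! m)"
      "\<xi> (vs ! m) - \<xi> (vs ! m') = int (min (dd (vs ! m')) (dd (vs ! m)))" for m m'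
    proof -
      have "rep_arrow adj \<sigma> (xs ! m') (xs ! m)"
        using that by (simp add: xs_nth rep_arrow_def orbit_size_def)
      moreover have "m < length xs" "m' < length xs" using that by (simp_all add: vs_def)
      ultimately show ?thesis using xs unfolding compatible_reading_def by blast
    qed
    show ?thesis
    proof
      assume "y \<in> set a"
      then obtain m where m: "m < k" "vs ! m = y" by (auto simp: in_set_conv_nth k_def vs nth_append)
      have "y \<in> set vs" using \<open>y \<in> set a\<close> vs by simp
      then have ty: "top y = y" unfolding set_vs by simp
      have "m < length vs" using m k by simp
      have "\<not> \<xi> y \<le> \<xi> x"
      proof
        assume "\<xi> y \<le> \<xi> x"
        then have "\<xi> x - \<xi> y = int (min (dd y) (dd x))"
          using top_adj_height[OF xy tx ty] by simp
        then have "k < m" using order[OF k(1) \<open>m < length vs\<close>] m k xy adj_sym by simp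
        then show False using m by simp
      qed
      then show "top y = y \<and> \<xi> x < \<xi> y" using ty by simp
    next
      assume y: "top y = y \<and> \<xi> x < \<xi> y"
      then obtain m where m: "m < length vs" "vs ! m = y"
        using set_vs in_set_conv_nth[of y vs] by auto
      have "\<xi> y - \<xi> x = int (min (dd x) (dd y))"
        using top_adj_height[OF xy tx] y by simp
      then have "m < k" using order[OF m(1) k(1)] m k xy by simp
      then show "y \<in> set a" using m by (auto simp: vs k_def nth_append)
    qed
  qed
  then show ?thesis by (rule that[OF w[folded vs_def] dist_vs set_vs])
qed

lemma additive_w: "additive w"
  by (rule circ_reading) (simp add: additive_refl_word)

lemma bij_w: "bij w"
  by (rule circ_reading) (simp add: bij_refl_word irrefl)

lemma w_not_top: "top x \<noteq> x \<Longrightarrow> w (frag_of x) = frag_of x"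
  by (rule circ_reading) (simp add: refl_word_frag_of_notin)

text \<open>Split the word at its only \<open>x\<close> as \<open>a @ x # b\<close>; both
  \<open>a\<close> and \<open>b\<close> fix \<open>\<varpi>_x\<close>. A neighbour occurring in
  \<open>a\<close> does not recur later, so \<open>a\<close> acts on its weight like the full word,
  while the weight of any other neighbour is fixed by \<open>a\<close>.\<close>

lemma w_mesh:
  assumes x: "top x = x"
  shows "frag_of x + w (frag_of x) =
    (\<Sum>y | adj x y. if top y = y \<and> \<xi> x < \<xi> y then w (frag_of y) else frag_of y)"
proof -
  obtain vs where vs: "w = refl_word adj vs" "distinct vs" "set vs = {x. top x = x}"
    and order: "\<And>a x b y. vs = a @ x # b \<Longrightarrow> adj x y \<Longrightarrow> y \<in> set a \<longleftrightarrow> top y = y \<and> \<xi> x < \<xi> y"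
    by (rule circ_reading, rule that)
  obtain a b where ab: "vs = a @ x # b" using x vs(3) split_list by fastforce
  have notin: "x \<notin> set a" "x \<notin> set b" "set a \<inter> set b = {}" using vs(2) ab by auto
  have wx: "w (frag_of x) = refl_word adj (a @ [x]) (frag_of x)"
    using notin by (simp add: vs(1) ab refl_word_append refl_word_Cons refl_word_frag_of_notin)
  have "refl_word adj a (frag_of y) =
      (if top y = y \<and> \<xi> x < \<xi> y then w (frag_of y) else frag_of y)" if "adj x y" for y
  proof (cases "y \<in> set a")
    case True
    then have "y \<notin> set b" "y \<noteq> x" using notin by auto
    then have "w (frag_of y) = refl_word adj a (frag_of y)"
      by (simp add: vs(1) ab refl_word_append refl_word_Cons refl_word_frag_of_notin reflection_frag_of)
    then show ?thesis using True order[OF ab that] by simp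
  next
    case False
    then show ?thesis using order[OF ab that] by (auto simp: refl_word_frag_of_notin)
  qed
  then have "(\<Sum>y | adj x y. refl_word adj a (frag_of y)) =
      (\<Sum>y | adj x y. if top y = y \<and> \<xi> x < \<xi> y then w (frag_of y) else frag_of y)"
    by (intro sum.cong) auto
  then show ?thesis
    using refl_word_snoc_frag_of[of adj a x] notin wx
    by (simp add: refl_word_frag_of_notin add.commute)
qed

section \<open>The twisted Coxeter element \<open>t\<close> and the weights
  \<open>Phi\<close>\<close>

lemma t_eq: "t = w \<circ> aut_weight \<sigma>"
  by (simp add: tau_circ_def)

lemma additive_t: "additive t"
  unfolding t_eq by (rule additive_comp[OF additive_w additive_aut_weight])

lemma bij_t: "bij t"
  unfolding t_eq by (rule bij_comp[OF bij_aut_weight[OF folding(1)] bij_w])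

lemma t_frag_of: "t (frag_of x) = w (frag_of (\<sigma> x))"
  by (simp add: t_eq)

text \<open>\<open>w\<close> fixes the weights at vertices other than the tops, so \<open>t\<close>
  acts like \<open>\<sigma>\<close> until the orbit returns to its top; only there, after
  \<open>dd x\<close> steps, does \<open>w\<close> intervene.\<close>

lemma t_funpow_top: "l < dd x \<Longrightarrow> top x = x \<Longrightarrow> (t ^^ l) (frag_of x) = frag_of ((\<sigma> ^^ l) x)"
proof (induction l)
  case (Suc l)
  have "(\<sigma> ^^ Suc l) x \<noteq> x" using funpow_eq_iff[OF Suc.prems(1)] by simp
  moreover have "top ((\<sigma> ^^ Suc l) x) = x" using Suc.prems(2) top_funpow[of "Suc l" x] by simp
  ultimately have "w (frag_of ((\<sigma> ^^ Suc l) x)) = frag_of ((\<sigma> ^^ Suc l) x)"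
    by (intro w_not_top) simp
  then show ?case using Suc by (simp add: t_frag_of)
qed simp

lemma t_funpow_dd: "top x = x \<Longrightarrow> (t ^^ dd x) (frag_of x) = w (frag_of x)"
proof -
  assume x: "top x = x"
  obtain m where m: "dd x = Suc m" using dd_pos[of x] gr0_implies_Suc by blast
  then have "(t ^^ m) (frag_of x) = frag_of ((\<sigma> ^^ m) x)" using x by (intro t_funpow_top) auto
  then show ?thesis using m funpow_dd[of x] by (simp add: t_frag_of)
qed

text \<open>For even \<open>\<xi> (top_elt \<xi> j) - p\<close>, the weights \<open>Phi j p\<close> extend the fundamental
  weights on the orbit \<open>j\<close> along the repetition quiver.\<close>

definition Phi :: "'v set \<Rightarrow> int \<Rightarrow> 'v weight" where
  "Phi j p = int_power t ((\<xi> (top_elt \<xi> j) - p) div 2) (frag_of (top_elt \<xi> j))"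

text \<open>An even shift passes through \<open>div 2\<close>, so this holds for every
  \<open>p\<close>, whatever its parity.\<close>

lemma Phi_shift: "Phi j (p - 2 * k) = int_power t k (Phi j p)"
proof -
  have "(\<xi> (top_elt \<xi> j) - (p - 2 * k)) div 2 = k + (\<xi> (top_elt \<xi> j) - p) div 2" by simp
  then show ?thesis unfolding Phi_def by (simp only: int_power_add[OF bij_t])
qed

lemma Phi_orb: "Phi (orb x) (\<xi> (top x) - 2 * k) = int_power t k (frag_of (top x))"
  by (simp add: Phi_def top_def)

lemma Phi_top: "l < dd x \<Longrightarrow> Phi (orb x) (\<xi> (top x) - 2 * int l) = frag_of ((\<sigma> ^^ l) (top x))"
  unfolding Phi_orb int_power_of_nat by (rule t_funpow_top) simp_all

lemma Phi_top_dd: "Phi (orb x) (\<xi> (top x) - 2 * int (dd x)) = w (frag_of (top x))"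
  unfolding Phi_orb int_power_of_nat using t_funpow_dd[of "top x"] by simp

text \<open>Contribution of a neighbouring orbit \<open>j\<close> to the mesh at height
  \<open>p\<close> of an orbit of size \<open>d\<close>. A larger \<open>j\<close> surrounds a fixed
  vertex and enters with \<open>card j\<close> weights, at heights \<open>p - 1\<close>,
  \<open>p - 3\<close> and so on; otherwise a single weight enters.\<close>

definition mesh_term :: "nat \<Rightarrow> 'v set \<Rightarrow> int \<Rightarrow> 'v weight" where
  "mesh_term d j p = (if card j \<le> d then Phi j (p - int (card j))
     else (\<Sum>l<card j. Phi j (p - 1 - 2 * int l)))"

lemma mesh_term_shift: "mesh_term d j (p - 2 * k) = int_power t k (mesh_term d j p)"
proof -
  have "Phi j (p - 2 * k - q) = int_power t k (Phi j (p - q))" for q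
    using Phi_shift[of j "p - q" k] by (simp add: algebra_simps)
  then show ?thesis
    by (simp add: mesh_term_def additive.sum[OF additive_int_power[OF additive_t bij_t]] diff_diff_eq
        add.assoc)
qed

lemma mesh_term_smaller:
  assumes x: "top x = x" and xy: "adj x y" and le: "dd y \<le> dd x"
  shows "(if top y = y \<and> \<xi> x < \<xi> y then w (frag_of y) else frag_of y) = Phi (orb y) (\<xi> x - int (dd y))"
proof (cases "top y = y")
  case True
  have h: "\<bar>\<xi> x - \<xi> y\<bar> = int (dd y)" using top_adj_height[OF xy x True] le by simp
  show ?thesis
  proof (cases "\<xi> x < \<xi> y")
    case less: True
    then have "\<xi> x - int (dd y) = \<xi> (top y) - 2 * int (dd y)" using h True by simp
    then show ?thesis unfolding \<open>\<xi> x - int (dd y) = _\<close> Phi_top_dd using less True by simp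
  next
    case False
    then have "\<xi> x - int (dd y) = \<xi> (top y) - 2 * int 0" using h True by simp
    then show ?thesis
      unfolding \<open>\<xi> x - int (dd y) = _\<close> using Phi_top[of 0 y] dd_pos[of y] False True by simp
  qed
next
  \<comment> \<open>If \<open>y\<close> is not a top vertex, both orbits have size two and
    \<open>\<sigma> x\<close> is adjacent to \<open>top y\<close>. The two edges and the two orbit
    gaps then force \<open>\<xi> x = \<xi> (top y)\<close>, so \<open>\<varpi>_y\<close> sits at
    height \<open>\<xi> x - 2\<close>.\<close>
  case False
  have ne1: "dd y \<noteq> 1" using False top_fixed by blast
  then have eq: "dd x = dd y" using le dd_eq_cases[of x] dd_eq_cases[of y] dd_pos[of y] by auto
  have "dd x \<noteq> 3" using orbit_three(2)[OF _ xy] ne1 by blast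
  then have two: "dd y = 2" using eq ne1 dd_pos[of y] dd_le[of y] by linarith
  have "y \<in> orb (top y)" using self_in_orb by simp
  then obtain l where l: "l < dd (top y)" "y = (\<sigma> ^^ l) (top y)" using orb_memD by blast
  then have y: "y = \<sigma> (top y)" using two False by (cases l) (auto simp: less_Suc_eq)
  have "\<sigma> y = top y" using y funpow_dd[of "top y"] two by (simp add: numeral_2_eq_2)
  then have "\<bar>\<xi> (\<sigma> x) - \<xi> (top y)\<bar> = 2"
    using height_same_size[of "\<sigma> x" "\<sigma> y"] folding(2)[of x y] xy eq two by simp
  moreover have "\<bar>\<xi> x - \<xi> y\<bar> = 2" using height_same_size[OF xy eq] two eq by simp
  moreover have "\<xi> y \<le> \<xi> (top y) - 2" using height_lt_top[of y] False by simp
  moreover have "\<xi> (\<sigma> x) \<le> \<xi> x - 2"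
    using height_lt_top[of "\<sigma> x"] x two eq fixed_iff[of x] by auto
  ultimately have "\<xi> x = \<xi> (top y)" by linarith
  then have "Phi (orb y) (\<xi> x - int (dd y)) = frag_of (\<sigma> (top y))"
    using Phi_top[of 1 y] two by simp
  then show ?thesis using False y by simp
qed

text \<open>The weights on the orbit are consecutive values of \<open>Phi\<close>. If the top vertex
  lies above \<open>x\<close>, applying \<open>w\<close> to its weight drops the first value and
  appends the one after the last. In both cases the values start at height
  \<open>\<xi> x - 1\<close>.\<close>

lemma mesh_term_larger:
  assumes x: "top x = x" and xy: "adj x y" and less: "dd x < dd y"
  shows "(\<Sum>z\<in>orb y. if top z = z \<and> \<xi> x < \<xi> z then w (frag_of z) else frag_of z) =
    (\<Sum>l<dd y. Phi (orb y) (\<xi> x - 1 - 2 * int l))"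
proof -
  note mixed = height_mixed[OF xy less]
  define f where "f = (\<lambda>z. if top z = z \<and> \<xi> x < \<xi> z then w (frag_of z) else frag_of z)"
  define g where "g = (\<lambda>l::nat. Phi (orb y) (\<xi> (top y) - 2 * int l))"
  obtain m where m: "dd y = Suc m" using dd_pos[of y] gr0_implies_Suc by blast
  have f_Suc: "f ((\<sigma> ^^ Suc l) (top y)) = g (Suc l)" if "l < m" for l
  proof -
    have "(\<sigma> ^^ Suc l) (top y) \<noteq> top y" using funpow_eq_iff[of "Suc l" "top y"] m that by simp
    moreover have "top ((\<sigma> ^^ Suc l) (top y)) = top y" using top_funpow[of "Suc l" "top y"] by simp
    ultimately show ?thesis using Phi_top[of "Suc l" y] m that by (simp add: f_def g_def)
  qed
  have "(\<Sum>z\<in>orb y. f z) = (\<Sum>l<dd y. f ((\<sigma> ^^ l) (top y)))"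
    using sum.reindex[OF inj_on_orb[of "top y"], of f] orb_eq[of "top y"] by simp
  also have "\<dots> = f (top y) + (\<Sum>l<m. g (Suc l))"
    unfolding m sum.lessThan_Suc_shift using f_Suc by simp
  also have "\<dots> = (\<Sum>l<dd y. Phi (orb y) (\<xi> x - 1 - 2 * int l))"
  proof (cases "\<xi> x < \<xi> (top y)")
    case True
    then have "f (top y) = g (Suc m)"
      using Phi_top_dd[of y] by (simp add: f_def g_def m)
    moreover have "\<xi> x - 1 - 2 * int l = \<xi> (top y) - 2 * int (Suc l)" for l
      using True mixed(3) by simp
    ultimately show ?thesis unfolding m by (simp only: g_def sum.lessThan_Suc add.commute)
  next
    case False
    then have "f (top y) = g 0"
      using Phi_top[of 0 y] dd_pos[of y] by (simp add: f_def g_def)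
    moreover have "\<xi> x - 1 - 2 * int l = \<xi> (top y) - 2 * int l" for l
      using False mixed(3) by simp
    ultimately show ?thesis unfolding m sum.lessThan_Suc_shift by (simp add: g_def)
  qed
  finally show ?thesis unfolding f_def .
qed

section \<open>Mesh relations grouped by orbits\<close>

definition nb_orbits :: "'v \<Rightarrow> 'v set set" where
  "nb_orbits x = orb ` {y. adj x y}"

lemma mesh_top:
  assumes x: "top x = x"
  shows "Phi (orb x) (\<xi> x) + Phi (orb x) (\<xi> x - 2 * int (dd x)) =
    (\<Sum>j\<in>nb_orbits x. mesh_term (dd x) j (\<xi> x))"
proof -
  define f where "f = (\<lambda>z. if top z = z \<and> \<xi> x < \<xi> z then w (frag_of z) else frag_of z)"
  have "Phi (orb x) (\<xi> x) + Phi (orb x) (\<xi> x - 2 * int (dd x)) = frag_of x + w (frag_of x)"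
    using Phi_top[of 0 x] Phi_top_dd[of x] dd_pos[of x] x by simp
  also have "\<dots> = (\<Sum>y | adj x y. f y)" unfolding f_def by (rule w_mesh[OF x])
  also have "\<dots> = (\<Sum>j\<in>nb_orbits x. \<Sum>y | y \<in> {y. adj x y} \<and> orb y = j. f y)"
    unfolding nb_orbits_def by (rule sum.image_gen) simp
  also have "\<dots> = (\<Sum>j\<in>nb_orbits x. mesh_term (dd x) j (\<xi> x))"
  proof (rule sum.cong)
    fix j assume "j \<in> nb_orbits x"
    then obtain y where y: "adj x y" "j = orb y" unfolding nb_orbits_def by blast
    show "(\<Sum>y | y \<in> {y. adj x y} \<and> orb y = j. f y) = mesh_term (dd x) j (\<xi> x)"
    proof (cases "dd y \<le> dd x")
      case True
      then have "{z. z \<in> {y. adj x y} \<and> orb z = j} = {y}"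
        using y neighbour_unique[OF y(1)] by (auto simp: orb_eq_iff intro: self_in_orb)
      then show ?thesis
        using mesh_term_smaller[OF x y(1) True] True y by (simp add: f_def mesh_term_def)
    next
      case False
      then have less: "dd x < dd y" by simp
      have "{z. z \<in> {y. adj x y} \<and> orb z = j} = orb y"
        using y fixed_adj_orb[OF height_mixed(1)[OF y(1) less] y(1)] by (auto simp: orb_eq_iff)
      then show ?thesis
        using mesh_term_larger[OF x y(1) less] False y by (simp add: f_def mesh_term_def)
    qed
  qed simp
  finally show ?thesis .
qed

lemma nb_orbits_iff: "orbit_adj adj j (orb x) \<and> j \<in> orbits \<sigma> \<longleftrightarrow> j \<in> nb_orbits x"
proof
  assume "orbit_adj adj j (orb x) \<and> j \<in> orbits \<sigma>"
  then obtain y z where y: "y \<in> j" "z \<in> orb x" "adj y z" and "j \<in> range orb"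
    unfolding orbit_adj_def orbits_def by blast
  then have j: "j = orb y" using orb_eqI by blast
  have "x \<in> orb z" using orb_eqI[OF y(2)] self_in_orb by blast
  then obtain l where "x = (\<sigma> ^^ l) z" using orb_memD by blast
  then have "adj x ((\<sigma> ^^ l) y)" using adj_funpow y(3) adj_sym by blast
  then show "j \<in> nb_orbits x" unfolding nb_orbits_def j by (auto intro!: image_eqI[of _ _ "(\<sigma> ^^ l) y"])
next
  assume "j \<in> nb_orbits x"
  then obtain y where "adj x y" "j = orb y" unfolding nb_orbits_def by blast
  then show "orbit_adj adj j (orb x) \<and> j \<in> orbits \<sigma>"
    unfolding orbit_adj_def orbits_def using self_in_orb adj_sym by blast
qed

lemma nb_orbits_cong: "orb x = orb y \<Longrightarrow> nb_orbits x = nb_orbits y"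
  using nb_orbits_iff[of _ x] nb_orbits_iff[of _ y] by auto

text \<open>The relation at the top vertex, translated by a power of \<open>t\<close>.\<close>

lemma mesh:
  assumes "even (p - \<xi> x)"
  shows "Phi (orb x) p + Phi (orb x) (p - 2 * int (dd x)) =
    (\<Sum>j\<in>nb_orbits x. mesh_term (dd x) j p)"
proof -
  have "even (\<xi> (top x) - \<xi> x)" using height_parity[OF top_in_orb] .
  then have "even (\<xi> (top x) - p)" using assms by presburger
  then obtain k where "\<xi> (top x) - p = 2 * k" by (rule evenE)
  then have p: "p = \<xi> (top x) - 2 * k" by simp
  have "Phi (orb x) (p - 2 * int (dd x)) = int_power t k (Phi (orb x) (\<xi> (top x) - 2 * int (dd x)))"
    using Phi_shift[of "orb x" "\<xi> (top x) - 2 * int (dd x)" k] by (simp add: p algebra_simps)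
  moreover have "Phi (orb x) p = int_power t k (Phi (orb x) (\<xi> (top x)))"
    unfolding p by (rule Phi_shift)
  moreover have "mesh_term (dd x) j p = int_power t k (mesh_term (dd x) j (\<xi> (top x)))" for j
    unfolding p by (rule mesh_term_shift)
  moreover have "Phi (orb x) (\<xi> (top x)) + Phi (orb x) (\<xi> (top x) - 2 * int (dd x)) =
      (\<Sum>j\<in>nb_orbits x. mesh_term (dd x) j (\<xi> (top x)))"
    using mesh_top[of "top x"] nb_orbits_cong[of "top x" x] by simp
  ultimately show ?thesis
    by (simp add: additive.sum[OF additive_int_power[OF additive_t bij_t], symmetric]
        additive.add[OF additive_int_power[OF additive_t bij_t], symmetric])
qed

section \<open>Differences of \<open>Phi\<close> and the relation behind
  \<open>A_elt\<close>\<close>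

definition wt0 :: "'v set \<Rightarrow> int \<Rightarrow> 'v weight" where
  "wt0 j p = Phi j p - Phi j (p - 2 * int (card j))"

lemma cartan_nb_orbits:
  assumes "j \<in> nb_orbits x"
  shows "cartan adj j (orb x) = (if dd x \<le> card j then - 1 else - int (dd x))"
proof -
  obtain y where y: "adj x y" "j = orb y" using assms unfolding nb_orbits_def by blast
  have "orb y \<noteq> orb x" using adj_imp_orb_neq[OF y(1)] by simp
  then have c: "cartan adj j (orb x) = - \<lceil>real (dd x) / real (dd y)\<rceil>"
    using nb_orbits_iff[of j x] assms y by (simp add: cartan_def)
  show ?thesis
  proof (cases "dd x \<le> dd y")
    case True
    then have "0 < real (dd x) / real (dd y)" "real (dd x) / real (dd y) \<le> 1"
      using dd_pos[of x] dd_pos[of y] by (simp_all add: divide_simps)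
    then have "\<lceil>real (dd x) / real (dd y)\<rceil> = 1" by (intro ceiling_unique) auto
    then show ?thesis using c True y by simp
  next
    case False
    then have "dd y = 1" using dd_eq_cases[of x] dd_eq_cases[of y] dd_pos[of x] dd_pos[of y] by auto
    then show ?thesis using c False y by simp
  qed
qed

lemma cartan_eq_imp_nb_orbits:
  assumes "c < 0"
  shows "{j. j \<in> orbits \<sigma> \<and> cartan adj j (orb x) = c} = {j \<in> nb_orbits x. cartan adj j (orb x) = c}"
  using assms nb_orbits_iff[of _ x] by (auto simp: cartan_def split: if_splits)

text \<open>Difference of the meshes at heights \<open>p + d\<close> and \<open>p - d\<close>. The
  sum for a larger orbit telescopes to one \<open>wt0\<close>; for \<open>d = 2\<close> or
  \<open>3\<close>, a neighbouring fixed vertex gives a difference over \<open>2 d\<close>, which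
  splits into \<open>d\<close> values of \<open>wt0\<close>. This is the shape of the products in
  \<open>A_elt\<close>.\<close>

lemma wt0_relation:
  assumes "even (p - int (dd x) - \<xi> x)"
  shows "wt0 (orb x) (p - int (dd x)) + wt0 (orb x) (p + int (dd x)) =
    (\<Sum>j | j \<in> orbits \<sigma> \<and> cartan adj j (orb x) = -1. wt0 j p) +
    (\<Sum>j | j \<in> orbits \<sigma> \<and> cartan adj j (orb x) = -2. wt0 j (p - 1) + wt0 j (p + 1)) +
    (\<Sum>j | j \<in> orbits \<sigma> \<and> cartan adj j (orb x) = -3. wt0 j (p - 2) + wt0 j p + wt0 j (p + 2))"
proof -
  let ?d = "int (dd x)" and ?c = "\<lambda>j. cartan adj j (orb x)"
  have fin: "finite (nb_orbits x)" by (simp add: nb_orbits_def)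
  have ev: "even (p + ?d - \<xi> x)" "even (p - ?d - \<xi> x)" using assms by presburger+
  have "wt0 (orb x) (p - ?d) + wt0 (orb x) (p + ?d) =
      (Phi (orb x) (p + ?d) + Phi (orb x) (p + ?d - 2 * ?d)) -
      (Phi (orb x) (p - ?d) + Phi (orb x) (p - ?d - 2 * ?d))"
    by (simp add: wt0_def)
  also have "\<dots> = (\<Sum>j\<in>nb_orbits x. mesh_term (dd x) j (p + ?d) - mesh_term (dd x) j (p - ?d))"
    unfolding mesh[OF ev(1)] mesh[OF ev(2)] by (simp add: sum_subtractf)
  also have "\<dots> = (\<Sum>j\<in>nb_orbits x. (if ?c j = -1 then wt0 j p else 0) +
      (if ?c j = -2 then wt0 j (p - 1) + wt0 j (p + 1) else 0) +
      (if ?c j = -3 then wt0 j (p - 2) + wt0 j p + wt0 j (p + 2) else 0))"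
  proof (rule sum.cong)
    fix j assume j: "j \<in> nb_orbits x"
    then obtain y where y: "adj x y" "j = orb y" unfolding nb_orbits_def by blast
    note c = cartan_nb_orbits[OF j]
    have "dd x < dd y \<and> dd x = 1 \<or> dd x = dd y \<or> dd x = 2 \<and> dd y = 1 \<or> dd x = 3 \<and> dd y = 1"
      using dd_eq_cases[of x] dd_eq_cases[of y] dd_pos[of x] dd_pos[of y] dd_le[of x] by auto
    then show "mesh_term (dd x) j (p + ?d) - mesh_term (dd x) j (p - ?d) =
      (if ?c j = -1 then wt0 j p else 0) +
      (if ?c j = -2 then wt0 j (p - 1) + wt0 j (p + 1) else 0) +
      (if ?c j = -3 then wt0 j (p - 2) + wt0 j p + wt0 j (p + 2) else 0)"
    proof (elim disjE conjE)
      assume d: "dd x < dd y" "dd x = 1"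
      define g where "g = (\<lambda>l::nat. Phi j (p - 2 * int l))"
      have "mesh_term (dd x) j (p + ?d) - mesh_term (dd x) j (p - ?d) =
          (\<Sum>l<dd y. g l) - (\<Sum>l<dd y. g (Suc l))"
        using d y by (simp add: mesh_term_def g_def algebra_simps)
      also have "\<dots> = g 0 - g (dd y)"
        unfolding sum_subtractf[symmetric] by (rule sum_lessThan_telescope')
      finally show ?thesis using c d y by (simp add: g_def wt0_def)
    next
      assume "dd x = dd y"
      then show ?thesis using c y by (simp add: mesh_term_def wt0_def)
    next
      assume "dd x = 2" "dd y = 1"
      then show ?thesis using c y by (simp add: mesh_term_def wt0_def add.commute)
    next
      assume "dd x = 3" "dd y = 1"
      then show ?thesis using c y by (simp add: mesh_term_def wt0_def add.commute)
    qed
  qed simp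
  finally show ?thesis
    unfolding sum.distrib sum.inter_filter[OF fin, symmetric] by (simp add: cartan_eq_imp_nb_orbits sum.distrib)
qed

section \<open>Conjugation by the second word\<close>

abbreviation Xp :: "('v \<times> int) set" where "Xp \<equiv> X_prime \<sigma> \<epsilon> \<xi>"
abbreviation u :: "'v weight \<Rightarrow> 'v weight" where "u \<equiv> word_elt adj \<sigma> Xp"

section \<open>The set \<open>X_prime\<close>\<close>

lemma rep_vertices_iff: "(x, p) \<in> rep_vertices \<sigma> \<epsilon> \<longleftrightarrow> 2 * int (dd x) dvd p - \<xi> x"
proof -
  have "[\<xi> x = \<epsilon> x] (mod 2 * int (dd x))"
    using compat unfolding height_compatible_def orbit_size_def by blast
  then have "[p = \<epsilon> x] (mod 2 * int (dd x)) \<longleftrightarrow> [p = \<xi> x] (mod 2 * int (dd x))"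
    by (meson cong_sym cong_trans)
  then show ?thesis by (simp add: rep_vertices_def orbit_size_def cong_iff_dvd_diff)
qed

lemma X_prime_iff:
  "(x, p) \<in> Xp \<longleftrightarrow>
    x = \<sigma> (top x) \<and> 2 * int (dd x) dvd p - \<xi> x \<and> \<xi> x < p \<and> p \<le> \<xi> (top x) - 2"
proof
  assume "(x, p) \<in> Xp"
  then obtain i where i: "i \<in> orbits \<sigma>" "x = \<sigma> (top_elt \<xi> i)" "(x, p) \<in> rep_vertices \<sigma> \<epsilon>"
    "\<xi> x < p" "p \<le> \<xi> (top_elt \<xi> i) - 2"
    unfolding X_prime_def by blast
  then obtain y where "i = orb y" unfolding orbits_def by blast
  then have "top_elt \<xi> i = top y" "top x = top y" using i(2) by (simp_all add: top_def[symmetric])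
  then show "x = \<sigma> (top x) \<and> 2 * int (dd x) dvd p - \<xi> x \<and> \<xi> x < p \<and> p \<le> \<xi> (top x) - 2"
    using i by (simp add: rep_vertices_iff)
next
  assume *: "x = \<sigma> (top x) \<and> 2 * int (dd x) dvd p - \<xi> x \<and> \<xi> x < p \<and> p \<le> \<xi> (top x) - 2"
  then have "(x, p) \<in> rep_vertices \<sigma> \<epsilon>" by (simp add: rep_vertices_iff)
  moreover have "orb x \<in> orbits \<sigma>" "top x = top_elt \<xi> (orb x)" by (simp_all add: orbits_def top_def)
  ultimately show "(x, p) \<in> Xp"
    using * unfolding X_prime_def mem_Collect_eq by metis
qed

lemma finite_X_prime: "finite Xp"
proof (rule finite_subset)
  show "Xp \<subseteq> (SIGMA x:UNIV. {\<xi> x..\<xi> (top x)})" by (auto simp: X_prime_iff)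
qed simp

text \<open>A neighbour in a smaller orbit forces
  \<open>\<xi> (\<sigma> (top x)) = \<xi> (top x) - 2\<close>, which leaves no admissible
  \<open>p\<close>. Every three-element orbit has such a neighbour, and a fixed vertex is its own
  top.\<close>

lemma X_prime_size:
  assumes "(x, p) \<in> Xp"
  shows "dd x = 2" "adj x y \<Longrightarrow> dd y = 2"
proof -
  have not_mixed: "\<not> dd z < dd x" if "adj x z" for z
  proof
    assume less: "dd z < dd x"
    note mixed = height_mixed[OF that[unfolded adj_sym[of x z]] less]
    have "1 < r" using mixed(2) less dd_pos[of z] by simp
    then have "\<xi> (\<sigma> (top x)) = \<xi> (top x) - 2" using mixed(4)[of 1] by simp
    then show False using assms by (auto simp: X_prime_iff)
  qed
  have "dd x \<noteq> 1" using assms top_fixed[of x] by (auto simp: X_prime_iff)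
  moreover have "dd x \<noteq> 3" using not_mixed orbit_three(1)[of x] by fastforce
  ultimately show two: "dd x = 2" using dd_pos[of x] dd_le[of x] by linarith
  then show "dd y = 2" if "adj x y"
    using not_mixed[OF that] dd_eq_cases[of x] dd_eq_cases[of y] by auto
qed

lemma two_orbit:
  assumes "dd x = 2" "top x \<noteq> x"
  shows "x = \<sigma> (top x)" "\<sigma> x = top x" "4 dvd \<xi> (top x) - 2 - \<xi> x"
proof -
  have "x \<in> orb (top x)" using self_in_orb by simp
  then obtain l where l: "l < dd (top x)" "x = (\<sigma> ^^ l) (top x)" using orb_memD by blast
  then show x: "x = \<sigma> (top x)" using assms by (cases l) (auto simp: less_Suc_eq)
  show "\<sigma> x = top x" using x funpow_dd[of "top x"] assms(1) by (simp add: numeral_2_eq_2)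
  have "4 dvd \<xi> x - \<xi> (top x) + 2" using height_funpow[of "top x" 1] assms(1) x by simp
  then show "4 dvd \<xi> (top x) - 2 - \<xi> x" by presburger
qed

lemma X_prime_iff_two:
  assumes "dd x = 2"
  shows "(x, p) \<in> Xp \<longleftrightarrow> top x \<noteq> x \<and> 4 dvd p - \<xi> x \<and> \<xi> x < p \<and> p \<le> \<xi> (top x) - 2"
  using two_orbit(1)[OF assms] assms unfolding X_prime_iff by (auto simp: fixed_iff)

text \<open>The admissible heights at \<open>x\<close> and \<open>y\<close> interlock:
  \<open>(y, p + 2)\<close> is in the set again unless \<open>p = \<xi> (top y)\<close>, and
  \<open>(y, p - 2)\<close> is unless \<open>p - 2 = \<xi> y\<close>.\<close>

lemma X_prime_neighbour:
  assumes xp: "(x, p) \<in> Xp" and xy: "adj x y"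
  shows "top y \<noteq> y" "p \<le> \<xi> (top y)" "\<xi> y \<le> p - 2" "4 dvd p - 2 - \<xi> y"
proof -
  have d: "dd x = 2" "dd y = 2" using X_prime_size[OF xp] xy by auto
  have x: "top x \<noteq> x" "4 dvd p - \<xi> x" "\<xi> x < p" "p \<le> \<xi> (top x) - 2"
    using xp X_prime_iff_two[OF d(1)] by auto
  have h: "\<bar>\<xi> x - \<xi> y\<bar> = 2" using height_same_size[OF xy] d by simp
  have h': "\<bar>\<xi> (top x) - \<xi> (\<sigma> y)\<bar> = 2"
    using height_same_size[of "\<sigma> x" "\<sigma> y"] folding(2)[of x y] xy d two_orbit(2)[OF d(1) x(1)] by simp
  have p: "\<xi> x \<le> p - 4" using x(2,3) by presburger
  show y: "top y \<noteq> y"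
  proof
    assume y: "top y = y"
    then have "\<xi> (\<sigma> y) \<le> \<xi> y - 2"
      using height_lt_top[of "\<sigma> y"] d fixed_iff[of y] by auto
    then show False using h h' p x(4) by linarith
  qed
  have "\<sigma> y = top y" using two_orbit(2)[OF d(2) y] .
  then show "p \<le> \<xi> (top y)" using h' x(4) by simp
  show "\<xi> y \<le> p - 2" using h p by linarith
  have "\<xi> x - \<xi> y = 2 \<or> \<xi> x - \<xi> y = -2" using h by linarith
  then show "4 dvd p - 2 - \<xi> y" using x(2) by presburger
qed

section \<open>Initial segments of readings and the heights they produce\<close>

lemma rep_arrow_two:
  "adj x y \<Longrightarrow> dd x = 2 \<Longrightarrow> dd y = 2 \<Longrightarrow> rep_arrow adj \<sigma> (x, p) (y, p + 2)"
  by (simp add: rep_arrow_def orbit_size_def)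

text \<open>The property of initial segments of compatible readings, where the target of an arrow
  precedes its source.\<close>

definition up_closed :: "('v \<times> int) set \<Rightarrow> bool" where
  "up_closed P \<longleftrightarrow> P \<subseteq> Xp \<and> (\<forall>a\<in>P. \<forall>b\<in>Xp. rep_arrow adj \<sigma> a b \<longrightarrow> b \<in> P)"

text \<open>Follow the arrows from \<open>(x, q)\<close> to \<open>(y, q + 2)\<close> to
  \<open>(x, q + 4)\<close> for a neighbour \<open>y\<close>, which exists by connectedness; the
  middle vertex is in the set by interlocking.\<close>

lemma up_closed_step:
  assumes P: "up_closed P" and q: "(x, q) \<in> P" and q4: "(x, q + 4) \<in> Xp"
  shows "(x, q + 4) \<in> P"
proof -
  have xq: "(x, q) \<in> Xp" using P q by (auto simp: up_closed_def)
  have d: "dd x = 2" using X_prime_size[OF xq] by simp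
  then obtain y where xy: "adj x y" using moved_has_neighbour[of x] by auto
  have dy: "dd y = 2" using X_prime_size[OF xq] xy by blast
  have "(y, q + 2) \<in> Xp"
    using X_prime_neighbour[OF xq xy] X_prime_neighbour[OF q4 xy]
    unfolding X_prime_iff_two[OF dy] by presburger
  then have "(y, q + 2) \<in> P"
    using P q rep_arrow_two[OF xy d dy, of q] unfolding up_closed_def by blast
  moreover have "rep_arrow adj \<sigma> (y, q + 2) (x, q + 4)"
    using rep_arrow_two[OF xy[unfolded adj_sym[of x y]] dy d, of "q + 2"] by (simp add: add.assoc)
  ultimately show ?thesis using P q4 unfolding up_closed_def by blast
qed

lemma up_closed_chain:
  assumes P: "up_closed P" and q: "(x, q) \<in> P" and q': "(x, q') \<in> Xp" "q \<le> q'"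
  shows "(x, q') \<in> P"
proof -
  have xq: "(x, q) \<in> Xp" using P q by (auto simp: up_closed_def)
  have d: "dd x = 2" using X_prime_size[OF xq] by simp
  note iff = X_prime_iff_two[OF d]
  have "4 dvd q - \<xi> x" "4 dvd q' - \<xi> x" using xq q'(1) iff by blast+
  then have "4 dvd q' - q" by presburger
  then obtain n where n: "q' = q + 4 * int n" using q'(2)
    by (metis add_diff_cancel_left' diff_ge_0_iff_ge dvdE nonneg_int_cases zero_le_mult_iff
        add.commute diff_add_cancel not_numeral_le_zero)
  have "m \<le> n \<Longrightarrow> (x, q + 4 * int m) \<in> P" for m
  proof (induction m)
    case (Suc m)
    have "(x, q + 4 * int m + 4) \<in> Xp"
    proof -
      have "4 dvd q - \<xi> x" using xq iff by blast
      then have "4 dvd q + 4 * int m + 4 - \<xi> x" by presburger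
      then show ?thesis using xq q'(1) Suc.prems unfolding iff n by auto
    qed
    then show ?case using up_closed_step[OF P Suc.IH] Suc.prems by (simp add: algebra_simps)
  qed (use q in simp)
  then show ?thesis using n by simp
qed

text \<open>The height function obtained from \<open>\<xi>\<close>, with \<open>\<xi> (\<sigma> (top x))\<close> raised to
  \<open>\<xi> (top x) - 2\<close>, after reflecting at all elements of \<open>P\<close>.\<close>

definition reflected_height :: "('v \<times> int) set \<Rightarrow> 'v \<Rightarrow> int" where
  "reflected_height P x = (if top x = x then \<xi> x
     else Min (insert (\<xi> (top x) - 2) ((\<lambda>q. q - 4) ` {q. (x, q) \<in> P})))"

lemma finite_fibre: "P \<subseteq> Xp \<Longrightarrow> finite {q. (x, q) \<in> P}"
  using finite_X_prime finite_subset[of P Xp]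
  by (intro finite_subset[of "{q. (x, q) \<in> P}" "snd ` P"]) force+

lemma reflected_heightI:
  assumes "P \<subseteq> Xp" "top x \<noteq> x" "h \<le> \<xi> (top x) - 2" "\<And>q. (x, q) \<in> P \<Longrightarrow> h + 4 \<le> q"
    "h = \<xi> (top x) - 2 \<or> (x, h + 4) \<in> P"
  shows "reflected_height P x = h"
  unfolding reflected_height_def if_not_P[OF assms(2)]
proof (rule Min_eqI)
  show "finite (insert (\<xi> (top x) - 2) ((\<lambda>q. q - 4) ` {q. (x, q) \<in> P}))"
    using finite_fibre[OF assms(1)] by simp
  show "h \<le> y" if "y \<in> insert (\<xi> (top x) - 2) ((\<lambda>q. q - 4) ` {q. (x, q) \<in> P})" for y
    using that assms(3) assms(4) by fastforce
  show "h \<in> insert (\<xi> (top x) - 2) ((\<lambda>q. q - 4) ` {q. (x, q) \<in> P})"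
    using assms(5) by (auto intro!: image_eqI[of _ _ "h + 4"])
qed

context
  fixes P x p
  assumes P: "up_closed P" and P': "up_closed (insert (x, p) P)" and notin: "(x, p) \<notin> P"
begin

text \<open>\<open>P\<close> contains the next admissible height \<open>p + 4\<close>, if there is
  one, and nothing at or below \<open>p\<close> on \<open>x\<close>, since that would pull in
  \<open>(x, p)\<close>. So \<open>x\<close> stands at height \<open>p\<close> when
  \<open>(x, p)\<close> is read.\<close>

lemma reflected_height_self: "reflected_height P x = p"
proof -
  have xp: "(x, p) \<in> Xp" and sub: "P \<subseteq> Xp" using P' by (auto simp: up_closed_def)
  have d: "dd x = 2" using X_prime_size[OF xp] by simp
  note iff = X_prime_iff_two[OF d]
  have x: "top x \<noteq> x" "4 dvd p - \<xi> x" "\<xi> x < p" "p \<le> \<xi> (top x) - 2" using xp iff by auto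
  show ?thesis
  proof (rule reflected_heightI[OF sub x(1,4)])
    fix q assume q: "(x, q) \<in> P"
    then have "\<not> q \<le> p" using up_closed_chain[OF P q xp] notin by blast
    moreover have "4 dvd q - \<xi> x" using q sub iff by auto
    ultimately show "p + 4 \<le> q" using x(2) by presburger
  next
    show "p = \<xi> (top x) - 2 \<or> (x, p + 4) \<in> P"
    proof (cases "p = \<xi> (top x) - 2")
      case False
      then have "4 dvd p + 4 - \<xi> x \<and> \<xi> x < p + 4 \<and> p + 4 \<le> \<xi> (top x) - 2"
        using x(2-4) two_orbit(3)[OF d x(1)] by presburger
      then have "(x, p + 4) \<in> Xp" unfolding iff using x(1) by blast
      then have "(x, p + 4) \<in> insert (x, p) P" using up_closed_step[OF P'] by blast
      then show ?thesis by simp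
    qed simp
  qed
qed

text \<open>Together with \<open>x\<close> standing at height \<open>p\<close>, this is the
  configuration of the mesh relation at \<open>p\<close> for orbits of size two.\<close>

lemma reflected_height_neighbour:
  assumes xy: "adj x y"
  shows "reflected_height P y = p - 2"
proof -
  have xp: "(x, p) \<in> Xp" and sub: "P \<subseteq> Xp" using P' by (auto simp: up_closed_def)
  have d: "dd x = 2" "dd y = 2" using X_prime_size[OF xp] xy by auto
  note iff = X_prime_iff_two[OF d(2)]
  note y = X_prime_neighbour[OF xp xy]
  have yx: "adj y x" using xy adj_sym by simp
  show ?thesis
  proof (rule reflected_heightI[OF sub y(1)])
    show "p - 2 \<le> \<xi> (top y) - 2" using y(2) by simp
  next
    fix q assume q: "(y, q) \<in> P"
    then have q': "4 dvd q - \<xi> y" "\<xi> y < q" using sub iff by auto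
    have "\<not> q \<le> p - 2"
    proof
      assume le: "q \<le> p - 2"
      then have "(y, p - 2) \<in> Xp" unfolding iff using y q'(2) by auto
      then have "(y, p - 2) \<in> P" using up_closed_chain[OF P q _ le] by blast
      moreover have "rep_arrow adj \<sigma> (y, p - 2) (x, p)"
        using rep_arrow_two[OF yx d(2,1), of "p - 2"] by simp
      ultimately show False using P xp notin unfolding up_closed_def by blast
    qed
    then show "p - 2 + 4 \<le> q" using q'(1) y(4) by presburger
  next
    show "p - 2 = \<xi> (top y) - 2 \<or> (y, p - 2 + 4) \<in> P"
    proof (cases "p = \<xi> (top y)")
      case False
      then have "4 dvd p + 2 - \<xi> y \<and> \<xi> y < p + 2 \<and> p + 2 \<le> \<xi> (top y) - 2"
        using y(2-4) two_orbit(3)[OF d(2) y(1)] by presburger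
      then have "(y, p + 2) \<in> Xp" unfolding iff using y(1) by blast
      moreover have "rep_arrow adj \<sigma> (x, p) (y, p + 2)" by (rule rep_arrow_two[OF xy d])
      ultimately have "(y, p + 2) \<in> insert (x, p) P" using P' unfolding up_closed_def by blast
      then show ?thesis by (simp add: add.commute)
    qed simp
  qed
qed

lemma reflected_height_insert:
  "reflected_height (insert (x, p) P) y = (if y = x then p - 4 else reflected_height P y)"
proof (cases "y = x")
  case True
  have xp: "(x, p) \<in> Xp" and sub: "P \<subseteq> Xp" using P' by (auto simp: up_closed_def)
  have d: "dd x = 2" using X_prime_size[OF xp] by simp
  have x: "top x \<noteq> x" using xp X_prime_iff_two[OF d] by auto
  have "{q. (x, q) \<in> insert (x, p) P} = insert p {q. (x, q) \<in> P}" by auto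
  then have "reflected_height (insert (x, p) P) x = min (p - 4) (reflected_height P x)"
    using x finite_fibre[OF sub, of x] by (simp add: reflected_height_def insert_commute Min_insert)
  then show ?thesis using reflected_height_self True by simp
next
  case False
  then show ?thesis by (simp add: reflected_height_def)
qed

end

lemma reflected_height_empty_top:
  assumes "dd x \<noteq> 3"
  shows "frag_of x = Phi (orb x) (reflected_height {} x)"
proof (cases "top x = x")
  case True
  then show ?thesis using Phi_top[of 0 x] dd_pos[of x] by (simp add: reflected_height_def)
next
  case False
  then have d: "dd x = 2" using assms top_fixed[of x] dd_pos[of x] dd_le[of x] by fastforce
  have "reflected_height {} x = \<xi> (top x) - 2 * int 1" using False by (simp add: reflected_height_def)
  then show ?thesis using Phi_top[of 1 x] d two_orbit(1)[OF d False] by simp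
qed

text \<open>The lowest admissible height, if any, is \<open>\<xi> x + 4\<close>, and reflecting
  there ends at \<open>\<xi> x\<close>.\<close>

lemma reflected_height_full:
  assumes "dd x \<noteq> 3"
  shows "reflected_height Xp x = \<xi> x"
proof (cases "top x = x")
  case True
  then show ?thesis by (simp add: reflected_height_def)
next
  case False
  then have d: "dd x = 2" using assms top_fixed[of x] dd_pos[of x] dd_le[of x] by fastforce
  note iff = X_prime_iff_two[OF d] and four = two_orbit(3)[OF d False]
  show ?thesis
  proof (rule reflected_heightI[OF _ False])
    show le: "\<xi> x \<le> \<xi> (top x) - 2" using height_lt_top[of x] False by simp
    show "\<xi> x + 4 \<le> q" if "(x, q) \<in> Xp" for q
    proof -
      have "4 dvd q - \<xi> x" "\<xi> x < q" using that iff by blast+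
      then show ?thesis by presburger
    qed
    show "\<xi> x = \<xi> (top x) - 2 \<or> (x, \<xi> x + 4) \<in> Xp"
    proof (cases "\<xi> x = \<xi> (top x) - 2")
      case False
      then have "\<xi> x + 4 \<le> \<xi> (top x) - 2" using le four by presburger
      then show ?thesis unfolding iff using \<open>top x \<noteq> x\<close> by simp
    qed simp
  qed simp
qed

lemma reading_prefix_up_closed:
  assumes "compatible_reading adj \<sigma> Xp (ys @ zs)"
  shows "up_closed (set ys)"
  unfolding up_closed_def
proof (intro conjI ballI impI)
  show "set ys \<subseteq> Xp" using assms by (auto simp: compatible_reading_def)
  fix a b assume a: "a \<in> set ys" and b: "b \<in> Xp" and ab: "rep_arrow adj \<sigma> a b"
  let ?xs = "ys @ zs"
  obtain k where k: "k < length ys" "ys ! k = a" using a by (auto simp: in_set_conv_nth)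
  have "b \<in> set ?xs" using b assms by (simp add: compatible_reading_def)
  then obtain m where m: "m < length ?xs" "?xs ! m = b" by (meson in_set_conv_nth)
  have "?xs ! k = a" "k < length ?xs" using k by (simp_all add: nth_append)
  then have "m < k" using assms ab m unfolding compatible_reading_def by metis
  then have "ys ! m = b" "m < length ys" using k m by (auto simp: nth_append)
  then show "b \<in> set ys" by auto
qed

text \<open>Reading \<open>(x, p)\<close> replaces the weight at height \<open>p\<close> by the one
  at \<open>p - 4\<close>: the identity for an appended letter and the mesh relation have the same
  right-hand side. Three-element orbits are excluded because \<open>reflected_height\<close> puts
  both of their lower vertices at the same height.\<close>

lemma prefix_weight:
  assumes "compatible_reading adj \<sigma> Xp (ys @ zs)" "dd y \<noteq> 3"
  shows "refl_word adj (map fst ys) (frag_of y) = Phi (orb y) (reflected_height (set ys) y)"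
  using assms
proof (induction ys arbitrary: zs y rule: rev_induct)
  case Nil
  then show ?case using reflected_height_empty_top by simp
next
  case (snoc a ys)
  obtain x p where a: "a = (x, p)" by (cases a)
  have read: "compatible_reading adj \<sigma> Xp (ys @ a # zs)" using snoc.prems(1) by simp
  have P: "up_closed (set ys)" by (rule reading_prefix_up_closed[OF read])
  have P': "up_closed (insert (x, p) (set ys))"
    using reading_prefix_up_closed[OF snoc.prems(1)] by (simp add: a)
  have notin: "(x, p) \<notin> set ys" using read by (auto simp: compatible_reading_def a)
  note IH = snoc.IH[OF read]
  have xp: "(x, p) \<in> Xp" using P' by (auto simp: up_closed_def)
  have d: "dd x = 2" "\<And>z. adj x z \<Longrightarrow> dd z = 2" using X_prime_size[OF xp] by auto
  have set: "set (ys @ [a]) = insert (x, p) (set ys)" by (simp add: a)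
  show ?case
  proof (cases "y = x")
    case False
    then show ?thesis
      using IH[OF snoc.prems(2)] reflected_height_insert[OF P P' notin, of y] set
      by (simp add: a refl_word_snoc_frag_of_other)
  next
    case True
    have self: "refl_word adj (map fst ys) (frag_of x) = Phi (orb x) p"
      using IH[of x] d reflected_height_self[OF P P' notin] by simp
    have nb: "refl_word adj (map fst ys) (frag_of z) = mesh_term (dd x) (orb z) p" if "adj x z" for z
      using IH[of z] d that reflected_height_neighbour[OF P P' notin that] by (simp add: mesh_term_def)
    \<comment> \<open>Each neighbouring orbit contains one neighbour of \<open>x\<close>, so the sum
      over neighbours is the sum over orbits in \<open>mesh\<close>.\<close>
    have "inj_on orb {z. adj x z}"
    proof (rule inj_onI)
      fix y z assume "y \<in> {z. adj x z}" "z \<in> {z. adj x z}" "orb y = orb z"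
      then show "y = z"
        using neighbour_unique[of x z y] d by (simp add: orb_eq_iff)
    qed
    then have "(\<Sum>z | adj x z. refl_word adj (map fst ys) (frag_of z)) =
        (\<Sum>j\<in>nb_orbits x. mesh_term (dd x) j p)"
      unfolding nb_orbits_def using nb by (simp add: sum.reindex)
    moreover have "4 dvd p - \<xi> x" using xp X_prime_iff_two[OF d(1)] by blast
    then have "even (p - \<xi> x)" by presburger
    ultimately have "refl_word adj (map fst ys @ [x]) (frag_of x) + Phi (orb x) p =
        Phi (orb x) p + Phi (orb x) (p - 4)"
      using refl_word_snoc_frag_of[of adj "map fst ys" x] mesh[of p x] self d by simp
    then have "refl_word adj (map fst (ys @ [a])) (frag_of x) = Phi (orb x) (p - 4)"
      by (simp add: a)
    moreover have "reflected_height (set (ys @ [a])) x = p - 4"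
      using reflected_height_insert[OF P P' notin, of x] set by simp
    ultimately show ?thesis using True by simp
  qed
qed

lemma u_reading:
  obtains xs where "compatible_reading adj \<sigma> Xp xs" "u = refl_word adj (map fst xs)"
  using word_elt_eq_refl_word[OF compatible_reading_exists[OF finite_X_prime]] .

lemma additive_u: "additive u"
  by (rule u_reading) (simp add: additive_refl_word)

lemma bij_u: "bij u"
  by (rule u_reading) (simp add: bij_refl_word irrefl)

lemma u_frag_of: "u (frag_of x) = Phi (orb x) (\<xi> x)"
proof -
  obtain xs where xs: "compatible_reading adj \<sigma> Xp xs" "u = refl_word adj (map fst xs)"
    by (rule u_reading, rule that)
  have set: "set xs = Xp" using xs(1) by (simp add: compatible_reading_def)
  show ?thesis
  proof (cases "dd x = 3")
    case False
    then show ?thesis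
      using prefix_weight[where ys = xs and zs = "[]" and y = x] xs reflected_height_full[OF False] set by simp
  next
    \<comment> \<open>No letter of \<open>u\<close> lies in a three-element orbit. There a fixed
      neighbour makes the heights fall by exactly 2, so \<open>Phi\<close> already agrees with the
      fundamental weights.\<close>
    case True
    then have "x \<notin> set (map fst xs)" using X_prime_size(1)[of x] set by auto
    then have "u (frag_of x) = frag_of x" using xs(2) by (simp add: refl_word_frag_of_notin)
    moreover obtain z where z: "dd z = 1" "adj z x" using orbit_three(1)[OF True] adj_sym by blast
    have "x \<in> orb (top x)" using self_in_orb by simp
    then obtain l where l: "l < dd x" "x = (\<sigma> ^^ l) (top x)" using orb_memD[of x "top x"] by auto
    then have "\<xi> x = \<xi> (top x) - 2 * int l"
      using height_mixed(2)[OF z(2)] height_mixed(4)[OF z(2), of l] z(1) True by simp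
    ultimately show ?thesis using Phi_top[of l x] l by simp
  qed
qed

section \<open>The weight homomorphism\<close>

abbreviation tq :: "'v weight \<Rightarrow> 'v weight" where "tq \<equiv> tau adj \<sigma> \<epsilon> \<xi>"

lemma tq_eq: "tq = inv_into UNIV u \<circ> t \<circ> u"
  by (simp add: tau_def)

lemma additive_inv_u: "additive (inv_into UNIV u)"
  by (rule additive_inv[OF additive_u bij_u])

lemma inv_u_u [simp]: "inv_into UNIV u (u v) = v" "u (inv_into UNIV u v) = v"
  using bij_u by (simp_all add: bij_is_inj bij_is_surj surj_f_inv_f)

lemma additive_tq: "additive tq"
  unfolding tq_eq by (rule additive_comp[OF additive_comp[OF additive_inv_u additive_t] additive_u])

lemma bij_tq: "bij tq"
  unfolding tq_eq by (rule bij_comp[OF bij_u bij_comp[OF bij_t bij_inv[OF bij_u]]])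

section \<open>Signed values of \<open>phi\<close>\<close>

definition signed :: "'v weight \<times> int \<Rightarrow> 'v weight" where
  "signed = (\<lambda>(\<beta>, k). if even k then \<beta> else - \<beta>)"

lemma additive_inv_tq_funpow: "additive (inv_into UNIV tq ^^ n)"
  by (rule additive_funpow[OF additive_inv[OF additive_tq bij_tq]])

lemma signed_phi_up: "signed ((phi_up adj \<sigma> \<epsilon> \<xi> x ^^ n) y) = (inv_into UNIV tq ^^ (dd x * n)) (signed y)"
proof (induction n)
  case (Suc n)
  have "signed (phi_up adj \<sigma> \<epsilon> \<xi> x z) = (inv_into UNIV tq ^^ dd x) (signed z)" for z
    by (cases z) (simp add: phi_up_def signed_def Let_def additive.minus[OF additive_inv_tq_funpow])
  then show ?case using Suc by (simp add: funpow_add)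
qed simp

lemma signed_phi_down: "signed ((phi_down adj \<sigma> \<epsilon> \<xi> x ^^ n) y) = (tq ^^ (dd x * n)) (signed y)"
proof (induction n)
  case (Suc n)
  have "signed (phi_down adj \<sigma> \<epsilon> \<xi> x z) = (tq ^^ dd x) (signed z)" for z
    by (cases z) (simp add: phi_down_def signed_def Let_def additive.minus[OF additive_funpow[OF additive_tq]])
  then show ?case using Suc by (simp add: funpow_add)
qed simp

lemma signed_phi:
  assumes "(x, p) \<in> rep_vertices \<sigma> \<epsilon>"
  shows "signed (phi adj \<sigma> \<epsilon> \<xi> (x, p)) = inv_into UNIV u (wt0 (orb x) p)"
proof -
  have "2 * int (dd x) dvd p - \<xi> x" using assms by (simp add: rep_vertices_iff)
  then obtain m where "p - \<xi> x = 2 * int (dd x) * m" by (rule dvdE)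
  \<comment> \<open>Moving up in height means negative powers; the double minus brings the exponent
    into the form of \<open>Phi_shift\<close>.\<close>
  then have m: "p = \<xi> x - 2 * (int (dd x) * - m)" by simp
  have d: "int (dd x) > 0" using dd_pos[of x] by simp
  have "signed (phi adj \<sigma> \<epsilon> \<xi> (x, p)) = int_power tq (int (dd x) * - m) (gamma adj \<sigma> \<epsilon> \<xi> x)"
  proof (cases "0 \<le> m")
    case True
    have "signed (phi adj \<sigma> \<epsilon> \<xi> (x, p)) =
        (inv_into UNIV tq ^^ (dd x * nat m)) (gamma adj \<sigma> \<epsilon> \<xi> x)"
      using True d by (simp add: phi_def m orbit_size_def signed_phi_up) (simp add: signed_def)
    moreover have "int (dd x) * - m = - int (dd x * nat m)" using True by simp
    ultimately show ?thesis by (simp only: int_power_minus_of_nat)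
  next
    case False
    then have "int (dd x) * m < 0" using d by (simp add: mult_pos_neg)
    then have "\<not> \<xi> x \<le> p" unfolding m mult_minus_right by linarith
    moreover have "\<xi> x - p = 2 * int (dd x) * - m"
      unfolding m by (simp only: diff_diff_eq2 add_diff_cancel_left' mult.assoc)
    then have "(\<xi> x - p) div (2 * int (dd x)) = - m"
      using nonzero_mult_div_cancel_left[of "2 * int (dd x)" "- m"] d by (simp only:)
    ultimately have "signed (phi adj \<sigma> \<epsilon> \<xi> (x, p)) = (tq ^^ (dd x * nat (- m))) (gamma adj \<sigma> \<epsilon> \<xi> x)"
      by (simp add: phi_def orbit_size_def signed_phi_down) (simp add: signed_def)
    moreover have "int (dd x) * - m = int (dd x * nat (- m))" using False by simp
    ultimately show ?thesis by (simp only: int_power_of_nat)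
  qed
  also have "\<dots> = inv_into UNIV u (int_power t (int (dd x) * - m) (u (gamma adj \<sigma> \<epsilon> \<xi> x)))"
    unfolding tq_eq by (rule int_power_conjugate[OF bij_u bij_t])
  also have "u (gamma adj \<sigma> \<epsilon> \<xi> x) = wt0 (orb x) (\<xi> x)"
  proof -
    have "(tq ^^ dd x) (frag_of x) = inv_into UNIV u (int_power t (int (dd x)) (u (frag_of x)))"
      using int_power_conjugate[OF bij_u bij_t, of "int (dd x)" "frag_of x"]
      unfolding tq_eq[symmetric] by (simp add: int_power_of_nat)
    then show ?thesis
      by (simp add: gamma_def additive.diff[OF additive_u] u_frag_of wt0_def Phi_shift)
  qed
  also have "int_power t (int (dd x) * - m) (wt0 (orb x) (\<xi> x)) = wt0 (orb x) p"
  proof -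
    have "p - 2 * int (dd x) = \<xi> x - 2 * int (dd x) - 2 * (int (dd x) * - m)" using m by simp
    then show ?thesis
      unfolding wt0_def additive.diff[OF additive_int_power[OF additive_t bij_t]]
      using Phi_shift[of "orb x"] m by metis
  qed
  finally show ?thesis .
qed

text \<open>Heights on an orbit share their parity, so any representative decides
  membership.\<close>

lemma I_hat_iff: "(orb x, p) \<in> I_hat \<sigma> \<epsilon> \<longleftrightarrow> even (p - \<xi> x)"
proof -
  have eps: "[\<epsilon> x = \<epsilon> y] (mod 2)" if "y \<in> orb x" for y
    using parity orb_eqI[OF that] unfolding parity_function_def by metis
  have "orbit_parity \<epsilon> (orb x) = \<epsilon> x mod 2"
    unfolding orbit_parity_def
  proof (rule the_equality)
    show "\<epsilon> x mod 2 \<in> {0, 1} \<and> (\<forall>y\<in>orb x. [\<epsilon> x mod 2 = \<epsilon> y] (mod 2))"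
      using eps by (auto simp: cong_def)
    fix e :: int assume "e \<in> {0, 1} \<and> (\<forall>y\<in>orb x. [e = \<epsilon> y] (mod 2))"
    then have "e \<in> {0, 1}" "[e = \<epsilon> x] (mod 2)" using self_in_orb by blast+
    then show "e = \<epsilon> x mod 2" by (auto simp: cong_def)
  qed
  moreover have "[\<xi> x = \<epsilon> x] (mod 2)"
    using compat unfolding height_compatible_def orbit_size_def
    by (meson cong_dvd_modulus dvd_triv_left)
  then have "even (\<xi> x - \<epsilon> x)" by (simp add: cong_iff_dvd_diff)
  ultimately show ?thesis
    by (simp add: I_hat_def orbits_def cong_iff_dvd_diff)
qed

lemma I_hatE:
  assumes "(j, p) \<in> I_hat \<sigma> \<epsilon>"
  obtains x where "j = orb x" "even (p - \<xi> x)"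
proof -
  have "j \<in> range orb" using assms by (simp add: I_hat_def orbits_def)
  then obtain x where "j = orb x" by (rule rangeE)
  then show ?thesis using that[of x] assms I_hat_iff by simp
qed

text \<open>The heights on an orbit are \<open>\<xi> x - 2 l\<close> modulo \<open>2 d\<close>, so
  they meet every residue of the right parity; \<open>l\<close> is chosen to make
  \<open>c + l\<close> divisible by \<open>d\<close>.\<close>

lemma rep_vertex_exists:
  assumes "(j, p) \<in> I_hat \<sigma> \<epsilon>"
  obtains y where "orb y = j" "(y, p) \<in> rep_vertices \<sigma> \<epsilon>"
proof -
  obtain x where x: "j = orb x" "even (p - \<xi> x)" using assms by (rule I_hatE)
  then obtain c where c: "p - \<xi> x = 2 * c" by blast
  define l where "l = nat ((- c) mod int (dd x))"
  have l: "int l = (- c) mod int (dd x)" using dd_pos[of x] by (simp add: l_def)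
  have "int (dd x) dvd - ((- c) - (- c) mod int (dd x))"
    unfolding dvd_minus_iff by (rule dvd_minus_mod)
  then have "int (dd x) dvd c + int l" unfolding l by (simp add: add.commute)
  then have "2 * int (dd x) dvd 2 * (c + int l)" by (rule mult_dvd_mono[OF dvd_refl])
  then have "2 * int (dd x) dvd 2 * (c + int l) - (\<xi> ((\<sigma> ^^ l) x) - \<xi> x + 2 * int l)"
    using height_funpow[of x l] by (rule dvd_diff)
  also have "2 * (c + int l) - (\<xi> ((\<sigma> ^^ l) x) - \<xi> x + 2 * int l) = p - \<xi> ((\<sigma> ^^ l) x)"
    using c by simp
  finally have "((\<sigma> ^^ l) x, p) \<in> rep_vertices \<sigma> \<epsilon>" by (simp add: rep_vertices_iff)
  then show ?thesis using that[of "(\<sigma> ^^ l) x"] x(1) by simp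
qed

abbreviation M :: "('v set \<times> int \<Rightarrow>\<^sub>0 int) monoid" where "M \<equiv> group_M \<sigma> \<epsilon>"
abbreviation wt :: "('v set \<times> int \<Rightarrow>\<^sub>0 int) \<Rightarrow> 'v weight" where "wt \<equiv> wt_Q adj \<sigma> \<epsilon> \<xi>"
abbreviation wt0_ext :: "('v set \<times> int \<Rightarrow>\<^sub>0 int) \<Rightarrow> 'v weight" where
  "wt0_ext \<equiv> frag_extend (\<lambda>(j, p). wt0 j p)"

lemma carrier_M: "m \<in> carrier M \<longleftrightarrow> Poly_Mapping.keys m \<subseteq> I_hat \<sigma> \<epsilon>"
  by (simp add: group_M_def carrier_free_Abelian_group_iff)

lemma add_closed_keys: "add_closed {m :: 'b \<Rightarrow>\<^sub>0 int. Poly_Mapping.keys m \<subseteq> S}"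
  unfolding add_closed_def using keys_diff[of "_ :: 'b \<Rightarrow>\<^sub>0 int"] by fastforce

lemma additive_wt: "additive wt"
  unfolding wt_Q_def by (rule additive_frag_extend)

text \<open>Whichever preimage \<open>inv_into\<close> selects, the value in
  \<open>signed_phi\<close> depends only on its orbit and height.\<close>

lemma wt_frag_of:
  assumes "(j, p) \<in> I_hat \<sigma> \<epsilon>"
  shows "wt (frag_of (j, p)) = inv_into UNIV u (wt0 j p)"
proof -
  obtain y where y: "orb y = j" "(y, p) \<in> rep_vertices \<sigma> \<epsilon>" using assms by (rule rep_vertex_exists)
  define z where "z = inv_into (rep_vertices \<sigma> \<epsilon>) (fold_map \<sigma>) (j, p)"
  have "(j, p) \<in> fold_map \<sigma> ` rep_vertices \<sigma> \<epsilon>"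
    using y by (auto simp: fold_map_def intro!: image_eqI[of _ _ "(y, p)"])
  then have z: "z \<in> rep_vertices \<sigma> \<epsilon>" "fold_map \<sigma> z = (j, p)"
    unfolding z_def by (rule inv_into_into, rule f_inv_into_f)
  obtain x q where xq: "z = (x, q)" by (cases z)
  then have q: "q = p" "orb x = j" using z(2) by (simp_all add: fold_map_def)
  have "wt (frag_of (j, p)) = signed (phi_bar adj \<sigma> \<epsilon> \<xi> (j, p))"
    by (simp add: wt_Q_def signed_def Let_def case_prod_unfold)
  also have "\<dots> = signed (phi adj \<sigma> \<epsilon> \<xi> (x, p))"
    using xq q by (simp add: phi_bar_def flip: z_def)
  also have "\<dots> = inv_into UNIV u (wt0 j p)"
    using signed_phi[of x p] z(1) xq q by simp
  finally show ?thesis .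
qed

lemma wt_eq:
  assumes "m \<in> carrier M"
  shows "wt m = inv_into UNIV u (wt0_ext m)"
  using assms unfolding carrier_M
proof (induction m rule: frag_induction)
  case (one x)
  then show ?case by (cases x) (simp add: wt_frag_of)
qed (simp_all add: additive.zero[OF additive_wt] additive.zero[OF additive_inv_u]
    additive.diff[OF additive_wt] additive.diff[OF additive_inv_u] frag_extend_diff)

subsection \<open>The image\<close>

abbreviation L :: "'v weight set" where "L \<equiv> carrier (root_lattice adj)"

lemma int_power_mem_iff:
  assumes "bij f" "\<And>v. f v \<in> N \<longleftrightarrow> v \<in> N"
  shows "int_power f k v \<in> N \<longleftrightarrow> v \<in> N"
proof (induction k rule: int_induct[of _ 0])
  case (step1 k)
  then show ?case using assms by (simp add: int_power_succ)
next
  case (step2 k)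
  have "f (int_power f (k - 1) v) = int_power f k v"
    using int_power_succ[OF assms(1), of "k - 1" v] by simp
  then show ?case using step2 assms(2) by metis
qed simp

lemma aut_weight_root_lattice: "aut_weight \<sigma> v \<in> L \<longleftrightarrow> v \<in> L"
proof -
  have mono: "aut_weight \<rho> v \<in> L" if "bij \<rho>" "\<And>x y. adj (\<rho> x) (\<rho> y) \<longleftrightarrow> adj x y" "v \<in> L" for \<rho> v
  proof -
    have "L \<subseteq> aut_weight \<rho> -` L"
      by (rule root_lattice_subset)
        (simp_all add: add_closed_vimage additive_aut_weight add_closed_root_lattice
          aut_weight_simple_root that simple_root_in_root_lattice)
    then show ?thesis using that by blast
  qed
  let ?\<rho> = "inv_into UNIV \<sigma>"
  have inv: "\<sigma> (?\<rho> x) = x" "?\<rho> (\<sigma> x) = x" for x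
    using folding(1) by (simp_all add: bij_is_inj bij_is_surj surj_f_inv_f)
  have "adj (?\<rho> x) (?\<rho> y) \<longleftrightarrow> adj x y" for x y
    using folding(2)[of "?\<rho> x" "?\<rho> y"] by (simp add: inv)
  then have "aut_weight \<sigma> v \<in> L \<Longrightarrow> aut_weight ?\<rho> (aut_weight \<sigma> v) \<in> L"
    by (rule mono[OF bij_inv[OF folding(1)]])
  moreover have "(aut_weight ?\<rho> \<circ> aut_weight \<sigma>) v = id v"
    by (rule additive_frag_eqI[OF additive_comp[OF additive_aut_weight additive_aut_weight] additive_id])
      (simp add: inv)
  moreover have "v \<in> L \<Longrightarrow> aut_weight \<sigma> v \<in> L" by (rule mono) (rule folding)+
  ultimately show ?thesis by auto
qed

lemma refl_word_root_lattice: "refl_word adj vs v \<in> L \<longleftrightarrow> v \<in> L"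
  by (rule refl_word_mem_iff[OF add_closed_root_lattice simple_root_in_root_lattice])

lemma w_root_lattice: "w v \<in> L \<longleftrightarrow> v \<in> L"
  by (rule circ_reading) (simp add: refl_word_root_lattice)

lemma u_root_lattice: "u v \<in> L \<longleftrightarrow> v \<in> L"
  by (rule u_reading) (simp add: refl_word_root_lattice)

lemma t_root_lattice: "t v \<in> L \<longleftrightarrow> v \<in> L"
  by (simp add: t_eq w_root_lattice aut_weight_root_lattice)

lemma wt0_orb: "wt0 (orb x) (\<xi> (top x) - 2 * k) = int_power t k (frag_of (top x) - w (frag_of (top x)))"
proof -
  have "Phi (orb x) (\<xi> (top x) - 2 * k - 2 * int (dd x)) = int_power t k (w (frag_of (top x)))"
    using Phi_shift[of "orb x" "\<xi> (top x) - 2 * int (dd x)" k] Phi_top_dd[of x]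
    by (simp add: algebra_simps)
  then show ?thesis
    by (simp add: wt0_def Phi_orb additive.diff[OF additive_int_power[OF additive_t bij_t]])
qed

lemma I_hat_orb: "(j, p) \<in> I_hat \<sigma> \<epsilon> \<Longrightarrow> \<exists>x k. j = orb x \<and> p = \<xi> (top x) - 2 * k"
proof -
  assume "(j, p) \<in> I_hat \<sigma> \<epsilon>"
  then obtain x where x: "j = orb x" "even (p - \<xi> x)" by (rule I_hatE)
  then have "even (\<xi> (top x) - p)" using height_parity[OF top_in_orb, of x] by presburger
  then obtain k where "\<xi> (top x) - p = 2 * k" by blast
  then show ?thesis using x by (intro exI[of _ x] exI[of _ k]) simp
qed

lemma wt0_in_root_lattice:
  assumes "(j, p) \<in> I_hat \<sigma> \<epsilon>"
  shows "wt0 j p \<in> L"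
proof -
  obtain x k where xk: "j = orb x" "p = \<xi> (top x) - 2 * k" using I_hat_orb[OF assms] by blast
  obtain vs where vs: "w = refl_word adj vs" by (rule circ_reading, rule that)
  have "refl_word adj vs (frag_of (top x)) - frag_of (top x) \<in> L"
    by (rule refl_word_displacement[OF add_closed_root_lattice simple_root_in_root_lattice])
  then have "frag_of (top x) - w (frag_of (top x)) \<in> L"
    using add_closed_minus[OF add_closed_root_lattice] unfolding vs by fastforce
  then show ?thesis
    unfolding xk wt0_orb by (simp add: int_power_mem_iff[OF bij_t t_root_lattice])
qed

lemma wt_in_root_lattice: "m \<in> carrier M \<Longrightarrow> wt m \<in> L"
proof -
  assume m: "m \<in> carrier M"
  have "wt0_ext m \<in> L"
    using m wt0_in_root_lattice unfolding carrier_M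
    by (intro add_closed_frag_extend[OF add_closed_root_lattice]) auto
  then have "u (wt m) \<in> L" by (simp add: wt_eq[OF m])
  then show ?thesis by (simp only: u_root_lattice)
qed

text \<open>The image of \<open>wt\<close> transported by \<open>u\<close>, so that \<open>t\<close>
  and \<open>w\<close> act on it instead of their conjugates.\<close>

definition wt0_span :: "'v weight set" where
  "wt0_span = generate (free_Abelian_group UNIV) {wt0 j p | j p. (j, p) \<in> I_hat \<sigma> \<epsilon>}"

lemma wt0_span_subset: "add_closed N \<Longrightarrow> (\<And>j p. (j, p) \<in> I_hat \<sigma> \<epsilon> \<Longrightarrow> wt0 j p \<in> N) \<Longrightarrow> wt0_span \<subseteq> N"
  unfolding wt0_span_def
  by (rule generate_subset_add_closed) (auto simp: carrier_free_Abelian_group_iff)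

lemma add_closed_wt0_span: "add_closed wt0_span"
  unfolding wt0_span_def by (rule add_closed_generate) (auto simp: carrier_free_Abelian_group_iff)

lemma wt0_in_span: "(j, p) \<in> I_hat \<sigma> \<epsilon> \<Longrightarrow> wt0 j p \<in> wt0_span"
  unfolding wt0_span_def by (rule generate.incl) blast

lemma wt0_shift: "wt0 j (p - 2 * k) = int_power t k (wt0 j p)"
proof -
  have "Phi j (p - 2 * k - 2 * int (card j)) = int_power t k (Phi j (p - 2 * int (card j)))"
    using Phi_shift[of j "p - 2 * int (card j)" k] by (simp add: algebra_simps)
  then show ?thesis
    by (simp add: wt0_def Phi_shift additive.diff[OF additive_int_power[OF additive_t bij_t]])
qed

lemma int_power_t_span: "v \<in> wt0_span \<Longrightarrow> int_power t k v \<in> wt0_span"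
proof -
  have "wt0_span \<subseteq> int_power t k -` wt0_span"
  proof (rule wt0_span_subset)
    show "add_closed (int_power t k -` wt0_span)"
      by (rule add_closed_vimage[OF additive_int_power[OF additive_t bij_t] add_closed_wt0_span])
    fix j p assume "(j, p) \<in> I_hat \<sigma> \<epsilon>"
    then obtain x where x: "j = orb x" "even (p - \<xi> x)" by (rule I_hatE)
    then have "(j, p - 2 * k) \<in> I_hat \<sigma> \<epsilon>" unfolding x(1) I_hat_iff by simp
    then have "wt0 j (p - 2 * k) \<in> wt0_span" by (rule wt0_in_span)
    then show "wt0 j p \<in> int_power t k -` wt0_span" by (simp add: wt0_shift)
  qed
  then show "v \<in> wt0_span \<Longrightarrow> int_power t k v \<in> wt0_span" by blast
qed

lemma t_span: "t v \<in> wt0_span \<longleftrightarrow> v \<in> wt0_span"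
proof -
  have "t v = int_power t 1 v" "v = int_power t (- 1) (t v)"
    using int_power_add[OF bij_t, of "- 1" 1 v] int_power_of_nat[of t 1] by simp_all
  then show ?thesis using int_power_t_span by metis
qed

text \<open>For \<open>vs = ys @ x # zs\<close> the element \<open>(1 - w) \<varpi>_x\<close> of the
  span is \<open>\<alpha>_x\<close> moved by the word \<open>ys\<close>. The displacement is a
  combination of simple roots at letters of \<open>ys\<close>, which lie in the span by induction,
  so \<open>\<alpha>_x\<close> does too.\<close>

lemma simple_root_in_span: "simple_root adj x \<in> wt0_span"
proof -
  obtain vs where vs: "w = refl_word adj vs" "distinct vs" "set vs = {x. top x = x}"
    by (rule circ_reading, rule that)
  have prefix: "\<forall>z\<in>set ys. simple_root adj z \<in> wt0_span" if "vs = ys @ zs" for ys zs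
    using that
  proof (induction ys arbitrary: zs rule: rev_induct)
    case (snoc x ys)
    then have IH: "\<And>z. z \<in> set ys \<Longrightarrow> simple_root adj z \<in> wt0_span" by simp
    have "x \<in> set vs" using snoc.prems by simp
    then have x: "top x = x" using vs(3) by simp
    have "x \<notin> set ys" "x \<notin> set zs" using vs(2) snoc.prems by auto
    then have "w (frag_of x) = frag_of x - refl_word adj ys (simple_root adj x)"
      by (simp add: vs(1) snoc.prems refl_word_append refl_word_Cons refl_word_frag_of_notin
          reflection_frag_of additive.diff[OF additive_refl_word])
    then have "refl_word adj ys (simple_root adj x) = wt0 (orb x) (\<xi> (top x))"
      using wt0_orb[of x 0] x by simp
    also have "\<dots> \<in> wt0_span"
      using x by (intro wt0_in_span) (simp add: I_hat_iff)
    finally have "simple_root adj x \<in> wt0_span"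
      by (simp add: refl_word_mem_iff[OF add_closed_wt0_span IH])
    then show ?case using IH by auto
  qed simp
  have tops: "\<And>z. z \<in> set vs \<Longrightarrow> simple_root adj z \<in> wt0_span" using prefix[of vs "[]"] by simp
  have "aut_weight \<sigma> v \<in> wt0_span \<longleftrightarrow> v \<in> wt0_span" for v
    using t_span[of v] refl_word_mem_iff[OF add_closed_wt0_span tops] by (simp add: t_eq vs(1))
  then have "simple_root adj (\<sigma> z) \<in> wt0_span \<longleftrightarrow> simple_root adj z \<in> wt0_span" for z
    using aut_weight_simple_root[of \<sigma> adj z] folding(1,2) by metis
  then have "simple_root adj ((\<sigma> ^^ l) z) \<in> wt0_span \<longleftrightarrow> simple_root adj z \<in> wt0_span" for l z
    by (induction l) simp_all
  moreover have "x \<in> orb (top x)" using self_in_orb by simp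
  then obtain l where "x = (\<sigma> ^^ l) (top x)" using orb_memD by blast
  moreover have "simple_root adj (top x) \<in> wt0_span" using tops vs(3) by simp
  ultimately show ?thesis by metis
qed

lemma wt_image: "wt ` carrier M = L"
proof
  show "wt ` carrier M \<subseteq> L" using wt_in_root_lattice by blast
  have car: "carrier M = {m. Poly_Mapping.keys m \<subseteq> I_hat \<sigma> \<epsilon>}" using carrier_M by blast
  have closed: "add_closed (wt ` carrier M)"
    unfolding add_closed_def
  proof (intro conjI ballI)
    show "0 \<in> wt ` carrier M"
      unfolding car using additive.zero[OF additive_wt] by (intro image_eqI[of _ _ 0]) simp_all
    fix a b assume "a \<in> wt ` carrier M" "b \<in> wt ` carrier M"
    then obtain m n where mn: "a = wt m" "m \<in> carrier M" "b = wt n" "n \<in> carrier M" by blast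
    then have "m - n \<in> carrier M"
      unfolding car using add_closed_diff[OF add_closed_keys] by blast
    then show "a - b \<in> wt ` carrier M" unfolding mn additive.diff[OF additive_wt, symmetric] by blast
  qed
  have "wt0_span \<subseteq> inv_into UNIV u -` wt ` carrier M"
  proof (rule wt0_span_subset[OF add_closed_vimage[OF additive_inv_u closed]])
    fix j p assume jp: "(j, p) \<in> I_hat \<sigma> \<epsilon>"
    then have "frag_of (j, p) \<in> carrier M" by (simp add: carrier_M)
    then show "wt0 j p \<in> inv_into UNIV u -` wt ` carrier M"
      using wt_frag_of[OF jp] by (metis imageI vimageI)
  qed
  moreover have "L \<subseteq> wt0_span" by (rule root_lattice_subset[OF add_closed_wt0_span simple_root_in_span])
  ultimately have *: "inv_into UNIV u v \<in> wt ` carrier M" if "v \<in> L" for v using that by blast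
  show "L \<subseteq> wt ` carrier M"
  proof
    fix v assume "v \<in> L"
    then have "u v \<in> L" by (simp only: u_root_lattice)
    from * [OF this] show "v \<in> wt ` carrier M" by simp
  qed
qed

subsection \<open>The kernel\<close>

text \<open>The orbit size recorded in the last two cases shows that the offsets 1 and 2 stay below
  \<open>dd x\<close>.\<close>

lemma nb_in_I_hat:
  assumes ev: "even (p - int (dd x) - \<xi> x)" and j: "j \<in> orbits \<sigma>"
  shows "cartan adj j (orb x) = -1 \<Longrightarrow> (j, p) \<in> I_hat \<sigma> \<epsilon>"
    "cartan adj j (orb x) = -2 \<Longrightarrow> dd x = 2 \<and> (j, p - 1) \<in> I_hat \<sigma> \<epsilon> \<and> (j, p + 1) \<in> I_hat \<sigma> \<epsilon>"
    "cartan adj j (orb x) = -3 \<Longrightarrow> dd x = 3 \<and> (j, p - 2) \<in> I_hat \<sigma> \<epsilon> \<and>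
      (j, p) \<in> I_hat \<sigma> \<epsilon> \<and> (j, p + 2) \<in> I_hat \<sigma> \<epsilon>"
proof -
  have nb: "\<exists>y. j = orb y \<and> even (\<xi> x - \<xi> y - int (min (dd x) (dd y))) \<and>
      cartan adj j (orb x) = (if dd x \<le> dd y then - 1 else - int (dd x)) \<and> (dd x \<le> dd y \<or> dd y = 1)"
    if neg: "cartan adj j (orb x) < 0"
  proof -
    have "j \<in> nb_orbits x"
      using cartan_eq_imp_nb_orbits[OF neg, of x] j by blast
    then obtain y where y: "j = orb y" "adj x y" unfolding nb_orbits_def by blast
    have "even (\<xi> x - \<xi> y - int (min (dd x) (dd y)))"
      using height_adj[OF y(2)] by (meson dvd_mult_left)
    moreover have "dd x \<le> dd y \<or> dd y = 1"
      using dd_eq_cases[of x] dd_eq_cases[of y] dd_pos[of y] by auto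
    ultimately show ?thesis
      using cartan_nb_orbits[OF \<open>j \<in> nb_orbits x\<close>] y(1) by blast
  qed
  show "(j, p) \<in> I_hat \<sigma> \<epsilon>" if c: "cartan adj j (orb x) = -1"
  proof -
    have "cartan adj j (orb x) < 0" using c by simp
    from nb[OF this] obtain y where y: "j = orb y" "even (\<xi> x - \<xi> y - int (min (dd x) (dd y)))"
      "cartan adj j (orb x) = (if dd x \<le> dd y then - 1 else - int (dd x))"
      "dd x \<le> dd y \<or> dd y = 1"
      by blast
    then have "int (min (dd x) (dd y)) = int (dd x)" using c by (auto split: if_splits)
    then show ?thesis using y ev unfolding y(1) I_hat_iff by presburger
  qed
  show "dd x = 2 \<and> (j, p - 1) \<in> I_hat \<sigma> \<epsilon> \<and> (j, p + 1) \<in> I_hat \<sigma> \<epsilon>" if c: "cartan adj j (orb x) = -2"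
  proof -
    have "cartan adj j (orb x) < 0" using c by simp
    from nb[OF this] obtain y where y: "j = orb y" "even (\<xi> x - \<xi> y - int (min (dd x) (dd y)))"
      "cartan adj j (orb x) = (if dd x \<le> dd y then - 1 else - int (dd x))"
      "dd x \<le> dd y \<or> dd y = 1"
      by blast
    have d: "dd x = 2" "dd y = 1" using y(3,4) c by (auto split: if_splits)
    then have "even (\<xi> x - \<xi> y - 1)" "even (p - 2 - \<xi> x)" using ev y(2) by simp_all
    then show ?thesis using d(1) unfolding y(1) I_hat_iff by presburger
  qed
  show "dd x = 3 \<and> (j, p - 2) \<in> I_hat \<sigma> \<epsilon> \<and> (j, p) \<in> I_hat \<sigma> \<epsilon> \<and> (j, p + 2) \<in> I_hat \<sigma> \<epsilon>"
    if c: "cartan adj j (orb x) = -3"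
  proof -
    have "cartan adj j (orb x) < 0" using c by simp
    from nb[OF this] obtain y where y: "j = orb y" "even (\<xi> x - \<xi> y - int (min (dd x) (dd y)))"
      "cartan adj j (orb x) = (if dd x \<le> dd y then - 1 else - int (dd x))"
      "dd x \<le> dd y \<or> dd y = 1"
      by blast
    have d: "dd x = 3" "dd y = 1" using y(3,4) c by (auto split: if_splits)
    then have "even (\<xi> x - \<xi> y - 1)" "even (p - 3 - \<xi> x)" using ev y(2) by simp_all
    then show ?thesis using d(1) unfolding y(1) I_hat_iff by presburger
  qed
qed

text \<open>All factors except the two outer ones have heights strictly between these, so modulo
  \<open>N\<close> only a two-term relation remains. Used with \<open>N\<close> the elements
  supported on \<open>I_hat\<close>, and with \<open>N\<close> the elements reducible to the
  slice.\<close>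

lemma A_elt_mem_iff:
  assumes N: "add_closed N" and ev: "even (p - int (dd x) - \<xi> x)"
    and mid: "\<And>j q. (j, q) \<in> I_hat \<sigma> \<epsilon> \<Longrightarrow> p - int (dd x) < q \<Longrightarrow> q < p + int (dd x) \<Longrightarrow> frag_of (j, q) \<in> N"
  shows "A_elt adj \<sigma> (orb x) p \<in> N \<longleftrightarrow>
    frag_of (orb x, p - int (dd x)) + frag_of (orb x, p + int (dd x)) \<in> N"
proof -
  define s where "s =
     (\<Sum>j | j \<in> orbits \<sigma> \<and> cartan adj j (orb x) = -1. frag_of (j, p))
     + (\<Sum>j | j \<in> orbits \<sigma> \<and> cartan adj j (orb x) = -2. frag_of (j, p - 1) + frag_of (j, p + 1))
     + (\<Sum>j | j \<in> orbits \<sigma> \<and> cartan adj j (orb x) = -3.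
          frag_of (j, p - 2) + frag_of (j, p) + frag_of (j, p + 2))"
  have d: "int (dd x) > 0" using dd_pos[of x] by simp
  have "s \<in> N"
    unfolding s_def
    by (intro add_closed_add[OF N] add_closed_sum[OF N])
      (use nb_in_I_hat[OF ev] d in \<open>auto intro!: mid\<close>)
  moreover have "A_elt adj \<sigma> (orb x) p =
      frag_of (orb x, p - int (dd x)) + frag_of (orb x, p + int (dd x)) - s"
    by (simp add: A_elt_def s_def algebra_simps)
  ultimately show ?thesis
    using add_closed_add[OF N, of "A_elt adj \<sigma> (orb x) p" s] add_closed_diff[OF N] by auto
qed

abbreviation A_gens :: "('v set \<times> int \<Rightarrow>\<^sub>0 int) set" where
  "A_gens \<equiv> {A_elt adj \<sigma> i p | i p. i \<in> orbits \<sigma> \<and> (i, p - int (card i)) \<in> I_hat \<sigma> \<epsilon>}"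
abbreviation MA :: "('v set \<times> int \<Rightarrow>\<^sub>0 int) set" where "MA \<equiv> subgroup_MA adj \<sigma> \<epsilon>"

lemma A_gensE:
  assumes "a \<in> A_gens"
  obtains x p where "a = A_elt adj \<sigma> (orb x) p" "even (p - int (dd x) - \<xi> x)"
proof -
  obtain i p where i: "a = A_elt adj \<sigma> i p" "i \<in> orbits \<sigma>" "(i, p - int (card i)) \<in> I_hat \<sigma> \<epsilon>"
    using assms by blast
  then obtain x where "i = orb x" unfolding orbits_def by blast
  then show ?thesis using that[of x p] i I_hat_iff by simp
qed

lemma A_gens_carrier: "A_gens \<subseteq> carrier M"
proof
  fix a assume "a \<in> A_gens"
  then obtain x p where a: "a = A_elt adj \<sigma> (orb x) p" and ev: "even (p - int (dd x) - \<xi> x)"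
    by (rule A_gensE)
  let ?N = "{m. Poly_Mapping.keys m \<subseteq> I_hat \<sigma> \<epsilon>}"
  have "even (p + int (dd x) - \<xi> x)" using ev by presburger
  then have "frag_of (orb x, p - int (dd x)) + frag_of (orb x, p + int (dd x)) \<in> ?N"
    using ev by (intro add_closed_add[OF add_closed_keys]) (simp_all add: I_hat_iff)
  then have "a \<in> ?N"
    unfolding a by (subst A_elt_mem_iff[OF add_closed_keys ev]) simp_all
  then show "a \<in> carrier M" by (simp add: carrier_M)
qed

lemma wt_A_gens:
  assumes "a \<in> A_gens"
  shows "wt a = 0"
proof -
  obtain x p where a: "a = A_elt adj \<sigma> (orb x) p" and ev: "even (p - int (dd x) - \<xi> x)"
    using assms by (rule A_gensE)
  have "wt0_ext a = 0"
    unfolding a A_elt_def using wt0_relation[OF ev]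
    by (simp add: additive.diff[OF additive_frag_extend] additive.add[OF additive_frag_extend]
        additive.sum[OF additive_frag_extend])
  moreover have "a \<in> carrier M" using A_gens_carrier assms by blast
  ultimately show ?thesis by (simp add: wt_eq additive.zero[OF additive_inv_u])
qed

section \<open>The subgroup generated by the \<open>A_elt\<close> and reduction modulo it\<close>

lemma add_closed_MA: "add_closed MA"
  unfolding subgroup_MA_def group_M_def
  by (rule add_closed_generate) (use A_gens_carrier in \<open>simp add: group_M_def\<close>)

lemma MA_subset: "MA \<subseteq> {m \<in> carrier M. wt m = 0}"
  unfolding subgroup_MA_def group_M_def
proof (rule generate_subset_add_closed)
  show "add_closed {m \<in> carrier (free_Abelian_group (I_hat \<sigma> \<epsilon>)). wt m = 0}"
    using add_closed_keys[of "I_hat \<sigma> \<epsilon>"] additive.zero[OF additive_wt] additive.diff[OF additive_wt]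
    by (auto simp: add_closed_def carrier_free_Abelian_group_iff)
  show "A_gens \<subseteq> {m \<in> carrier (free_Abelian_group (I_hat \<sigma> \<epsilon>)). wt m = 0}"
    using A_gens_carrier wt_A_gens unfolding group_M_def by blast
  show "A_gens \<subseteq> carrier (free_Abelian_group (I_hat \<sigma> \<epsilon>))"
    using A_gens_carrier unfolding group_M_def .
qed

text \<open>On an orbit of size \<open>d\<close> the heights of \<open>I_hat\<close> in
  \<open>[0, 2 d)\<close> are the values of \<open>\<epsilon>\<close>. Indexing them by vertices
  bounds their number by the rank.\<close>

definition slice :: "('v set \<times> int) set" where
  "slice = range (\<lambda>x. (orb x, \<epsilon> x))"

lemma in_slice:
  assumes jp: "(j, p) \<in> I_hat \<sigma> \<epsilon>" and "0 \<le> p" "p < 2 * int (card j)"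
  shows "(j, p) \<in> slice"
proof -
  obtain y where y: "orb y = j" "(y, p) \<in> rep_vertices \<sigma> \<epsilon>" using jp by (rule rep_vertex_exists)
  have "[p = \<epsilon> y] (mod 2 * int (dd y))"
    using y(2) by (simp add: rep_vertices_def orbit_size_def)
  moreover have "0 \<le> \<epsilon> y" "\<epsilon> y < 2 * int (dd y)"
    using parity by (auto simp: parity_function_def orbit_size_def)
  ultimately have "p = \<epsilon> y"
    using assms(2,3) y(1) by (auto simp: cong_def)
  then show ?thesis using y(1) by (auto simp: slice_def)
qed

text \<open>Solving a generator for its upper outer factor lowers a height
  \<open>p \<ge> 2 d\<close>; solving for the lower one raises a negative height. The inner factors
  belong to other orbits, so each induction bounds the heights on all orbits at once.\<close>

lemma reduce_to_slice:
  assumes "m \<in> carrier M"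
  obtains s where "Poly_Mapping.keys s \<subseteq> slice" "m - s \<in> MA"
proof -
  define N where "N = {m. \<exists>s. Poly_Mapping.keys s \<subseteq> slice \<and> m - s \<in> MA}"
  have N: "add_closed N"
    unfolding add_closed_def
  proof (intro conjI ballI)
    show "0 \<in> N" unfolding N_def using add_closed_zero[OF add_closed_MA] by (auto intro!: exI[of _ 0])
    fix a b assume "a \<in> N" "b \<in> N"
    then obtain s s' where s: "Poly_Mapping.keys s \<subseteq> slice" "a - s \<in> MA"
      "Poly_Mapping.keys s' \<subseteq> slice" "b - s' \<in> MA" unfolding N_def by blast
    have "a - b - (s - s') = (a - s) - (b - s')" by simp
    then have "a - b - (s - s') \<in> MA" using add_closed_diff[OF add_closed_MA s(2,4)] by (simp only:)
    moreover have "Poly_Mapping.keys (s - s') \<subseteq> slice"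
      using add_closed_diff[OF add_closed_keys, of s slice s'] s by simp
    ultimately show "a - b \<in> N" unfolding N_def by blast
  qed
  have slice: "frag_of (j, p) \<in> N" if "(j, p) \<in> slice" for j p
    using that add_closed_zero[OF add_closed_MA] by (auto simp: N_def intro!: exI[of _ "frag_of (j, p)"])
  have A: "A_elt adj \<sigma> (orb x) p \<in> N" if "even (p - int (dd x) - \<xi> x)" for x p
  proof -
    have "A_elt adj \<sigma> (orb x) p \<in> MA"
      unfolding subgroup_MA_def
    proof (rule generate.incl)
      have "orb x \<in> orbits \<sigma>" "(orb x, p - int (dd x)) \<in> I_hat \<sigma> \<epsilon>"
        using that by (simp_all add: orbits_def I_hat_iff)
      then show "A_elt adj \<sigma> (orb x) p \<in> A_gens" by blast
    qed
    then show ?thesis by (auto simp: N_def intro!: exI[of _ 0])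
  qed
  \<comment> \<open>For \<open>p \<ge> 2 d\<close> the other heights in the generator centred at
    \<open>p - d\<close> lie in \<open>[p - 2 d, p)\<close>, so they are nonnegative.\<close>
  have up: "\<forall>j p. (j, p) \<in> I_hat \<sigma> \<epsilon> \<and> 0 \<le> p \<and> p < int n \<longrightarrow> frag_of (j, p) \<in> N" for n
  proof (induction n)
    case (Suc n)
    show ?case
    proof (intro allI impI)
      fix j p assume jp: "(j, p) \<in> I_hat \<sigma> \<epsilon> \<and> 0 \<le> p \<and> p < int (Suc n)"
      then obtain x where x: "j = orb x" "even (p - \<xi> x)" using I_hatE by metis
      let ?d = "int (dd x)"
      show "frag_of (j, p) \<in> N"
      proof (cases "p < 2 * ?d")
        case True
        then show ?thesis using in_slice[of j p] jp x(1) slice by blast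
      next
        case False
        have ev: "even (p - ?d - ?d - \<xi> x)" using x(2) by presburger
        have "frag_of (orb x, p - ?d - ?d) + frag_of (orb x, p - ?d + ?d) \<in> N"
          using A[OF ev] A_elt_mem_iff[OF N ev] Suc jp False by auto
        moreover have "frag_of (orb x, p - ?d - ?d) \<in> N"
          using Suc[rule_format, of "orb x" "p - ?d - ?d"] jp False ev dd_pos[of x]
          by (simp add: I_hat_iff)
        ultimately show ?thesis
          using add_closed_diff[OF N] x(1) by fastforce
      qed
    qed
  qed auto
  \<comment> \<open>No upper bound on \<open>p\<close>: the generator centred at
    \<open>p + d\<close> involves heights up to \<open>p + 2 d\<close>, possibly above the
    slice.\<close>
  have down: "\<forall>j p. (j, p) \<in> I_hat \<sigma> \<epsilon> \<and> - int n \<le> p \<longrightarrow> frag_of (j, p) \<in> N" for n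
  proof (induction n)
    case 0
    have "frag_of (j, p) \<in> N" if "(j, p) \<in> I_hat \<sigma> \<epsilon>" "0 \<le> p" for j p
      using up[of "nat p + 1"] that by simp
    then show ?case by simp
  next
    case (Suc n)
    show ?case
    proof (intro allI impI)
      fix j p assume jp: "(j, p) \<in> I_hat \<sigma> \<epsilon> \<and> - int (Suc n) \<le> p"
      then obtain x where x: "j = orb x" "even (p - \<xi> x)" using I_hatE by metis
      let ?d = "int (dd x)"
      have d: "?d > 0" using dd_pos[of x] by simp
      have ev: "even (p + ?d - ?d - \<xi> x)" using x(2) by simp
      have "frag_of (orb x, p + ?d - ?d) + frag_of (orb x, p + ?d + ?d) \<in> N"
        using A[OF ev] A_elt_mem_iff[OF N ev] Suc jp by auto
      moreover have "frag_of (orb x, p + ?d + ?d) \<in> N"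
        using Suc[rule_format, of "orb x" "p + ?d + ?d"] jp d x(2) by (simp add: I_hat_iff)
      ultimately show "frag_of (j, p) \<in> N"
        using add_closed_diff[OF N] x(1) by fastforce
    qed
  qed
  have frag: "frag_of y \<in> N" if "y \<in> I_hat \<sigma> \<epsilon>" for y
  proof -
    obtain j p where y: "y = (j, p)" by (cases y)
    have "- int (nat (- p)) \<le> p" by simp
    then show ?thesis using down[of "nat (- p)"] that unfolding y by blast
  qed
  have "m \<in> N"
    using assms unfolding carrier_M
  proof (induction m rule: frag_induction)
    case (diff a b)
    then show ?case by (rule add_closed_diff[OF N])
  qed (use frag add_closed_zero[OF N] in auto)
  then show ?thesis using that unfolding N_def by blast
qed

text \<open>The slice has at most as many elements as the diagram has vertices, and its weights span a
  lattice of that rank.\<close>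

lemma wt_inj_on_slice:
  assumes s: "Poly_Mapping.keys s \<subseteq> slice" and "wt s = 0"
  shows "s = 0"
proof -
  define vec :: "'v weight \<Rightarrow> real^'v" where "vec = (\<lambda>v. \<chi> y. real_of_int (poly_mapping.lookup v y))"
  define F where "F = (\<lambda>y. vec (wt (frag_of y)))"
  have vec: "additive vec" by (simp add: additive_def vec_def lookup_add vec_eq_iff)
  have vec_cmul: "vec (frag_cmul c v) = real_of_int c *\<^sub>R vec v" for c v
    by (simp add: vec_def vec_eq_iff)
  have fin: "finite slice" and card: "card slice \<le> CARD('v)"
    unfolding slice_def by (simp_all add: card_image_le)
  have closed: "add_closed (vec -` span (F ` slice))"
    by (rule add_closed_vimage[OF vec]) (simp add: add_closed_def span_zero span_diff)
  have wt_ext: "wt m = frag_extend (\<lambda>y. wt (frag_of y)) m" for m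
    by (rule additive_frag_eqI[OF additive_wt additive_frag_extend]) simp
  have "wt m \<in> vec -` span (F ` slice)" if m: "m \<in> carrier M" for m
  proof -
    obtain s where s: "Poly_Mapping.keys s \<subseteq> slice" "m - s \<in> MA" using m by (rule reduce_to_slice)
    then have "wt (m - s) = 0" using MA_subset by blast
    then have "wt m = wt s" by (simp add: additive.diff[OF additive_wt])
    also have "\<dots> \<in> vec -` span (F ` slice)"
      unfolding wt_ext[of s] using s(1)
      by (intro add_closed_frag_extend[OF closed]) (auto simp: F_def intro: span_base)
    finally show ?thesis .
  qed
  then have "vec (simple_root adj x) \<in> span (F ` slice)" for x
    using wt_image simple_root_in_root_lattice[of adj x] by (metis imageE vimageE)
  then have "range (\<lambda>x. vec (simple_root adj x)) \<subseteq> span (F ` slice)" by blast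
  then have span: "span (F ` slice) = UNIV"
    using real_span_simple_roots[OF ade] span_minimal[OF _ subspace_span] unfolding vec_def by blast
  have card_F: "card (F ` slice) \<le> CARD('v)"
    using card card_image_le[OF fin, of F] by linarith
  have dim: "dim (UNIV :: (real^'v) set) = CARD('v)" by simp
  have indep: "independent (F ` slice)"
    by (rule card_le_dim_spanning[of _ UNIV]) (use span fin card_F dim in auto)
  have "CARD('v) \<le> card (F ` slice)"
    using span dim_le_card[of UNIV "F ` slice"] fin dim by simp
  \<comment> \<open>Without injectivity, slice elements of equal weight would merge in the image of
    \<open>F\<close>, and its independence would not separate their coefficients.\<close>
  then have "card (F ` slice) = card slice" using card card_F card_image_le[OF fin, of F] by linarith
  then have inj: "inj_on F slice" using fin by (rule eq_card_imp_inj_on[rotated])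
  have "0 = vec (wt s)" using assms(2) by (simp add: additive.zero[OF vec])
  also have "\<dots> = (\<Sum>y\<in>Poly_Mapping.keys s. real_of_int (poly_mapping.lookup s y) *\<^sub>R F y)"
    by (subst wt_ext) (simp add: frag_extend_def additive.sum[OF vec] vec_cmul F_def)
  also have "\<dots> = (\<Sum>y\<in>slice. real_of_int (poly_mapping.lookup s y) *\<^sub>R F y)"
    using s fin by (intro sum.mono_neutral_left) (auto simp: in_keys_iff)
  also have "\<dots> = (\<Sum>v\<in>F ` slice. real_of_int (poly_mapping.lookup s (inv_into slice F v)) *\<^sub>R v)"
    using inj by (simp add: sum.reindex)
  finally have sum0: "(\<Sum>v\<in>F ` slice. real_of_int (poly_mapping.lookup s (inv_into slice F v)) *\<^sub>R v) = 0" ..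
  have "poly_mapping.lookup s y = 0" if "y \<in> slice" for y
    using independentD[OF indep _ _ sum0, of "F y"] that fin inj by simp
  then have "poly_mapping.lookup s y = 0" for y
    using s by (cases "y \<in> slice") (auto simp: in_keys_iff)
  then show "s = 0" by (intro poly_mapping_eqI) simp
qed

lemma group_M_group: "group M"
  by (simp add: group_M_def)

lemma mult_M [simp]: "x \<otimes>\<^bsub>M\<^esub> y = x + y"
  by (simp add: group_M_def)

lemma wt_hom: "wt \<in> hom M (root_lattice adj)"
  using wt_in_root_lattice by (auto simp: hom_def additive.add[OF additive_wt])

lemma kernel_wt: "kernel M (root_lattice adj) wt = MA"
proof
  show "MA \<subseteq> kernel M (root_lattice adj) wt" using MA_subset by (auto simp: kernel_def)
  show "kernel M (root_lattice adj) wt \<subseteq> MA"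
  proof
    fix m assume "m \<in> kernel M (root_lattice adj) wt"
    then have m: "m \<in> carrier M" "wt m = 0" by (auto simp: kernel_def)
    obtain s where s: "Poly_Mapping.keys s \<subseteq> slice" "m - s \<in> MA" using m(1) by (rule reduce_to_slice)
    then have "wt (m - s) = 0" using MA_subset by blast
    then have "wt s = 0" using m(2) by (simp add: additive.diff[OF additive_wt])
    then have "s = 0" by (rule wt_inj_on_slice[OF s(1)])
    then show "m \<in> MA" using s(2) by simp
  qed
qed

end

theorem proposition4p14:
  fixes adj :: "'v::finite \<Rightarrow> 'v \<Rightarrow> bool"
    and \<sigma> :: "'v \<Rightarrow> 'v"
    and \<epsilon> \<xi> :: "'v \<Rightarrow> int"
  assumes "Q_datum adj \<sigma> \<xi>"
    and "parity_function adj \<sigma> \<epsilon>"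
    and "height_compatible \<sigma> \<epsilon> \<xi>"
  shows "wt_Q adj \<sigma> \<epsilon> \<xi> \<in> hom (group_M \<sigma> \<epsilon>) (root_lattice adj) \<and>
         (\<exists>\<psi> \<in> iso (group_M \<sigma> \<epsilon> Mod subgroup_MA adj \<sigma> \<epsilon>) (root_lattice adj).
            \<forall>m \<in> carrier (group_M \<sigma> \<epsilon>). \<psi> (subgroup_MA adj \<sigma> \<epsilon> #>\<^bsub>group_M \<sigma> \<epsilon>\<^esub> m) = wt_Q adj \<sigma> \<epsilon> \<xi> m)"
proof -
  interpret q_data adj \<sigma> \<epsilon> \<xi> using assms by unfold_locales
  interpret group_hom M "root_lattice adj" wt
    by (intro group_hom.intro group_hom_axioms.intro group_M_group group_root_lattice wt_hom)
  have "(\<lambda>X. the_elem (wt ` X)) \<in> iso (M Mod MA) (root_lattice adj)"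
    using FactGroup_iso_set[OF wt_image] by (simp only: kernel_wt)
  \<comment> \<open>The homomorphism theorem supplies its isomorphism in terms of
    \<open>the_elem\<close>; on a coset \<open>wt\<close> is constant because it vanishes on
    \<open>MA\<close>.\<close>
  moreover have "the_elem (wt ` (MA #>\<^bsub>M\<^esub> m)) = wt m" for m
  proof -
    have "wt ` (MA #>\<^bsub>M\<^esub> m) = (\<lambda>a. wt a + wt m) ` MA"
      by (auto simp: r_coset_def additive.add[OF additive_wt, symmetric])
    also have "\<dots> = {wt m}"
      using MA_subset add_closed_zero[OF add_closed_MA] by (force simp: additive.zero[OF additive_wt])
    finally show ?thesis by simp
  qed
  ultimately show ?thesis using wt_hom by (intro conjI bexI[where x = "\<lambda>X. the_elem (wt ` X)"]) simp_all
qed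

end
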